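(* Let $E\to M$ be a Lie algebroid with structure functions $(\rho_a^i,C_{ab}^f)$. Any regular Lagrangian $\mathcal L\in C^\infty(E)$ defines a canonical N-connection on the prolongation Lie algebroid $\mathcal T^EE$, with coefficients $$\widetilde{\mathcal N}_a^f=-\tfrac12\Big(\frac{\partial\varphi^f}{\partial y^a}+y^bC_{ba}^f\Big),$$ where $$\varphi^e=\tilde g^{eb}\Big(\rho_b^i\frac{\partial\mathcal L}{\partial x^i}-\rho_a^i\frac{\partial^2\mathcal L}{\partial x^i\partial y^b}y^a-C_{ba}^f\frac{\partial\mathcal L}{\partial y^f}y^a\Big)$$ are the components of the semi-spray $\Gamma_{\mathcal L}=y^a\mathcal X_a+\varphi^a\mathcal V_a$ encoding the solutions of the Euler–Lagrange equations $$\frac{dx^i}{d\tau}=\rho_a^iy^a,\qquad \frac{d}{d\tau}\Big(\frac{\partial\mathcal L}{\partial y^a}\Big)+y^bC_{ab}^f\frac{\partial\mathcal L}{\partial y^f}-\rho_a^i\frac{\partial\mathcal L}{\partial x^i}=0$$ (the integral curves of the anchor image of $\Gamma_{\mathcal L}$ are the solutions). That is, the local sections $\widetilde\delta_a=\mathcal X_a-\widetilde{\mathcal N}_a^f\mathcal V_f$ span a globally well-defined subbundle of $\mathcal T^EE$ complementary to the vertical subbundle.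
   Context: All objects are smooth. $(E,\lfloor\cdot,\cdot\rfloor,\rho)$ is a Lie algebroid of rank $m$ over $M$, with local coordinates $x^i$ on $M$, local basis of sections $e_a$, fibre coordinates $y^a$ on $E$, $\rho(e_a)=\rho_a^i(x)\partial_i$, $\lfloor e_a,e_b\rfloor=C_{ab}^f(x)e_f$. The prolongation $\mathcal T^EE\to E$ (over $\pi:E\to M$) is the Lie algebroid with fibre over $p\in E$ equal to $\{(b,v)\in E_{\pi(p)}\times T_pE:\rho(b)=T_p\pi(v)\}$ and anchor $(b,v)\mapsto v$. It has local basis $\mathcal X_a=(e_a,\rho_a^i\partial_i)$, $\mathcal V_a=(0,\partial/\partial y^a)$ with brackets $\lfloor\mathcal X_a,\mathcal X_b\rfloor^\pi=C_{ab}^f\mathcal X_f$ and all other brackets of basis sections zero. The vertical subbundle $v\mathcal T^EE$ is spanned by the $\mathcal V_a$. An N-connection on $\mathcal T^EE$ is a splitting $\mathcal T^EE=h\mathcal T^EE\oplus v\mathcal T^EE$. Its coefficients $\mathcal N_a^f$ are defined by the requirement that $h\mathcal T^EE$ is locally spanned by $\mathcal X_a-\mathcal N_a^f\mathcal V_f$. $\mathcal L$ is regular if the Hessian $\tilde g_{ab}=\partial^2\mathcal L/\partial y^a\partial y^b$ satisfies $\det(\tilde g_{ab})\neq0$ everywhere; $\tilde g^{ab}$ is the inverse matrix. *)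

theory Defs
  imports "HOL-Analysis.Analysis" "HOL-Library.Function_Algebras"
begin

text \<open>Functions into a real vector space form a real vector space. Tangent vectors are below
  functionals on real functions, so this makes \<^const>\<open>span\<close> and \<^const>\<open>subspace\<close> available for them.\<close>

instantiation "fun" :: (type, real_vector) real_vector
begin

definition scaleR_fun_def: "r *\<^sub>R f = (\<lambda>x. r *\<^sub>R f x)"

instance
  by standard (simp_all add: scaleR_fun_def fun_eq_iff scaleR_add_right scaleR_add_left)

end

section \<open>Smooth manifolds\<close>

primrec Ck_on ::
  "nat \<Rightarrow> 'a::real_normed_vector set \<Rightarrow> ('a \<Rightarrow> 'b::real_normed_vector) \<Rightarrow> bool" where
  "Ck_on 0 S f \<longleftrightarrow> continuous_on S f"
| "Ck_on (Suc k) S f \<longleftrightarrow> (\<forall>x\<in>S. f differentiable (at x)) \<and>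
     (\<forall>v. Ck_on k S (\<lambda>x. frechet_derivative f (at x) v))"

text \<open>Used for open subsets \<open>S\<close> of finite-dimensional spaces only.\<close>

definition smooth_on :: "'a::real_normed_vector set \<Rightarrow> ('a \<Rightarrow> 'b::real_normed_vector) \<Rightarrow> bool" where
  "smooth_on S f \<longleftrightarrow> (\<forall>k. Ck_on k S f)"

text \<open>A chart is a pair of a domain and a coordinate map; the values of the map outside the domain
  are irrelevant.\<close>

type_synonym ('p, 'e) chart = "'p set \<times> ('p \<Rightarrow> 'e)"

definition chart_inv :: "('p, 'e) chart \<Rightarrow> 'e \<Rightarrow> 'p" where
  "chart_inv c = inv_into (fst c) (snd c)"

definition atlas_carrier :: "('p, 'e) chart set \<Rightarrow> 'p set" where
  "atlas_carrier A = (\<Union>c\<in>A. fst c)"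

definition atlas_topology :: "('p, 'e::real_normed_vector) chart set \<Rightarrow> 'p topology" where
  "atlas_topology A =
     topology (\<lambda>W. W \<subseteq> atlas_carrier A \<and> (\<forall>c\<in>A. open (snd c ` (W \<inter> fst c))))"

lemma openin_atlas_topology:
  assumes "\<forall>c\<in>A. inj_on (snd c) (fst c)"
  shows "openin (atlas_topology A) W \<longleftrightarrow>
    W \<subseteq> atlas_carrier A \<and> (\<forall>c\<in>A. open (snd c ` (W \<inter> fst c)))"
proof -
  let ?P = "\<lambda>W. W \<subseteq> atlas_carrier A \<and> (\<forall>c\<in>A. open (snd c ` (W \<inter> fst c)))"
  have "?P (S \<inter> T)" if "?P S" "?P T" for S T
  proof -
    have "open (snd c ` (S \<inter> T \<inter> fst c))" if "c \<in> A" for c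
    proof -
      have "snd c ` (S \<inter> T \<inter> fst c) = snd c ` (S \<inter> fst c) \<inter> snd c ` (T \<inter> fst c)"
        using assms that unfolding inj_on_def by blast
      then show ?thesis using \<open>?P S\<close> \<open>?P T\<close> that by (simp add: open_Int)
    qed
    then show ?thesis using that by blast
  qed
  moreover have "?P (\<Union>K)" if "\<forall>S\<in>K. ?P S" for K
  proof -
    have "snd c ` (\<Union>K \<inter> fst c) = (\<Union>S\<in>K. snd c ` (S \<inter> fst c))" for c :: "('a, 'b) chart"
      by blast
    then show ?thesis using that by (auto intro!: open_UN)
  qed
  ultimately have "istopology ?P" unfolding istopology_def by blast
  then show ?thesis by (simp add: atlas_topology_def topology_inverse')
qed

definition charts_compatible ::
  "('p, 'e::real_normed_vector) chart \<Rightarrow> ('p, 'e) chart \<Rightarrow> bool" where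
  "charts_compatible c d \<longleftrightarrow>
     open (snd c ` (fst c \<inter> fst d)) \<and> open (snd d ` (fst c \<inter> fst d)) \<and>
     smooth_on (snd c ` (fst c \<inter> fst d)) (snd d \<circ> chart_inv c) \<and>
     smooth_on (snd d ` (fst c \<inter> fst d)) (snd c \<circ> chart_inv d)"

definition is_chart :: "('p, 'e::real_normed_vector) chart \<Rightarrow> bool" where
  "is_chart c \<longleftrightarrow> inj_on (snd c) (fst c) \<and> open (snd c ` fst c)"

text \<open>A smooth manifold whose underlying set is the type \<open>'p\<close>, given by its maximal atlas.\<close>

definition smooth_manifold :: "('p, 'e::real_normed_vector) chart set \<Rightarrow> bool" where
  "smooth_manifold A \<longleftrightarrow>
     (\<forall>c\<in>A. is_chart c) \<and>
     (\<forall>c\<in>A. \<forall>d\<in>A. charts_compatible c d) \<and>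
     (\<forall>c. is_chart c \<and> (\<forall>d\<in>A. charts_compatible c d) \<longrightarrow> c \<in> A) \<and>
     atlas_carrier A = UNIV \<and>
     Hausdorff_space (atlas_topology A) \<and>
     second_countable (atlas_topology A)"

definition smooth_fun ::
  "('p, 'e::real_normed_vector) chart set \<Rightarrow> 'p set \<Rightarrow> ('p \<Rightarrow> real) \<Rightarrow> bool" where
  "smooth_fun A W f \<longleftrightarrow> (\<forall>c\<in>A. smooth_on (snd c ` (W \<inter> fst c)) (f \<circ> chart_inv c))"

definition smooth_near ::
  "('p, 'e::real_normed_vector) chart set \<Rightarrow> 'p \<Rightarrow> ('p \<Rightarrow> real) \<Rightarrow> bool" where
  "smooth_near A p f \<longleftrightarrow> (\<exists>W. openin (atlas_topology A) W \<and> p \<in> W \<and> smooth_fun A W f)"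

text \<open>The tangent vector at \<open>p\<close> with coordinates \<open>w\<close> in the chart \<open>c\<close>, as an operator on functions
  smooth near \<open>p\<close>; to make it a total functional it is set to \<open>0\<close> on all other functions.\<close>

definition tangent_vec ::
  "('p, 'e::real_normed_vector) chart set \<Rightarrow> ('p, 'e) chart \<Rightarrow> 'p \<Rightarrow> 'e \<Rightarrow> ('p \<Rightarrow> real) \<Rightarrow> real" where
  "tangent_vec A c p w =
     (\<lambda>f. if smooth_near A p f then frechet_derivative (f \<circ> chart_inv c) (at (snd c p)) w else 0)"

definition tangent_space ::
  "('p, 'e::real_normed_vector) chart set \<Rightarrow> 'p \<Rightarrow> (('p \<Rightarrow> real) \<Rightarrow> real) set" where
  "tangent_space A p = {v. \<exists>c\<in>A. p \<in> fst c \<and> (\<exists>w. v = tangent_vec A c p w)}"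

section \<open>Lie algebroids\<close>

text \<open>The data of a Lie algebroid over the manifold \<open>'m\<close>. The model space \<open>'e\<close> of the base carries
  an orthonormal basis \<open>model_basis\<close> (so \<open>'e\<close> is Euclidean \<open>n\<close>-space, \<open>n = card model_basis\<close>); unlike
  \<^class>\<open>euclidean_space\<close> this allows \<open>n = 0\<close>, i.e. Lie algebras. The fibre over \<open>q\<close> is a linear
  subspace of an ambient vector space \<open>'v\<close> without further structure, so the total space is the set
  of pairs \<open>(q, u)\<close> with \<open>u \<in> fibre q\<close>, and a section is a function \<open>'m \<Rightarrow> 'v\<close>. The smooth structure
  of the bundle is given by local frames, i.e. by local trivialisations; the rank is \<open>CARD('k)\<close>.\<close>

type_synonym ('m, 'v, 'k) frame = "'k \<Rightarrow> 'm \<Rightarrow> 'v"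

record ('m, 'e, 'v, 'k) algebroid =
  atlas :: "('m, 'e) chart set"
  model_basis :: "'e set"
  fibre :: "'m \<Rightarrow> 'v set"
  frames :: "('m set \<times> ('m, 'v, 'k) frame) set"
  bracket :: "('m \<Rightarrow> 'v) \<Rightarrow> ('m \<Rightarrow> 'v) \<Rightarrow> 'm \<Rightarrow> 'v"
  anchor :: "'m \<Rightarrow> 'v \<Rightarrow> ('m \<Rightarrow> real) \<Rightarrow> real"

definition orthonormal_basis :: "'e::real_inner set \<Rightarrow> bool" where
  "orthonormal_basis B \<longleftrightarrow>
     finite B \<and> (\<forall>i\<in>B. \<forall>j\<in>B. i \<bullet> j = (if i = j then 1 else 0)) \<and> span B = UNIV"

definition base_open :: "('m, 'e::real_inner, 'v, 'k) algebroid \<Rightarrow> 'm set \<Rightarrow> bool" where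
  "base_open D U \<longleftrightarrow> openin (atlas_topology (atlas D)) U"

definition frame_basis_at ::
  "('m, 'e, 'v::real_vector, 'k) algebroid \<Rightarrow> ('m, 'v, 'k) frame \<Rightarrow> 'm \<Rightarrow> bool" where
  "frame_basis_at D e q \<longleftrightarrow>
     inj (\<lambda>a. e a q) \<and> independent (range (\<lambda>a. e a q)) \<and> span (range (\<lambda>a. e a q)) = fibre D q"

definition frame_coords ::
  "('m, 'v::real_vector, 'k::finite) frame \<Rightarrow> 'm \<Rightarrow> 'v \<Rightarrow> real ^ 'k" where
  "frame_coords e q u = (\<chi> a. representation (range (\<lambda>b. e b q)) u (e a q))"

definition smooth_vector_bundle ::
  "('m, 'e::real_inner, 'v::real_vector, 'k::finite) algebroid \<Rightarrow> bool" where
  "smooth_vector_bundle D \<longleftrightarrow>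
     (\<Union>(V, e)\<in>frames D. V) = UNIV \<and>
     (\<forall>(V, e)\<in>frames D. base_open D V \<and> (\<forall>q\<in>V. frame_basis_at D e q)) \<and>
     (\<forall>(V, e)\<in>frames D. \<forall>(V', e')\<in>frames D. \<forall>a b.
        smooth_fun (atlas D) (V \<inter> V') (\<lambda>q. frame_coords e' q (e a q) $ b))"

definition smooth_section ::
  "('m, 'e::real_inner, 'v::real_vector, 'k::finite) algebroid \<Rightarrow> 'm set \<Rightarrow> ('m \<Rightarrow> 'v) \<Rightarrow> bool" where
  "smooth_section D U s \<longleftrightarrow>
     (\<forall>q\<in>U. s q \<in> fibre D q) \<and>
     (\<forall>(V, e)\<in>frames D. \<forall>a. smooth_fun (atlas D) (U \<inter> V) (\<lambda>q. frame_coords e q (s q) $ a))"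

abbreviation global_sections ::
  "('m, 'e::real_inner, 'v::real_vector, 'k::finite) algebroid \<Rightarrow> ('m \<Rightarrow> 'v) set" where
  "global_sections D \<equiv> {s. smooth_section D UNIV s}"

definition lie_algebroid ::
  "('m, 'e::real_inner, 'v::real_vector, 'k::finite) algebroid \<Rightarrow> bool" where
  "lie_algebroid D \<longleftrightarrow>
     orthonormal_basis (model_basis D) \<and> smooth_manifold (atlas D) \<and> smooth_vector_bundle D \<and>
     \<comment> \<open>the anchor is a smooth bundle map to the tangent bundle\<close>
     (\<forall>q. \<forall>u\<in>fibre D q. anchor D q u \<in> tangent_space (atlas D) q) \<and>
     (\<forall>q. \<forall>u\<in>fibre D q. \<forall>w\<in>fibre D q. anchor D q (u + w) = anchor D q u + anchor D q w) \<and>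
     (\<forall>q. \<forall>u\<in>fibre D q. \<forall>r. anchor D q (r *\<^sub>R u) = r *\<^sub>R anchor D q u) \<and>
     (\<forall>U s f. base_open D U \<and> smooth_section D U s \<and> smooth_fun (atlas D) U f \<longrightarrow>
        smooth_fun (atlas D) U (\<lambda>q. anchor D q (s q) f)) \<and>
     \<comment> \<open>the bracket is a Lie bracket on the space of sections\<close>
     (\<forall>s\<in>global_sections D. \<forall>t\<in>global_sections D. bracket D s t \<in> global_sections D) \<and>
     (\<forall>s\<in>global_sections D. \<forall>s'\<in>global_sections D. \<forall>t\<in>global_sections D.
        bracket D (s + s') t = bracket D s t + bracket D s' t) \<and>
     (\<forall>r. \<forall>s\<in>global_sections D. \<forall>t\<in>global_sections D.
        bracket D (r *\<^sub>R s) t = r *\<^sub>R bracket D s t) \<and>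
     (\<forall>s\<in>global_sections D. \<forall>t\<in>global_sections D. bracket D s t = - bracket D t s) \<and>
     (\<forall>s\<in>global_sections D. \<forall>t\<in>global_sections D. \<forall>u\<in>global_sections D.
        bracket D s (bracket D t u) + bracket D t (bracket D u s) + bracket D u (bracket D s t) = 0) \<and>
     \<comment> \<open>Leibniz rule\<close>
     (\<forall>s\<in>global_sections D. \<forall>t\<in>global_sections D. \<forall>f. smooth_fun (atlas D) UNIV f \<longrightarrow>
        bracket D s (\<lambda>q. f q *\<^sub>R t q) = (\<lambda>q. f q *\<^sub>R bracket D s t q + anchor D q (s q) f *\<^sub>R t q))"

text \<open>The bracket at \<open>q\<close> of sections defined only near \<open>q\<close>: the bracket of global sections with the
  same germs at \<open>q\<close>, which exist and whose choice does not matter by the Leibniz rule.\<close>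

definition germ_eq ::
  "('m, 'e::real_inner, 'v, 'k) algebroid \<Rightarrow> 'm \<Rightarrow> ('m \<Rightarrow> 'v) \<Rightarrow> ('m \<Rightarrow> 'v) \<Rightarrow> bool" where
  "germ_eq D q s t \<longleftrightarrow> (\<exists>W. base_open D W \<and> q \<in> W \<and> (\<forall>x\<in>W. s x = t x))"

definition local_bracket ::
  "('m, 'e::real_inner, 'v::real_vector, 'k::finite) algebroid \<Rightarrow> ('m \<Rightarrow> 'v) \<Rightarrow> ('m \<Rightarrow> 'v) \<Rightarrow> 'm \<Rightarrow> 'v"
  where
  "local_bracket D s t q =
     (THE w. \<exists>s'\<in>global_sections D. \<exists>t'\<in>global_sections D.
        germ_eq D q s s' \<and> germ_eq D q t t' \<and> w = bracket D s' t' q)"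

section \<open>Adapted coordinates and the prolongation\<close>

text \<open>Adapted coordinates consist of an open set \<open>U\<close>, coordinates \<open>x\<^sup>i\<close> on \<open>U\<close> and a basis \<open>e\<^sub>a\<close> of
  sections over \<open>U\<close>. They induce the chart \<open>(x\<^sup>i, y\<^sup>a)\<close> of the total space.\<close>

type_synonym ('m, 'e, 'v, 'k) coords = "'m set \<times> ('m \<Rightarrow> 'e) \<times> ('m, 'v, 'k) frame"

abbreviation coord_dom :: "('m, 'e, 'v, 'k) coords \<Rightarrow> 'm set" where "coord_dom c \<equiv> fst c"
abbreviation coord_map :: "('m, 'e, 'v, 'k) coords \<Rightarrow> 'm \<Rightarrow> 'e" where "coord_map c \<equiv> fst (snd c)"
abbreviation coord_frame :: "('m, 'e, 'v, 'k) coords \<Rightarrow> ('m, 'v, 'k) frame" where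
  "coord_frame c \<equiv> snd (snd c)"

definition adapted_coords ::
  "('m, 'e::real_inner, 'v::real_vector, 'k::finite) algebroid \<Rightarrow> ('m, 'e, 'v, 'k) coords set" where
  "adapted_coords D = {(U, x, e).
     (U, x) \<in> atlas D \<and> (\<forall>a. smooth_section D U (e a)) \<and> (\<forall>q\<in>U. frame_basis_at D e q)}"

definition total_space :: "('m, 'e, 'v, 'k) algebroid \<Rightarrow> ('m \<times> 'v) set" where
  "total_space D = (SIGMA q:UNIV. fibre D q)"

definition total_chart ::
  "('m, 'e, 'v::real_vector, 'k::finite) algebroid \<Rightarrow> ('m, 'e, 'v, 'k) coords \<Rightarrow>
   ('m \<times> 'v, 'e \<times> (real ^ 'k)) chart" where
  "total_chart D c =
     ((SIGMA q:coord_dom c. fibre D q), (\<lambda>(q, u). (coord_map c q, frame_coords (coord_frame c) q u)))"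

definition total_atlas ::
  "('m, 'e::real_inner, 'v::real_vector, 'k::finite) algebroid \<Rightarrow>
   ('m \<times> 'v, 'e \<times> (real ^ 'k)) chart set" where
  "total_atlas D = total_chart D ` adapted_coords D"

definition fibre_coord ::
  "('m, 'e, 'v::real_vector, 'k::finite) coords \<Rightarrow> 'k \<Rightarrow> 'm \<times> 'v \<Rightarrow> real" where
  "fibre_coord c a p = frame_coords (coord_frame c) (fst p) (snd p) $ a"

text \<open>Elements of the prolongation are pairs \<open>(b, v)\<close>; \<open>v (f \<circ> fst)\<close> is the derivative of \<open>f\<close> along the
  image of \<open>v\<close> under the tangent map of the bundle projection \<open>fst\<close>.\<close>

type_synonym ('m, 'v) prolongation_elem = "'v \<times> (('m \<times> 'v \<Rightarrow> real) \<Rightarrow> real)"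

definition prolongation ::
  "('m, 'e::real_inner, 'v::real_vector, 'k::finite) algebroid \<Rightarrow> 'm \<times> 'v \<Rightarrow>
   ('m, 'v) prolongation_elem set" where
  "prolongation D p = {(b, v). b \<in> fibre D (fst p) \<and> v \<in> tangent_space (total_atlas D) p \<and>
     (\<forall>f. smooth_near (atlas D) (fst p) f \<longrightarrow> anchor D (fst p) b f = v (f \<circ> fst))}"

definition prolongation_anchor ::
  "('m, 'v) prolongation_elem \<Rightarrow> ('m \<times> 'v \<Rightarrow> real) \<Rightarrow> real" where
  "prolongation_anchor z = snd z"

text \<open>Structure functions \<open>\<rho>\<^sub>a\<^sup>i\<close> and \<open>C\<^sub>a\<^sub>b\<^sup>f\<close>, as functions on the base; \<open>\<rho>\<^sub>a\<^sup>i\<close> is the vector \<open>\<rho>(e\<^sub>a)\<close>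
  applied to the coordinate function \<open>x\<^sup>i\<close>.\<close>

definition rho ::
  "('m, 'e::real_inner, 'v, 'k) algebroid \<Rightarrow> ('m, 'e, 'v, 'k) coords \<Rightarrow> 'k \<Rightarrow> 'e \<Rightarrow> 'm \<Rightarrow> real" where
  "rho D c a i q = anchor D q (coord_frame c a q) (\<lambda>q'. coord_map c q' \<bullet> i)"

definition struct_C ::
  "('m, 'e::real_inner, 'v::real_vector, 'k::finite) algebroid \<Rightarrow> ('m, 'e, 'v, 'k) coords \<Rightarrow>
   'k \<Rightarrow> 'k \<Rightarrow> 'k \<Rightarrow> 'm \<Rightarrow> real" where
  "struct_C D c a b f q =
     frame_coords (coord_frame c) q (local_bracket D (coord_frame c a) (coord_frame c b) q) $ f"

text \<open>The basis \<open>\<X>\<^sub>a = (e\<^sub>a, \<rho>\<^sub>a\<^sup>i \<partial>\<^sub>i)\<close>, \<open>\<V>\<^sub>a = (0, \<partial>/\<partial>y\<^sup>a)\<close> of the prolongation.\<close>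

definition prol_X ::
  "('m, 'e::real_inner, 'v::real_vector, 'k::finite) algebroid \<Rightarrow> ('m, 'e, 'v, 'k) coords \<Rightarrow>
   'k \<Rightarrow> 'm \<times> 'v \<Rightarrow> ('m, 'v) prolongation_elem" where
  "prol_X D c a p = (coord_frame c a (fst p),
     (\<Sum>i\<in>model_basis D. rho D c a i (fst p) *\<^sub>R
        tangent_vec (total_atlas D) (total_chart D c) p (i, 0)))"

definition prol_V ::
  "('m, 'e::real_inner, 'v::real_vector, 'k::finite) algebroid \<Rightarrow> ('m, 'e, 'v, 'k) coords \<Rightarrow>
   'k \<Rightarrow> 'm \<times> 'v \<Rightarrow> ('m, 'v) prolongation_elem" where
  "prol_V D c a p = (0, tangent_vec (total_atlas D) (total_chart D c) p (0, axis a 1))"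

definition vertical ::
  "('m, 'e::real_inner, 'v::real_vector, 'k::finite) algebroid \<Rightarrow> 'm \<times> 'v \<Rightarrow>
   ('m, 'v) prolongation_elem set" where
  "vertical D p = span {prol_V D c a p | c a. c \<in> adapted_coords D \<and> fst p \<in> coord_dom c}"

definition smooth_prolongation_section ::
  "('m, 'e::real_inner, 'v::real_vector, 'k::finite) algebroid \<Rightarrow> ('m \<times> 'v) set \<Rightarrow>
   ('m \<times> 'v \<Rightarrow> ('m, 'v) prolongation_elem) \<Rightarrow> bool" where
  "smooth_prolongation_section D W Z \<longleftrightarrow>
     (\<forall>p\<in>W. Z p \<in> prolongation D p) \<and>
     (\<forall>c\<in>adapted_coords D. \<exists>\<xi> \<eta>.
        (\<forall>a. smooth_fun (total_atlas D) (W \<inter> fst (total_chart D c)) (\<xi> a)) \<and>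
        (\<forall>a. smooth_fun (total_atlas D) (W \<inter> fst (total_chart D c)) (\<eta> a)) \<and>
        (\<forall>p\<in>W \<inter> fst (total_chart D c).
           Z p = (\<Sum>a\<in>UNIV. \<xi> a p *\<^sub>R prol_X D c a p) + (\<Sum>a\<in>UNIV. \<eta> a p *\<^sub>R prol_V D c a p)))"

text \<open>A subbundle is a family of subspaces that locally has a smooth frame, here a finite set of
  sections.\<close>

definition smooth_subbundle ::
  "('m, 'e::real_inner, 'v::real_vector, 'k::finite) algebroid \<Rightarrow>
   ('m \<times> 'v \<Rightarrow> ('m, 'v) prolongation_elem set) \<Rightarrow> bool" where
  "smooth_subbundle D H \<longleftrightarrow>
     (\<forall>p\<in>total_space D. \<exists>W \<Z>. openin (atlas_topology (total_atlas D)) W \<and> p \<in> W \<and> finite \<Z> \<and>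
        (\<forall>Z\<in>\<Z>. smooth_prolongation_section D W Z) \<and>
        (\<forall>p'\<in>W. inj_on (\<lambda>Z. Z p') \<Z> \<and> independent ((\<lambda>Z. Z p') ` \<Z>) \<and>
           H p' = span ((\<lambda>Z. Z p') ` \<Z>)))"

definition N_connection ::
  "('m, 'e::real_inner, 'v::real_vector, 'k::finite) algebroid \<Rightarrow>
   ('m \<times> 'v \<Rightarrow> ('m, 'v) prolongation_elem set) \<Rightarrow> bool" where
  "N_connection D H \<longleftrightarrow>
     smooth_subbundle D H \<and>
     (\<forall>p\<in>total_space D.
        prolongation D p = {h + v | h v. h \<in> H p \<and> v \<in> vertical D p} \<and>
        H p \<inter> vertical D p = {0})"

text \<open>\<open>N a f\<close> is the coefficient with lower index \<open>a\<close> and upper index \<open>f\<close>.\<close>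

definition N_coefficients ::
  "('m, 'e::real_inner, 'v::real_vector, 'k::finite) algebroid \<Rightarrow>
   ('m \<times> 'v \<Rightarrow> ('m, 'v) prolongation_elem set) \<Rightarrow> ('m, 'e, 'v, 'k) coords \<Rightarrow>
   ('k \<Rightarrow> 'k \<Rightarrow> 'm \<times> 'v \<Rightarrow> real) \<Rightarrow> bool" where
  "N_coefficients D H c N \<longleftrightarrow>
     (\<forall>p\<in>fst (total_chart D c).
        H p = span (range (\<lambda>a. prol_X D c a p - (\<Sum>f\<in>UNIV. N a f p *\<^sub>R prol_V D c f p))))"

section \<open>Lagrangians\<close>

text \<open>The coordinate vector fields of the chart \<open>(x\<^sup>i, y\<^sup>a)\<close> acting on functions on the total space.\<close>

definition d_x ::
  "('m, 'e::real_inner, 'v::real_vector, 'k::finite) algebroid \<Rightarrow> ('m, 'e, 'v, 'k) coords \<Rightarrow>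
   'e \<Rightarrow> ('m \<times> 'v \<Rightarrow> real) \<Rightarrow> 'm \<times> 'v \<Rightarrow> real" where
  "d_x D c i F p =
     frechet_derivative (F \<circ> chart_inv (total_chart D c)) (at (snd (total_chart D c) p)) (i, 0)"

definition d_y ::
  "('m, 'e::real_inner, 'v::real_vector, 'k::finite) algebroid \<Rightarrow> ('m, 'e, 'v, 'k) coords \<Rightarrow>
   'k \<Rightarrow> ('m \<times> 'v \<Rightarrow> real) \<Rightarrow> 'm \<times> 'v \<Rightarrow> real" where
  "d_y D c a F p =
     frechet_derivative (F \<circ> chart_inv (total_chart D c)) (at (snd (total_chart D c) p)) (0, axis a 1)"

definition hessian ::
  "('m, 'e::real_inner, 'v::real_vector, 'k::finite) algebroid \<Rightarrow> ('m \<times> 'v \<Rightarrow> real) \<Rightarrow>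
   ('m, 'e, 'v, 'k) coords \<Rightarrow> 'm \<times> 'v \<Rightarrow> real ^ 'k ^ 'k" where
  "hessian D L c p = (\<chi> a b. d_y D c a (d_y D c b L) p)"

definition regular_lagrangian ::
  "('m, 'e::real_inner, 'v::real_vector, 'k::finite) algebroid \<Rightarrow> ('m \<times> 'v \<Rightarrow> real) \<Rightarrow> bool" where
  "regular_lagrangian D L \<longleftrightarrow>
     smooth_fun (total_atlas D) (total_space D) L \<and>
     (\<forall>c\<in>adapted_coords D. \<forall>p\<in>fst (total_chart D c). det (hessian D L c p) \<noteq> 0)"

definition semispray_coeff ::
  "('m, 'e::real_inner, 'v::real_vector, 'k::finite) algebroid \<Rightarrow> ('m \<times> 'v \<Rightarrow> real) \<Rightarrow>
   ('m, 'e, 'v, 'k) coords \<Rightarrow> 'k \<Rightarrow> 'm \<times> 'v \<Rightarrow> real" where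
  "semispray_coeff D L c e p =
     (\<Sum>b\<in>UNIV. matrix_inv (hessian D L c p) $ e $ b *
        ((\<Sum>i\<in>model_basis D. rho D c b i (fst p) * d_x D c i L p)
         - (\<Sum>i\<in>model_basis D. \<Sum>a\<in>UNIV.
              rho D c a i (fst p) * d_x D c i (d_y D c b L) p * fibre_coord c a p)
         - (\<Sum>a\<in>UNIV. \<Sum>f\<in>UNIV.
              struct_C D c b a f (fst p) * d_y D c f L p * fibre_coord c a p)))"

definition canonical_N ::
  "('m, 'e::real_inner, 'v::real_vector, 'k::finite) algebroid \<Rightarrow> ('m \<times> 'v \<Rightarrow> real) \<Rightarrow>
   ('m, 'e, 'v, 'k) coords \<Rightarrow> 'k \<Rightarrow> 'k \<Rightarrow> 'm \<times> 'v \<Rightarrow> real" where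
  "canonical_N D L c a f p =
     - (1 / 2) * (d_y D c a (semispray_coeff D L c f) p
                  + (\<Sum>b\<in>UNIV. fibre_coord c b p * struct_C D c b a f (fst p)))"

definition semispray ::
  "('m, 'e::real_inner, 'v::real_vector, 'k::finite) algebroid \<Rightarrow>
   ('m \<times> 'v \<Rightarrow> ('m, 'v) prolongation_elem) \<Rightarrow> bool" where
  "semispray D \<Gamma> \<longleftrightarrow>
     smooth_prolongation_section D (total_space D) \<Gamma> \<and> (\<forall>p\<in>total_space D. fst (\<Gamma> p) = snd p)"

text \<open>Quantifying over all functions smooth near \<open>\<gamma> t\<close>, whatever their values elsewhere, makes this
  include continuity of \<open>\<gamma>\<close> at \<open>t\<close>.\<close>

definition has_velocity ::
  "('p, 'e::real_normed_vector) chart set \<Rightarrow> (real \<Rightarrow> 'p) \<Rightarrow> (('p \<Rightarrow> real) \<Rightarrow> real) \<Rightarrow> real \<Rightarrow> bool" where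
  "has_velocity A \<gamma> v t \<longleftrightarrow>
     v \<in> tangent_space A (\<gamma> t) \<and>
     (\<forall>f. smooth_near A (\<gamma> t) f \<longrightarrow> ((\<lambda>s. f (\<gamma> s)) has_real_derivative v f) (at t))"

definition differentiable_curve ::
  "('m, 'e::real_inner, 'v::real_vector, 'k::finite) algebroid \<Rightarrow> real set \<Rightarrow> (real \<Rightarrow> 'm \<times> 'v) \<Rightarrow> bool"
  where
  "differentiable_curve D J \<gamma> \<longleftrightarrow>
     open J \<and> is_interval J \<and> \<gamma> ` J \<subseteq> total_space D \<and>
     (\<forall>t\<in>J. \<exists>v. has_velocity (total_atlas D) \<gamma> v t)"

definition integral_curve ::
  "('m, 'e::real_inner, 'v::real_vector, 'k::finite) algebroid \<Rightarrow>
   ('m \<times> 'v \<Rightarrow> ('m \<times> 'v \<Rightarrow> real) \<Rightarrow> real) \<Rightarrow> real set \<Rightarrow> (real \<Rightarrow> 'm \<times> 'v) \<Rightarrow> bool" where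
  "integral_curve D X J \<gamma> \<longleftrightarrow>
     differentiable_curve D J \<gamma> \<and> (\<forall>t\<in>J. has_velocity (total_atlas D) \<gamma> (X (\<gamma> t)) t)"

definition euler_lagrange_solution ::
  "('m, 'e::real_inner, 'v::real_vector, 'k::finite) algebroid \<Rightarrow> ('m \<times> 'v \<Rightarrow> real) \<Rightarrow>
   real set \<Rightarrow> (real \<Rightarrow> 'm \<times> 'v) \<Rightarrow> bool" where
  "euler_lagrange_solution D L J \<gamma> \<longleftrightarrow>
     differentiable_curve D J \<gamma> \<and>
     (\<forall>c\<in>adapted_coords D. \<forall>t\<in>J. fst (\<gamma> t) \<in> coord_dom c \<longrightarrow>
        (\<forall>i\<in>model_basis D.
           ((\<lambda>s. coord_map c (fst (\<gamma> s)) \<bullet> i) has_real_derivative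
              (\<Sum>a\<in>UNIV. rho D c a i (fst (\<gamma> t)) * fibre_coord c a (\<gamma> t))) (at t)) \<and>
        (\<forall>a. \<exists>P. ((\<lambda>s. d_y D c a L (\<gamma> s)) has_real_derivative P) (at t) \<and>
           P + (\<Sum>b\<in>UNIV. \<Sum>f\<in>UNIV.
                  fibre_coord c b (\<gamma> t) * struct_C D c a b f (fst (\<gamma> t)) * d_y D c f L (\<gamma> t))
             - (\<Sum>i\<in>model_basis D. rho D c a i (fst (\<gamma> t)) * d_x D c i L (\<gamma> t)) = 0))"

end

theory Submission
  imports Defs
begin

text \<open>A vector \<open>z\<close> in the fibre of the prolongation over \<open>p\<close> acts on functions of the total space as a
  derivation, and in a chart it is determined by its first component and its values on the fibre
  coordinates. If the first component of \<open>z\<close> is \<open>p\<close> itself, the Euler-Lagrange equations at \<open>p\<close> say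
  that \<open>z\<close> takes prescribed values on the momenta \<open>\<partial>L/\<partial>y\<^sup>b\<close>; since the Hessian is invertible, exactly
  one such \<open>z\<close> satisfies them, the semispray. These equations in one chart imply those in any other
  (the inhomogeneous terms in the transformation of the structure functions cancel those from the
  transformation of the momenta), so the semispray is globally defined. Differentiating the
  resulting transformation law of its coefficients along the fibres gives the law for
  \<open>\<delta>\<^sub>a = \<X>\<^sub>a - N\<^sub>a\<^sup>f \<V>\<^sub>f\<close>, which turns out to be that of a frame.\<close>

section \<open>Smooth functions on open sets\<close>

text \<open>The base model space is an inner product space with a finite, possibly empty,
  orthonormal basis, so every use of finite dimension goes through that basis: the chain rule for
  \<open>Ck_on\<close> and the compactness of closed balls. Compactness and the Hausdorff axiom
  yield bump functions. These are essential because \<open>bracket\<close> acts on global sections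
  while the structure functions need brackets of local frames: cutoffs extend germs and show that
  the choice of extension is immaterial. The inhomogeneous terms all have the form R b g j, the
  derivative along rho(e_b) of the entry (g, j) of the frame-change matrix. The semispray
  coefficients pick up R b g j y^b y^g, whose derivative along y^a is R a g j y^g + R b a j y^b. The
  structure functions contracted with y contribute R a b j y^b - R b a j y^b. The sum is twice R a g
  j y^g, and one such term is the vertical part that \<open>prol_X\<close> acquires under a change
  of chart; this fixes the factor 1/2 in \<open>canonical_N\<close>.\<close>

lemma Ck_on_Suc_imp_Ck_on: "Ck_on (Suc k) S f \<Longrightarrow> Ck_on k S f"
proof (induction k arbitrary: f)
  case 0
  then show ?case
    by (auto intro!: continuous_at_imp_continuous_on differentiable_imp_continuous_within)
next
  case (Suc k)
  then show ?case by (metis Ck_on.simps(2))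
qed

lemma Ck_on_subset: "Ck_on k S f \<Longrightarrow> T \<subseteq> S \<Longrightarrow> Ck_on k T f"
  by (induction k arbitrary: f) (auto intro: continuous_on_subset)

text \<open>\<open>frechet_derivative\<close> is taken \<open>at x\<close> in the whole space, so
  agreement on \<open>S\<close> carries over to derivatives because \<open>S\<close> is
  open.\<close>

lemma Ck_on_cong:
  assumes "open S" "Ck_on k S f" "\<And>x. x \<in> S \<Longrightarrow> f x = g x"
  shows "Ck_on k S g"
  using assms(2,3)
proof (induction k arbitrary: f g)
  case 0
  then show ?case by (simp cong: continuous_on_cong)
next
  case (Suc k)
  have der: "(g has_derivative frechet_derivative f (at x)) (at x)" if "x \<in> S" for x
    using Suc.prems that assms(1)
    by (metis Ck_on.simps(2) frechet_derivative_works has_derivative_transform_within_open)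
  then have eq: "frechet_derivative g (at x) = frechet_derivative f (at x)" if "x \<in> S" for x
    using frechet_derivative_at that by metis
  have "Ck_on k S (\<lambda>x. frechet_derivative g (at x) v)" for v
    using Suc.IH[of "\<lambda>x. frechet_derivative f (at x) v"] Suc.prems eq by simp
  then show ?case using der by (auto simp: differentiable_def)
qed

lemma Ck_on_local:
  assumes "\<And>x. x \<in> S \<Longrightarrow> \<exists>T. open T \<and> x \<in> T \<and> Ck_on k T f"
  shows "Ck_on k S f"
  using assms
proof (induction k arbitrary: f)
  case 0
  then show ?case
    by (metis Ck_on.simps(1) continuous_at_imp_continuous_on continuous_on_eq_continuous_at)
next
  case (Suc k)
  then show ?case by (metis Ck_on.simps(2))
qed

text \<open>\<open>frechet_derivative\<close> is a choice operator; uniqueness of derivatives lets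
  an explicit candidate \<open>f'\<close> stand for it. The closure properties below feed their
  differentiation rules into this one.\<close>

lemma Ck_on_SucI:
  assumes "open S" "\<And>x. x \<in> S \<Longrightarrow> (f has_derivative f' x) (at x)"
    and "\<And>v. Ck_on k S (\<lambda>x. f' x v)"
  shows "Ck_on (Suc k) S f"
proof -
  have "frechet_derivative f (at x) = f' x" if "x \<in> S" for x
    using assms(2)[OF that] frechet_derivative_at by metis
  then have "Ck_on k S (\<lambda>x. frechet_derivative f (at x) v)" for v
    using Ck_on_cong[OF assms(1) assms(3)[of v]] by simp
  then show ?thesis using assms(2) by (auto simp: differentiable_def)
qed

lemma Ck_on_SucD:
  assumes "Ck_on (Suc k) S f" "x \<in> S"
  shows "(f has_derivative frechet_derivative f (at x)) (at x)"
  using assms by (simp add: frechet_derivative_works[symmetric])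

lemma Ck_on_const: "open S \<Longrightarrow> Ck_on k S (\<lambda>x. c)"
proof (induction k arbitrary: c)
  case (Suc k)
  show ?case by (rule Ck_on_SucI[OF Suc.prems has_derivative_const Suc.IH[OF Suc.prems]])
qed simp

lemma Ck_on_bounded_linear:
  assumes "open S" "bounded_linear h"
  shows "Ck_on k S h"
proof (cases k)
  case 0
  then show ?thesis using assms(2) by (simp add: linear_continuous_on)
next
  case (Suc j)
  show ?thesis unfolding Suc
    by (rule Ck_on_SucI[OF assms(1) bounded_linear_imp_has_derivative[OF assms(2)] Ck_on_const[OF assms(1)]])
qed

lemma Ck_on_add:
  assumes "open S" "Ck_on k S f" "Ck_on k S g"
  shows "Ck_on k S (\<lambda>x. f x + g x)"
  using assms(2,3)
proof (induction k arbitrary: f g)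
  case 0
  then show ?case by (simp add: continuous_on_add)
next
  case (Suc k)
  show ?case
    by (rule Ck_on_SucI[OF assms(1) has_derivative_add[OF Ck_on_SucD[OF Suc.prems(1)] Ck_on_SucD[OF Suc.prems(2)]]])
      (use Suc in auto)
qed

text \<open>Each term of the product rule contains one undifferentiated factor, so the induction is
  over both functions at once and \<open>Ck_on_Suc_imp_Ck_on\<close> lowers the order of that
  factor.\<close>

lemma Ck_on_bilinear:
  assumes "open S" "bounded_bilinear h" "Ck_on k S f" "Ck_on k S g"
  shows "Ck_on k S (\<lambda>x. h (f x) (g x))"
  using assms(3,4)
proof (induction k arbitrary: f g)
  case 0
  then show ?case by (simp add: bounded_bilinear.continuous_on[OF assms(2)])
next
  case (Suc k)
  have "Ck_on k S (\<lambda>x. h (f x) (frechet_derivative g (at x) v) + h (frechet_derivative f (at x) v) (g x))" for v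
    using Suc.prems Suc.prems[THEN Ck_on_Suc_imp_Ck_on]
    by (intro Ck_on_add[OF assms(1)] Suc.IH) auto
  then show ?case
    by (intro Ck_on_SucI[OF assms(1) bounded_bilinear.FDERIV[OF assms(2) Ck_on_SucD[OF Suc.prems(1)] Ck_on_SucD[OF Suc.prems(2)]]])
qed

lemma Ck_on_linear_compose:
  assumes "open S" "bounded_linear h" "Ck_on k S f"
  shows "Ck_on k S (\<lambda>x. h (f x))"
  using assms(3)
proof (induction k arbitrary: f)
  case 0
  then show ?case by (simp add: bounded_linear.continuous_on[OF assms(2)])
next
  case (Suc k)
  show ?case
    by (rule Ck_on_SucI[OF assms(1) bounded_linear.has_derivative[OF assms(2) Ck_on_SucD[OF Suc.prems]]])
      (use Suc in auto)
qed

section \<open>Chain rule through a finite orthonormal basis\<close>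

lemma orthonormal_expansion:
  assumes "orthonormal_basis B"
  shows "x = (\<Sum>i\<in>B. (x \<bullet> i) *\<^sub>R i)"
proof -
  have fin: "finite B" and on: "\<And>i j. i \<in> B \<Longrightarrow> j \<in> B \<Longrightarrow> i \<bullet> j = (if i = j then 1 else 0)"
    using assms by (auto simp: orthonormal_basis_def)
  have "x \<in> span B" using assms by (simp add: orthonormal_basis_def)
  then obtain u where u: "x = (\<Sum>i\<in>B. u i *\<^sub>R i)"
    unfolding span_finite[OF fin] by auto
  have "x \<bullet> j = u j" if "j \<in> B" for j
  proof -
    have "x \<bullet> j = (\<Sum>i\<in>B. u i * (i \<bullet> j))" by (simp add: u inner_sum_left)
    also have "\<dots> = (\<Sum>i\<in>B. if i = j then u i else 0)" by (rule sum.cong) (use on that in auto)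
    also have "\<dots> = u j" using fin that by simp
    finally show ?thesis .
  qed
  then show ?thesis using u by simp
qed

lemma linear_expansion:
  assumes "orthonormal_basis B" "linear f"
  shows "f x = (\<Sum>i\<in>B. (x \<bullet> i) *\<^sub>R f i)"
proof -
  have "f x = f (\<Sum>i\<in>B. (x \<bullet> i) *\<^sub>R i)" using orthonormal_expansion[OF assms(1), of x] by simp
  then show ?thesis by (simp add: linear_sum[OF assms(2)] linear_cmul[OF assms(2)])
qed

lemma Ck_on_sum:
  assumes "open S" "\<And>i. i \<in> I \<Longrightarrow> Ck_on k S (f i)"
  shows "Ck_on k S (\<lambda>x. \<Sum>i\<in>I. f i x)"
  using assms(2)
  by (induction I rule: infinite_finite_induct) (simp_all add: Ck_on_const Ck_on_add assms(1))

text \<open>In the derivative \<open>g'(f x)(f'(x) v)\<close> both the base point and the direction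
  depend on \<open>x\<close>. Expanding the direction in \<open>B\<close> leaves products of scalar
  functions with \<open>g'(f x) i\<close> for fixed \<open>i\<close>, and to these the induction
  hypothesis applies.\<close>

lemma Ck_on_compose:
  fixes B :: "'b::real_inner set" and f :: "'a::real_normed_vector \<Rightarrow> 'b"
  assumes "orthonormal_basis B" "open S" "open T" "f ` S \<subseteq> T" "Ck_on k S f" "Ck_on k T g"
  shows "Ck_on k S (\<lambda>x. g (f x))"
  using assms(5,6)
proof (induction k arbitrary: g)
  case 0
  then show ?case using assms(4) by (auto intro: continuous_on_compose2)
next
  case (Suc k)
  have f: "(f has_derivative frechet_derivative f (at x)) (at x)" if "x \<in> S" for x
    using Ck_on_SucD[OF Suc.prems(1) that] .
  have g: "(g has_derivative frechet_derivative g (at (f x))) (at (f x))" if "x \<in> S" for x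
    using Ck_on_SucD[OF Suc.prems(2)] that assms(4) by blast
  have eq: "frechet_derivative g (at (f x)) (frechet_derivative f (at x) v)
      = (\<Sum>i\<in>B. (frechet_derivative f (at x) v \<bullet> i) *\<^sub>R frechet_derivative g (at (f x)) i)"
    if "x \<in> S" for x v
    by (rule linear_expansion[OF assms(1) has_derivative_linear[OF g[OF that]]])
  have "Ck_on k S (\<lambda>x. frechet_derivative g (at (f x)) (frechet_derivative f (at x) v))" for v
  proof (rule Ck_on_cong[OF assms(2)])
    show "Ck_on k S (\<lambda>x. \<Sum>i\<in>B. (frechet_derivative f (at x) v \<bullet> i) *\<^sub>R frechet_derivative g (at (f x)) i)"
      using Suc.prems Ck_on_Suc_imp_Ck_on[OF Suc.prems(1)]
      by (intro Ck_on_sum[OF assms(2)] Ck_on_bilinear[OF assms(2) bounded_bilinear_scaleR]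
          Ck_on_bilinear[OF assms(2) bounded_bilinear_inner] Ck_on_const[OF assms(2)] Suc.IH) auto
  qed (use eq in auto)
  then show ?case
    by (intro Ck_on_SucI[OF assms(2) has_derivative_compose[OF f g]])
qed

text \<open>The derivative of \<open>1/f\<close> is again built from \<open>1/f\<close> and the
  derivative of \<open>f\<close>, so the induction closes with \<open>f\<close> fixed.\<close>

lemma Ck_on_inverse:
  fixes f :: "'a::real_normed_vector \<Rightarrow> real"
  assumes "open S" "Ck_on k S f" "\<And>x. x \<in> S \<Longrightarrow> f x \<noteq> 0"
  shows "Ck_on k S (\<lambda>x. inverse (f x))"
  using assms(2)
proof (induction k)
  case 0
  then show ?case using assms(3) by (auto intro: continuous_on_inverse)
next
  case (Suc k)
  have "Ck_on k S f" "Ck_on k S (\<lambda>x. frechet_derivative f (at x) v)" for v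
    using Suc.prems Ck_on_Suc_imp_Ck_on[OF Suc.prems] by auto
  then have "Ck_on k S (\<lambda>x. - (inverse (f x) * frechet_derivative f (at x) v * inverse (f x)))" for v
    by (intro Ck_on_linear_compose[OF assms(1) bounded_linear_minus[OF bounded_linear_ident]]
        Ck_on_bilinear[OF assms(1) bounded_bilinear_mult] Suc.IH)
  then show ?case
    by (intro Ck_on_SucI[OF assms(1) Deriv.has_derivative_inverse[OF assms(3) Ck_on_SucD[OF Suc.prems]]])
qed

lemma smooth_on_cong:
  assumes "open S" "smooth_on S f" "\<And>x. x \<in> S \<Longrightarrow> f x = g x"
  shows "smooth_on S g"
  using assms Ck_on_cong unfolding smooth_on_def by metis

lemma smooth_on_subset: "smooth_on S f \<Longrightarrow> T \<subseteq> S \<Longrightarrow> smooth_on T f"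
  using Ck_on_subset unfolding smooth_on_def by metis

lemma smooth_on_local:
  assumes "\<And>x. x \<in> S \<Longrightarrow> \<exists>T. open T \<and> x \<in> T \<and> smooth_on T f"
  shows "smooth_on S f"
  unfolding smooth_on_def
proof
  fix k
  show "Ck_on k S f" by (rule Ck_on_local) (use assms smooth_on_def in metis)
qed

lemma smooth_on_const: "open S \<Longrightarrow> smooth_on S (\<lambda>x. c)"
  by (simp add: smooth_on_def Ck_on_const)

lemma smooth_on_bounded_linear: "open S \<Longrightarrow> bounded_linear h \<Longrightarrow> smooth_on S h"
  by (simp add: smooth_on_def Ck_on_bounded_linear)

lemma smooth_on_add: "open S \<Longrightarrow> smooth_on S f \<Longrightarrow> smooth_on S g \<Longrightarrow> smooth_on S (\<lambda>x. f x + g x)"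
  by (simp add: smooth_on_def Ck_on_add)

lemma smooth_on_sum:
  "open S \<Longrightarrow> (\<And>i. i \<in> I \<Longrightarrow> smooth_on S (f i)) \<Longrightarrow> smooth_on S (\<lambda>x. \<Sum>i\<in>I. f i x)"
  by (simp add: smooth_on_def Ck_on_sum)

lemma smooth_on_bilinear:
  "open S \<Longrightarrow> bounded_bilinear h \<Longrightarrow> smooth_on S f \<Longrightarrow> smooth_on S g \<Longrightarrow> smooth_on S (\<lambda>x. h (f x) (g x))"
  by (simp add: smooth_on_def Ck_on_bilinear)

lemma smooth_on_mult:
  fixes f g :: "'a::real_normed_vector \<Rightarrow> real"
  shows "open S \<Longrightarrow> smooth_on S f \<Longrightarrow> smooth_on S g \<Longrightarrow> smooth_on S (\<lambda>x. f x * g x)"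
  by (rule smooth_on_bilinear[OF _ bounded_bilinear_mult])

lemma smooth_on_linear_compose:
  "open S \<Longrightarrow> bounded_linear h \<Longrightarrow> smooth_on S f \<Longrightarrow> smooth_on S (\<lambda>x. h (f x))"
  by (simp add: smooth_on_def Ck_on_linear_compose)

lemma smooth_on_inverse:
  fixes f :: "'a::real_normed_vector \<Rightarrow> real"
  shows "open S \<Longrightarrow> smooth_on S f \<Longrightarrow> (\<And>x. x \<in> S \<Longrightarrow> f x \<noteq> 0) \<Longrightarrow> smooth_on S (\<lambda>x. inverse (f x))"
  by (simp add: smooth_on_def Ck_on_inverse)

lemma smooth_on_compose:
  fixes B :: "'b::real_inner set" and f :: "'a::real_normed_vector \<Rightarrow> 'b"
  assumes "orthonormal_basis B" "open S" "open T" "f ` S \<subseteq> T" "smooth_on S f" "smooth_on T g"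
  shows "smooth_on S (\<lambda>x. g (f x))"
  using assms(5,6) Ck_on_compose[OF assms(1-4)] unfolding smooth_on_def by metis

lemma smooth_on_Pair:
  assumes "open S" "smooth_on S f" "smooth_on S g"
  shows "smooth_on S (\<lambda>x. (f x, g x))"
proof -
  have "bounded_linear (\<lambda>a::'b. (a, 0::'c))" "bounded_linear (\<lambda>b::'c. (0::'b, b))"
    by (auto intro!: bounded_linear_Pair bounded_linear_ident bounded_linear_zero)
  then have "smooth_on S (\<lambda>x. (f x, 0) + (0, g x))"
    by (intro smooth_on_add assms smooth_on_linear_compose[where f = f] smooth_on_linear_compose[where f = g])
  then show ?thesis by simp
qed

lemma smooth_on_continuous_on: "smooth_on S f \<Longrightarrow> continuous_on S f"
  unfolding smooth_on_def by (metis Ck_on.simps(1))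

lemma smooth_on_derivative:
  "smooth_on S f \<Longrightarrow> smooth_on S (\<lambda>x. frechet_derivative f (at x) v)"
  unfolding smooth_on_def by (metis Ck_on.simps(2))

lemma smooth_on_has_derivative:
  "smooth_on S f \<Longrightarrow> x \<in> S \<Longrightarrow> (f has_derivative frechet_derivative f (at x)) (at x)"
  unfolding smooth_on_def using Ck_on_SucD[of 0 S f x] by metis

lemma orthonormal_basis_real: "orthonormal_basis {1::real}"
proof -
  have "x \<in> span {1::real}" for x
    using span_scale[OF span_base[of "1::real" "{1}"], of x] by simp
  then show ?thesis by (auto simp: orthonormal_basis_def)
qed

text \<open>The second difference is an increment of \<open>?g\<close>, to which the mean value
  theorem applies in direction \<open>u\<close>; a second application runs in direction
  \<open>v\<close>. The difference is symmetric in \<open>u\<close> and \<open>v\<close>, the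
  iterated derivative a priori not.\<close>

lemma mean_value_mixed_difference:
  fixes f :: "'a::real_normed_vector \<Rightarrow> real"
  assumes "smooth_on S f" "h > 0"
    and S: "\<And>s t. 0 \<le> s \<Longrightarrow> s \<le> h \<Longrightarrow> 0 \<le> t \<Longrightarrow> t \<le> h \<Longrightarrow> x + s *\<^sub>R u + t *\<^sub>R v \<in> S"
  shows "\<exists>s t. 0 < s \<and> s < h \<and> 0 < t \<and> t < h \<and>
    f (x + h *\<^sub>R u + h *\<^sub>R v) - f (x + h *\<^sub>R u) - f (x + h *\<^sub>R v) + f x =
    h * h * frechet_derivative (\<lambda>y. frechet_derivative f (at y) u) (at (x + s *\<^sub>R u + t *\<^sub>R v)) v"
proof -
  define F where "F = (\<lambda>y. frechet_derivative f (at y) u)"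
  have F: "smooth_on S F" unfolding F_def by (rule smooth_on_derivative[OF assms(1)])
  have du: "((\<lambda>s. f (x + s *\<^sub>R u + t *\<^sub>R v)) has_real_derivative F (x + s *\<^sub>R u + t *\<^sub>R v)) (at s)"
    if "0 \<le> s" "s \<le> h" "0 \<le> t" "t \<le> h" for s t
  proof -
    have fd: "(f has_derivative frechet_derivative f (at (x + s *\<^sub>R u + t *\<^sub>R v))) (at (x + s *\<^sub>R u + t *\<^sub>R v))"
      by (rule smooth_on_has_derivative[OF assms(1) S[OF that]])
    have "((\<lambda>s. x + s *\<^sub>R u + t *\<^sub>R v) has_derivative (\<lambda>r. r *\<^sub>R u)) (at s)"
      by (auto intro!: derivative_eq_intros)
    from has_derivative_compose[OF this fd]
    show ?thesis unfolding has_field_derivative_def F_def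
      by (rule has_derivative_eq_rhs) (simp add: fun_eq_iff linear_cmul[OF has_derivative_linear[OF fd]])
  qed
  have dv: "((\<lambda>t. F (x + s *\<^sub>R u + t *\<^sub>R v)) has_real_derivative frechet_derivative F (at (x + s *\<^sub>R u + t *\<^sub>R v)) v) (at t)"
    if "0 \<le> s" "s \<le> h" "0 \<le> t" "t \<le> h" for s t
  proof -
    have fd: "(F has_derivative frechet_derivative F (at (x + s *\<^sub>R u + t *\<^sub>R v))) (at (x + s *\<^sub>R u + t *\<^sub>R v))"
      by (rule smooth_on_has_derivative[OF F S[OF that]])
    have "((\<lambda>t. x + s *\<^sub>R u + t *\<^sub>R v) has_derivative (\<lambda>r. r *\<^sub>R v)) (at t)"
      by (auto intro!: derivative_eq_intros)
    from has_derivative_compose[OF this fd]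
    show ?thesis unfolding has_field_derivative_def
      by (rule has_derivative_eq_rhs) (simp add: fun_eq_iff linear_cmul[OF has_derivative_linear[OF fd]])
  qed
  let ?g = "\<lambda>s. f (x + s *\<^sub>R u + h *\<^sub>R v) - f (x + s *\<^sub>R u + 0 *\<^sub>R v)"
  have "\<exists>s. 0 < s \<and> s < h \<and> ?g h - ?g 0 =
      (h - 0) * (F (x + s *\<^sub>R u + h *\<^sub>R v) - F (x + s *\<^sub>R u + 0 *\<^sub>R v))"
    by (rule MVT2[OF assms(2)]) (use assms(2) in \<open>intro DERIV_diff du; simp\<close>)
  then obtain s where s: "0 < s" "s < h"
    "?g h - ?g 0 = h * (F (x + s *\<^sub>R u + h *\<^sub>R v) - F (x + s *\<^sub>R u + 0 *\<^sub>R v))"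
    by auto
  have "\<exists>t. 0 < t \<and> t < h \<and> F (x + s *\<^sub>R u + h *\<^sub>R v) - F (x + s *\<^sub>R u + 0 *\<^sub>R v) =
      (h - 0) * frechet_derivative F (at (x + s *\<^sub>R u + t *\<^sub>R v)) v"
    by (rule MVT2[OF assms(2)]) (use s in \<open>auto intro!: dv\<close>)
  then obtain t where "0 < t" "t < h" "F (x + s *\<^sub>R u + h *\<^sub>R v) - F (x + s *\<^sub>R u + 0 *\<^sub>R v) =
      h * frechet_derivative F (at (x + s *\<^sub>R u + t *\<^sub>R v)) v"
    by auto
  then show ?thesis using s unfolding F_def[symmetric] by (intro exI[of _ s] exI[of _ t]) (auto simp: algebra_simps)
qed

text \<open>Evaluating the same symmetric second difference in both orders makes the two mixed
  derivatives agree at points close to \<open>x\<close>; continuity of both then contradicts a gap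
  at \<open>x\<close>.\<close>

lemma second_derivative_symmetric:
  fixes f :: "'a::real_normed_vector \<Rightarrow> real"
  assumes "open S" "smooth_on S f" "x \<in> S"
  shows "frechet_derivative (\<lambda>y. frechet_derivative f (at y) u) (at x) v =
         frechet_derivative (\<lambda>y. frechet_derivative f (at y) v) (at x) u" (is "?A x = ?B x")
proof (rule ccontr)
  assume ne: "?A x \<noteq> ?B x"
  define e where "e = \<bar>?A x - ?B x\<bar> / 2"
  have e: "e > 0" using ne by (simp add: e_def)
  have cont: "continuous (at x) ?A" "continuous (at x) ?B"
    using smooth_on_continuous_on[OF smooth_on_derivative[OF smooth_on_derivative[OF assms(2)]]]
      assms(1,3) continuous_on_eq_continuous_at by blast+
  obtain d1 where d1: "d1 > 0" "\<And>y. dist y x < d1 \<Longrightarrow> dist (?A y) (?A x) < e"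
    using cont(1) e unfolding continuous_at_eps_delta by blast
  obtain d2 where d2: "d2 > 0" "\<And>y. dist y x < d2 \<Longrightarrow> dist (?B y) (?B x) < e"
    using cont(2) e unfolding continuous_at_eps_delta by blast
  obtain d3 where d3: "d3 > 0" "ball x d3 \<subseteq> S" using assms(1,3) open_contains_ball by blast
  define d where "d = min d1 (min d2 d3)"
  \<comment> \<open>With this \<open>h\<close> the whole parallelogram spanned by
    \<open>h *\<^sub>R u\<close> and \<open>h *\<^sub>R v\<close> stays within distance
    \<open>d\<close> of \<open>x\<close>; the summand 1 keeps the denominator positive when
    \<open>u\<close> and \<open>v\<close> vanish.\<close>
  define h where "h = d / (norm u + norm v + 1)"
  have d: "d > 0" using d1 d2 d3 by (simp add: d_def)
  have nz: "norm u + norm v + 1 > 0" using norm_ge_zero[of u] norm_ge_zero[of v] by linarith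
  have h: "h > 0" using d nz by (simp add: h_def)
  have near: "dist (x + s *\<^sub>R u + t *\<^sub>R v) x < d"
    if "0 \<le> s" "s \<le> h" "0 \<le> t" "t \<le> h" for s t
  proof -
    have "dist (x + s *\<^sub>R u + t *\<^sub>R v) x = norm (s *\<^sub>R u + t *\<^sub>R v)" by (simp add: dist_norm)
    also have "\<dots> \<le> s * norm u + t * norm v" using that by (intro norm_triangle_le) simp
    also have "\<dots> \<le> h * norm u + h * norm v" using that by (intro add_mono mult_right_mono) auto
    also have "\<dots> < h * (norm u + norm v + 1)" using h by (simp add: algebra_simps)
    also have "\<dots> = d" using nz by (simp add: h_def)
    finally show ?thesis .
  qed
  then have S: "x + s *\<^sub>R u + t *\<^sub>R v \<in> S" if "0 \<le> s" "s \<le> h" "0 \<le> t" "t \<le> h" for s t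
    using that d3 by (fastforce simp: d_def dist_commute)
  obtain s t where st: "0 < s" "s < h" "0 < t" "t < h"
    "f (x + h *\<^sub>R u + h *\<^sub>R v) - f (x + h *\<^sub>R u) - f (x + h *\<^sub>R v) + f x =
    h * h * ?A (x + s *\<^sub>R u + t *\<^sub>R v)"
    using mean_value_mixed_difference[OF assms(2) h S] by blast
  have S': "x + s *\<^sub>R v + t *\<^sub>R u \<in> S" if "0 \<le> s" "s \<le> h" "0 \<le> t" "t \<le> h" for s t
    using S[of t s] that by (simp add: algebra_simps)
  obtain s' t' where st': "0 < s'" "s' < h" "0 < t'" "t' < h"
    "f (x + h *\<^sub>R v + h *\<^sub>R u) - f (x + h *\<^sub>R v) - f (x + h *\<^sub>R u) + f x =
    h * h * ?B (x + s' *\<^sub>R v + t' *\<^sub>R u)"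
    using mean_value_mixed_difference[OF assms(2) h S'] by blast
  have swap: "x + s' *\<^sub>R v + t' *\<^sub>R u = x + t' *\<^sub>R u + s' *\<^sub>R v"
    "x + h *\<^sub>R v + h *\<^sub>R u = x + h *\<^sub>R u + h *\<^sub>R v"
    by (simp_all add: algebra_simps)
  have "h * h * ?A (x + s *\<^sub>R u + t *\<^sub>R v) = h * h * ?B (x + t' *\<^sub>R u + s' *\<^sub>R v)"
    using st(5) st'(5) unfolding swap by linarith
  then have "?A (x + s *\<^sub>R u + t *\<^sub>R v) = ?B (x + t' *\<^sub>R u + s' *\<^sub>R v)" using h by simp
  moreover have "dist (?A (x + s *\<^sub>R u + t *\<^sub>R v)) (?A x) < e"
    using near[of s t] st d1(2) by (simp add: d_def)
  moreover have "dist (?B (x + t' *\<^sub>R u + s' *\<^sub>R v)) (?B x) < e"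
    using near[of t' s'] st' d2(2) by (simp add: d_def)
  ultimately have "\<bar>?A x - ?B x\<bar> < 2 * e" unfolding dist_real_def by linarith
  then show False by (simp add: e_def)
qed

section \<open>Bump functions\<close>

text \<open>The powers of \<open>t\<close> in the denominator make the family closed under
  differentiation, so that smoothness of all its members can be proved in one induction.\<close>

definition exp_tail :: "nat \<Rightarrow> real \<Rightarrow> real" where
  "exp_tail m t = (if t > 0 then exp (- (1 / t)) / t ^ m else 0)"

lemma exp_tail_has_derivative:
  "(exp_tail m has_real_derivative exp_tail (m + 2) t - real m * exp_tail (m + 1) t) (at t)"
proof -
  consider "t > 0" | "t < 0" | "t = 0" by linarith
  then show ?thesis
  proof cases
    case 1
    have "((\<lambda>t. exp (- (1 / t)) / t ^ m) has_real_derivative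
        exp_tail (m + 2) t - real m * exp_tail (m + 1) t) (at t)"
    proof (cases m)
      case 0
      then show ?thesis using 1
        by (auto intro!: derivative_eq_intros simp: exp_tail_def power2_eq_square)
    next
      case (Suc j)
      have e: "((\<lambda>t. exp (- (1 / t))) has_real_derivative exp (- (1 / t)) * (1 / t\<^sup>2)) (at t)"
        using 1 by (auto intro!: derivative_eq_intros simp: power2_eq_square)
      have p: "((\<lambda>t. t ^ Suc j) has_real_derivative real (Suc j) * t ^ j) (at t)"
        using DERIV_pow[of "Suc j" t UNIV] by simp
      show ?thesis unfolding Suc
        by (rule DERIV_cong[OF DERIV_divide[OF e p]])
          (use 1 Suc in \<open>simp_all add: exp_tail_def field_simps power2_eq_square\<close>)
    qed
    then show ?thesis
      by (rule has_field_derivative_transform_within_open[of _ _ _ "{0<..}"])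
        (use 1 in \<open>auto simp: exp_tail_def\<close>)
  next
    case 2
    have "((\<lambda>t. 0) has_real_derivative exp_tail (m + 2) t - real m * exp_tail (m + 1) t) (at t)"
      using 2 by (auto simp: exp_tail_def)
    then show ?thesis
      by (rule has_field_derivative_transform_within_open[of _ _ _ "{..<0}"])
        (use 2 in \<open>auto simp: exp_tail_def\<close>)
  next
    case 3
    \<comment> \<open>At 0 the difference quotient from the right is
      \<open>exp (- (1 / t)) / t ^ (m + 1)\<close>; with \<open>u = 1 / t\<close> its limit is
      decided by the exponential outgrowing powers.\<close>
    have "((\<lambda>u. u ^ (m + 1) / exp u) \<longlongrightarrow> 0) (at_top :: real filter)"
      by (rule tendsto_power_div_exp_0)
    from filterlim_compose[OF this filterlim_inverse_at_top_right]
    have "((\<lambda>t. inverse t ^ (m + 1) / exp (inverse t)) \<longlongrightarrow> 0) (at_right (0::real))" .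
    then have right: "((\<lambda>h. (exp_tail m (0 + h) - exp_tail m 0) / h) \<longlongrightarrow> 0) (at_right 0)"
      by (rule Lim_transform_eventually)
        (auto simp: eventually_at_right_field exp_tail_def exp_minus field_simps intro!: exI[of _ 1])
    have left: "((\<lambda>h. (exp_tail m (0 + h) - exp_tail m 0) / h) \<longlongrightarrow> 0) (at_left 0)"
      by (rule Lim_transform_eventually[OF tendsto_const])
        (auto simp: eventually_at_left_field exp_tail_def intro!: exI[of _ "-1"])
    have "(exp_tail m has_real_derivative 0) (at 0)"
      unfolding DERIV_def by (rule filterlim_split_at[OF left right])
    then show ?thesis using 3 by (simp add: exp_tail_def)
  qed
qed

lemma smooth_on_exp_tail: "smooth_on UNIV (exp_tail m)"
proof -
  have "Ck_on k UNIV (exp_tail m)" for k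
  proof (induction k arbitrary: m)
    case 0
    show ?case
      using DERIV_isCont[OF exp_tail_has_derivative] by (simp add: continuous_at_imp_continuous_on)
  next
    case (Suc k)
    show ?case
    proof (rule Ck_on_SucI[OF open_UNIV exp_tail_has_derivative[unfolded has_field_derivative_def]])
      fix v
      have "Ck_on k UNIV (\<lambda>t. (exp_tail (m + 2) t + (- real m) * exp_tail (m + 1) t) * v)"
        by (intro Ck_on_bilinear[OF open_UNIV bounded_bilinear_mult] Ck_on_add Ck_on_const Suc.IH open_UNIV)
      then show "Ck_on k UNIV (\<lambda>t. (exp_tail (m + 2) t - real m * exp_tail (m + 1) t) * v)" by simp
    qed
  qed
  then show ?thesis by (simp add: smooth_on_def)
qed

lemma smooth_cutoff_real:
  obtains g :: "real \<Rightarrow> real" where "smooth_on UNIV g" "\<And>t. t \<le> 1 \<Longrightarrow> g t = 1" "\<And>t. t \<ge> 2 \<Longrightarrow> g t = 0"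
proof -
  \<comment> \<open>\<open>2 - t\<close> and \<open>t - 1\<close> add up to 1, so one of them is
    positive and the denominator of the cutoff never vanishes.\<close>
  have nz: "exp_tail 0 (2 - t) + exp_tail 0 (t - 1) \<noteq> 0" for t
  proof -
    have "exp_tail 0 s \<ge> 0" for s by (simp add: exp_tail_def)
    moreover have "exp_tail 0 (2 - t) > 0 \<or> exp_tail 0 (t - 1) > 0" by (auto simp: exp_tail_def)
    ultimately show ?thesis by (metis add_nonneg_eq_0_iff less_irrefl)
  qed
  have affine: "smooth_on UNIV (\<lambda>t. r * t + s)" for r s :: real
    by (intro smooth_on_add smooth_on_const smooth_on_bounded_linear bounded_linear_mult_right open_UNIV)
  have comp: "smooth_on UNIV (\<lambda>t. exp_tail 0 (r * t + s))" for r s :: real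
    by (rule smooth_on_compose[OF orthonormal_basis_real open_UNIV open_UNIV _ affine smooth_on_exp_tail]) simp
  have e: "smooth_on UNIV (\<lambda>t. exp_tail 0 (2 - t))" "smooth_on UNIV (\<lambda>t. exp_tail 0 (t - 1))"
    using comp[of "-1" 2] comp[of 1 "-1"] by simp_all
  show thesis
  proof (rule that[of "\<lambda>t. exp_tail 0 (2 - t) * inverse (exp_tail 0 (2 - t) + exp_tail 0 (t - 1))"])
    show "smooth_on UNIV (\<lambda>t. exp_tail 0 (2 - t) * inverse (exp_tail 0 (2 - t) + exp_tail 0 (t - 1)))"
      by (intro smooth_on_mult smooth_on_inverse smooth_on_add e open_UNIV nz)
  qed (auto simp: exp_tail_def)
qed

text \<open>The squared distance is used because the norm itself need not be smooth at 0. At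
  distance \<open>2 * r\<close> the rescaled square is already 4, beyond the point 2 from which the
  real cutoff vanishes.\<close>

lemma smooth_cutoff:
  fixes x :: "'e::real_inner"
  assumes "r > 0"
  obtains g where "smooth_on UNIV g" "\<And>y. norm (y - x) \<le> r \<Longrightarrow> g y = 1"
    "\<And>y. norm (y - x) \<ge> 2 * r \<Longrightarrow> g y = (0::real)"
proof -
  obtain f :: "real \<Rightarrow> real" where f: "smooth_on UNIV f" "\<And>t. t \<le> 1 \<Longrightarrow> f t = 1" "\<And>t. t \<ge> 2 \<Longrightarrow> f t = 0"
    using smooth_cutoff_real by blast
  define q where "q = (\<lambda>y. ((y - x) \<bullet> (y - x)) * (1 / r\<^sup>2))"
  have "smooth_on UNIV (\<lambda>y. y - x)"
    using smooth_on_add[OF open_UNIV smooth_on_bounded_linear[OF open_UNIV bounded_linear_ident]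
        smooth_on_const[OF open_UNIV, of "- x"]] by simp
  then have "smooth_on UNIV q" unfolding q_def
    by (intro smooth_on_mult smooth_on_bilinear[OF _ bounded_bilinear_inner] smooth_on_const open_UNIV)
  then have "smooth_on UNIV (\<lambda>y. f (q y))"
    by (rule smooth_on_compose[OF orthonormal_basis_real open_UNIV open_UNIV _ _ f(1), rotated]) simp
  moreover have q: "q y = (norm (y - x) / r)\<^sup>2" for y
    by (simp add: q_def power2_norm_eq_inner power_divide)
  have "f (q y) = 1" if "norm (y - x) \<le> r" for y
  proof -
    have "(norm (y - x) / r)\<^sup>2 \<le> 1\<^sup>2" using that assms by (intro power_mono) auto
    then show ?thesis using f(2) q by simp
  qed
  moreover have "f (q y) = 0" if "norm (y - x) \<ge> 2 * r" for y
  proof -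
    have "2\<^sup>2 \<le> (norm (y - x) / r)\<^sup>2" using that assms by (intro power_mono) (auto simp: field_simps)
    then show ?thesis using f(3) q by simp
  qed
  ultimately show thesis using that by blast
qed

section \<open>Atlases and tangent vectors\<close>

lemma chart_inv_image [simp]: "is_chart c \<Longrightarrow> p \<in> fst c \<Longrightarrow> chart_inv c (snd c p) = p"
  by (simp add: chart_inv_def is_chart_def)

text \<open>Serves both the base and the total space. The atlas of the total space contains just the
  charts induced by adapted coordinates, and its carrier is a subset of a product type; what is
  listed here is what the two atlases share.\<close>

locale coherent_atlas =
  fixes A :: "('p, 'e::real_inner) chart set" and B :: "'e set"
  assumes onb: "orthonormal_basis B"
    and chart: "c \<in> A \<Longrightarrow> is_chart c"
    and compatible: "c \<in> A \<Longrightarrow> d \<in> A \<Longrightarrow> charts_compatible c d"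
begin

lemma openin_iff:
  "openin (atlas_topology A) W \<longleftrightarrow> W \<subseteq> atlas_carrier A \<and> (\<forall>c\<in>A. open (snd c ` (W \<inter> fst c)))"
  by (rule openin_atlas_topology) (use chart in \<open>auto simp: is_chart_def\<close>)

lemma open_chart_image: "openin (atlas_topology A) W \<Longrightarrow> c \<in> A \<Longrightarrow> open (snd c ` (W \<inter> fst c))"
  by (simp add: openin_iff)

lemma continuous_on_transition:
  assumes "c \<in> A" "d \<in> A"
  shows "continuous_on (snd c ` (fst c \<inter> fst d)) (snd d \<circ> chart_inv c)"
  using compatible[OF assms] smooth_on_continuous_on unfolding charts_compatible_def by blast

lemma openin_chart_iff:
  assumes "c \<in> A" "W \<subseteq> fst c"
  shows "openin (atlas_topology A) W \<longleftrightarrow> open (snd c ` W)"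
proof
  assume "openin (atlas_topology A) W"
  then show "open (snd c ` W)" using open_chart_image[OF _ assms(1), of W] assms(2) by (metis Int_absorb2)
next
  assume W: "open (snd c ` W)"
  have "open (snd d ` (W \<inter> fst d))" if d: "d \<in> A" for d
  proof -
    \<comment> \<open>The image in \<open>d\<close> is the preimage of the open image in
      \<open>c\<close> under the transition map, which is continuous on an open overlap.\<close>
    have "snd d ` (W \<inter> fst d) = snd d ` (fst d \<inter> fst c) \<inter> (snd c \<circ> chart_inv d) -` (snd c ` W)"
    proof (intro set_eqI iffI)
      fix y assume "y \<in> snd d ` (W \<inter> fst d)"
      then obtain q where "q \<in> W" "q \<in> fst d" "y = snd d q" by blast
      then show "y \<in> snd d ` (fst d \<inter> fst c) \<inter> (snd c \<circ> chart_inv d) -` (snd c ` W)"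
        using assms(2) chart[OF d] by auto
    next
      fix y assume "y \<in> snd d ` (fst d \<inter> fst c) \<inter> (snd c \<circ> chart_inv d) -` (snd c ` W)"
      then obtain q w where q: "q \<in> fst d" "q \<in> fst c" "y = snd d q" and w: "w \<in> W" "snd c q = snd c w"
        using chart[OF d] by auto
      then have "q = w" using chart[OF assms(1)] assms(2) by (auto simp: is_chart_def dest: inj_onD)
      then show "y \<in> snd d ` (W \<inter> fst d)" using q w by blast
    qed
    moreover have "open (snd d ` (fst d \<inter> fst c))"
      using compatible[OF d assms(1)] by (simp add: charts_compatible_def)
    ultimately show ?thesis
      using continuous_open_preimage[OF continuous_on_transition[OF d assms(1)] _ W] by simp
  qed
  then show "openin (atlas_topology A) W" using assms by (auto simp: openin_iff atlas_carrier_def)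
qed

lemma openin_chart_domain: "c \<in> A \<Longrightarrow> openin (atlas_topology A) (fst c)"
  using openin_chart_iff[of c "fst c"] chart[of c] by (simp add: is_chart_def)

lemma openin_carrier: "openin (atlas_topology A) (atlas_carrier A)"
  unfolding atlas_carrier_def using openin_chart_domain by blast

lemma chart_at:
  assumes "openin (atlas_topology A) W" "p \<in> W"
  obtains c where "c \<in> A" "p \<in> fst c"
  using assms by (auto simp: openin_iff atlas_carrier_def)

text \<open>\<open>smooth_fun\<close> quantifies over all charts; composition with the smooth
  transition maps transports smoothness from one chart to the others.\<close>

lemma smooth_funI_chart:
  assumes c: "c \<in> A" and W: "openin (atlas_topology A) W" "W \<subseteq> fst c"
    and f: "smooth_on (snd c ` W) (f \<circ> chart_inv c)"
  shows "smooth_fun A W f"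
  unfolding smooth_fun_def
proof
  fix d assume d: "d \<in> A"
  have S: "open (snd d ` (W \<inter> fst d))" by (rule open_chart_image[OF W(1) d])
  have tr: "smooth_on (snd d ` (W \<inter> fst d)) (snd c \<circ> chart_inv d)"
    using compatible[OF d c] W(2) by (auto simp: charts_compatible_def elim!: smooth_on_subset)
  have "smooth_on (snd d ` (W \<inter> fst d)) (\<lambda>x. (f \<circ> chart_inv c) ((snd c \<circ> chart_inv d) x))"
    by (rule smooth_on_compose[OF onb S _ _ tr f])
      (use openin_chart_iff[OF c W(2)] W(1) chart[OF d] in auto)
  then show "smooth_on (snd d ` (W \<inter> fst d)) (f \<circ> chart_inv d)"
    by (rule smooth_on_cong[OF S]) (use chart[OF c] chart[OF d] W(2) in auto)
qed

lemma smooth_funD_chart: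
  assumes "smooth_fun A W f" "c \<in> A" "V \<subseteq> W" "V \<subseteq> fst c"
  shows "smooth_on (snd c ` V) (f \<circ> chart_inv c)"
  using assms unfolding smooth_fun_def by (meson Int_greatest image_mono smooth_on_subset)

text \<open>Smoothness is mostly handled on germs, through \<open>smooth_near\<close>; this converts
  the results back to smoothness on a set.\<close>

lemma smooth_fun_local:
  assumes "\<And>p. p \<in> W \<Longrightarrow> smooth_near A p f"
  shows "smooth_fun A W f"
  unfolding smooth_fun_def
proof (intro ballI smooth_on_local)
  fix c x assume c: "c \<in> A" and "x \<in> snd c ` (W \<inter> fst c)"
  then obtain p where p: "p \<in> W" "p \<in> fst c" "x = snd c p" by blast
  then obtain V where V: "openin (atlas_topology A) V" "p \<in> V" "smooth_fun A V f"
    using assms by (auto simp: smooth_near_def)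
  show "\<exists>T. open T \<and> x \<in> T \<and> smooth_on T (f \<circ> chart_inv c)"
    using open_chart_image[OF V(1) c] V p c by (auto simp: smooth_fun_def)
qed

lemma smooth_nearI: "openin (atlas_topology A) W \<Longrightarrow> smooth_fun A W f \<Longrightarrow> p \<in> W \<Longrightarrow> smooth_near A p f"
  by (auto simp: smooth_near_def)

lemma smooth_near_cong:
  assumes "openin (atlas_topology A) W" "p \<in> W" "smooth_near A p f" "\<And>q. q \<in> W \<Longrightarrow> f q = g q"
  shows "smooth_near A p g"
proof -
  obtain V where V: "openin (atlas_topology A) V" "p \<in> V" "smooth_fun A V f"
    using assms(3) by (auto simp: smooth_near_def)
  have WV: "openin (atlas_topology A) (W \<inter> V)" by (intro openin_Int assms V)
  have "smooth_on (snd c ` (W \<inter> V \<inter> fst c)) (g \<circ> chart_inv c)" if c: "c \<in> A" for c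
    by (rule smooth_on_cong[OF open_chart_image[OF WV c] smooth_funD_chart[OF V(3) c]])
      (use chart[OF c] assms(4) in auto)
  then show ?thesis using WV assms(2) V(2) unfolding smooth_near_def smooth_fun_def by blast
qed

lemma smooth_near_openD:
  assumes "smooth_near A p f"
  obtains W where "openin (atlas_topology A) W" "p \<in> W" "\<And>q. q \<in> W \<Longrightarrow> smooth_near A q f"
  using assms smooth_nearI by (metis smooth_near_def)

lemma smooth_near_const: "p \<in> atlas_carrier A \<Longrightarrow> smooth_near A p (\<lambda>q. r)"
  by (rule smooth_nearI[OF openin_carrier])
    (auto simp: smooth_fun_def comp_def intro!: smooth_on_const open_chart_image openin_carrier)

lemma smooth_near_binary:
  assumes "smooth_near A p f" "smooth_near A p g"
    and h: "\<And>S f g. open S \<Longrightarrow> smooth_on S f \<Longrightarrow> smooth_on S g \<Longrightarrow> smooth_on S (\<lambda>x::'e. h (f x) (g x))"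
  shows "smooth_near A p (\<lambda>q. h (f q) (g q))"
proof -
  obtain V where V: "openin (atlas_topology A) V" "p \<in> V" "smooth_fun A V f"
    using assms(1) by (auto simp: smooth_near_def)
  obtain W where W: "openin (atlas_topology A) W" "p \<in> W" "smooth_fun A W g"
    using assms(2) by (auto simp: smooth_near_def)
  have VW: "openin (atlas_topology A) (V \<inter> W)" by (intro openin_Int V W)
  have "smooth_on (snd c ` (V \<inter> W \<inter> fst c)) (\<lambda>x. h ((f \<circ> chart_inv c) x) ((g \<circ> chart_inv c) x))"
    if c: "c \<in> A" for c
    by (intro h open_chart_image[OF VW c] smooth_funD_chart[OF V(3) c] smooth_funD_chart[OF W(3) c]) auto
  then have "smooth_fun A (V \<inter> W) (\<lambda>q. h (f q) (g q))" by (simp add: smooth_fun_def comp_def)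
  then show ?thesis using smooth_nearI[OF VW] V W by blast
qed

lemma smooth_near_add: "smooth_near A p f \<Longrightarrow> smooth_near A p g \<Longrightarrow> smooth_near A p (\<lambda>q. f q + g q)"
  by (rule smooth_near_binary) (auto intro: smooth_on_add)

lemma smooth_near_mult: "smooth_near A p f \<Longrightarrow> smooth_near A p g \<Longrightarrow> smooth_near A p (\<lambda>q. f q * g q)"
  by (rule smooth_near_binary) (auto intro: smooth_on_mult)

lemma smooth_near_carrier: "smooth_near A p f \<Longrightarrow> p \<in> atlas_carrier A"
  by (auto simp: smooth_near_def openin_iff)

lemma smooth_near_cmult: "smooth_near A p f \<Longrightarrow> smooth_near A p (\<lambda>q. r * f q)"
  by (intro smooth_near_mult smooth_near_const smooth_near_carrier)

lemma smooth_near_minus: "smooth_near A p f \<Longrightarrow> smooth_near A p (\<lambda>q. - f q)"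
  using smooth_near_cmult[of p f "-1"] by simp

lemma smooth_near_diff: "smooth_near A p f \<Longrightarrow> smooth_near A p g \<Longrightarrow> smooth_near A p (\<lambda>q. f q - g q)"
  using smooth_near_add[OF _ smooth_near_minus, of p f g] by simp

lemma smooth_near_sum:
  assumes "p \<in> atlas_carrier A" "\<And>i. i \<in> I \<Longrightarrow> smooth_near A p (f i)"
  shows "smooth_near A p (\<lambda>q. \<Sum>i\<in>I. f i q)"
  using assms(2)
  by (induction I rule: infinite_finite_induct) (auto intro!: smooth_near_add smooth_near_const assms(1))

lemma smooth_near_prod:
  assumes "p \<in> atlas_carrier A" "\<And>i. i \<in> I \<Longrightarrow> smooth_near A p (f i)"
  shows "smooth_near A p (\<lambda>q. \<Prod>i\<in>I. f i q)"
  using assms(2)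
  by (induction I rule: infinite_finite_induct) (auto intro!: smooth_near_mult smooth_near_const assms(1))

lemma smooth_near_det:
  assumes "p \<in> atlas_carrier A" "\<And>i j. smooth_near A p (\<lambda>q. M q $ i $ j)"
  shows "smooth_near A p (\<lambda>q. det (M q))"
  unfolding det_def by (intro smooth_near_sum smooth_near_cmult smooth_near_prod assms)

lemma smooth_near_inverse:
  assumes "smooth_near A p f" "f p \<noteq> 0"
  shows "smooth_near A p (\<lambda>q. inverse (f q))"
proof -
  obtain V where V: "openin (atlas_topology A) V" "p \<in> V" "smooth_fun A V f"
    using assms(1) by (auto simp: smooth_near_def)
  obtain c where c: "c \<in> A" "p \<in> fst c" using chart_at[OF V(1,2)] .
  define S where "S = snd c ` (V \<inter> fst c)"
  have S: "open S" "smooth_on S (f \<circ> chart_inv c)"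
    unfolding S_def by (intro open_chart_image V c) (use V(3) c in \<open>auto simp: smooth_fun_def\<close>)
  \<comment> \<open>The neighbourhood shrinks to the points where \<open>f\<close> is nonzero; their
    image \<open>T\<close> is open by continuity of \<open>f\<close> in the chart.\<close>
  define T where "T = S \<inter> (f \<circ> chart_inv c) -` (- {0})"
  have T: "open T" unfolding T_def
    by (rule continuous_open_preimage[OF smooth_on_continuous_on[OF S(2)] S(1)]) auto
  define U where "U = {q \<in> V \<inter> fst c. f q \<noteq> 0}"
  have TU: "T = snd c ` U" using chart[OF c(1)] by (force simp: T_def U_def S_def)
  have U: "openin (atlas_topology A) U" "U \<subseteq> fst c"
    using openin_chart_iff[OF c(1), of U] T TU by (auto simp: U_def)
  have "smooth_on T (\<lambda>x. inverse ((f \<circ> chart_inv c) x))"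
    by (rule smooth_on_inverse[OF T smooth_on_subset[OF S(2)]]) (auto simp: T_def)
  then have "smooth_fun A U (\<lambda>q. inverse (f q))"
    by (intro smooth_funI_chart[OF c(1) U]) (simp add: TU comp_def)
  then show ?thesis using smooth_nearI[OF U(1)] V c assms(2) by (auto simp: U_def)
qed

text \<open>Cramer's rule expresses the solution through determinants, so it depends smoothly on the data.\<close>

lemma smooth_near_linear_solution:
  fixes M :: "'p \<Rightarrow> real ^ 'k ^ 'k"
  assumes W: "openin (atlas_topology A) W" "p \<in> W"
    and M: "\<And>i j. smooth_near A p (\<lambda>q. M q $ i $ j)" and w: "\<And>i. smooth_near A p (\<lambda>q. w q $ i)"
    and det: "\<And>q. q \<in> W \<Longrightarrow> det (M q) \<noteq> 0" and x: "\<And>q. q \<in> W \<Longrightarrow> M q *v x q = w q"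
  shows "smooth_near A p (\<lambda>q. x q $ k)"
proof -
  have carrier: "p \<in> atlas_carrier A" using smooth_near_carrier[OF w] .
  have "smooth_near A p (\<lambda>q. if j = k then w q $ i else M q $ i $ j)" for i j
    by (cases "j = k") (simp_all add: M w)
  then have "smooth_near A p (\<lambda>q. det (\<chi> i j. if j = k then w q $ i else M q $ i $ j) * inverse (det (M q)))"
    by (intro smooth_near_mult smooth_near_det smooth_near_inverse carrier det W M) simp
  then show ?thesis
    by (rule smooth_near_cong[OF W]) (use x det in \<open>simp add: cramer divide_inverse\<close>)
qed

lemma smooth_near_coordinate:
  assumes "c \<in> A" "p \<in> fst c" "bounded_linear h"
  shows "smooth_near A p (\<lambda>q. h (snd c q))"
proof -
  have S: "open (snd c ` fst c)" using chart[OF assms(1)] by (simp add: is_chart_def)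
  have "smooth_fun A (fst c) (\<lambda>q. h (snd c q))"
  proof (rule smooth_funI_chart[OF assms(1) openin_chart_domain[OF assms(1)] order_refl])
    show "smooth_on (snd c ` fst c) ((\<lambda>q. h (snd c q)) \<circ> chart_inv c)"
      by (rule smooth_on_cong[OF S smooth_on_bounded_linear[OF S assms(3)]]) (use chart[OF assms(1)] in auto)
  qed
  then show ?thesis using smooth_nearI[OF openin_chart_domain] assms by blast
qed

lemma smooth_near_chartD:
  assumes "smooth_near A p f" "c \<in> A" "p \<in> fst c"
  obtains W where "openin (atlas_topology A) W" "p \<in> W" "W \<subseteq> fst c" "open (snd c ` W)"
    "smooth_on (snd c ` W) (f \<circ> chart_inv c)"
proof -
  obtain V where V: "openin (atlas_topology A) V" "p \<in> V" "smooth_fun A V f"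
    using assms(1) by (auto simp: smooth_near_def)
  show thesis
    by (rule that[of "V \<inter> fst c"])
      (use V assms open_chart_image[OF V(1) assms(2)] openin_Int[OF V(1) openin_chart_domain[OF assms(2)]]
        in \<open>auto simp: smooth_fun_def\<close>)
qed

section \<open>Tangent vectors as local derivations\<close>

lemma tangent_vec_has_derivative:
  assumes "smooth_near A p f" "c \<in> A" "p \<in> fst c"
  shows "((f \<circ> chart_inv c) has_derivative (\<lambda>w. tangent_vec A c p w f)) (at (snd c p))"
proof -
  obtain W where "p \<in> W" "smooth_on (snd c ` W) (f \<circ> chart_inv c)"
    using smooth_near_chartD[OF assms] by metis
  then show ?thesis using assms(1) smooth_on_has_derivative[of "snd c ` W" "f \<circ> chart_inv c" "snd c p"]
    by (simp add: tangent_vec_def)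
qed

lemma tangent_vec_eqI:
  assumes "smooth_near A p f" "((f \<circ> chart_inv c) has_derivative f') (at (snd c p))"
  shows "tangent_vec A c p w f = f' w"
  using assms frechet_derivative_at[OF assms(2)] by (simp add: tangent_vec_def)

lemma linear_tangent_vec:
  assumes "c \<in> A" "p \<in> fst c"
  shows "linear (tangent_vec A c p)"
proof -
  have *: "linear (\<lambda>w. tangent_vec A c p w f)" for f
  proof (cases "smooth_near A p f")
    case True
    then show ?thesis using tangent_vec_has_derivative[OF True assms] has_derivative_linear by blast
  next
    case False
    then show ?thesis by (simp add: tangent_vec_def linear_iff)
  qed
  show ?thesis by (rule linearI) (simp_all add: fun_eq_iff linear_add[OF *] linear_cmul[OF *] scaleR_fun_def)
qed

lemma tangent_vec_change:
  assumes c: "c \<in> A" "p \<in> fst c" and d: "d \<in> A" "p \<in> fst d"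
  shows "tangent_vec A c p w = tangent_vec A d p (frechet_derivative (snd d \<circ> chart_inv c) (at (snd c p)) w)"
proof
  fix f
  show "tangent_vec A c p w f = tangent_vec A d p (frechet_derivative (snd d \<circ> chart_inv c) (at (snd c p)) w) f"
  proof (cases "smooth_near A p f")
    case True
    have S: "open (snd c ` (fst c \<inter> fst d))" and sm: "smooth_on (snd c ` (fst c \<inter> fst d)) (snd d \<circ> chart_inv c)"
      using compatible[OF c(1) d(1)] by (auto simp: charts_compatible_def)
    have pS: "snd c p \<in> snd c ` (fst c \<inter> fst d)" using c d by blast
    have 1: "((snd d \<circ> chart_inv c) has_derivative frechet_derivative (snd d \<circ> chart_inv c) (at (snd c p))) (at (snd c p))"
      by (rule smooth_on_has_derivative[OF sm pS])
    have 2: "((f \<circ> chart_inv d) has_derivative (\<lambda>w. tangent_vec A d p w f)) (at ((snd d \<circ> chart_inv c) (snd c p)))"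
      using tangent_vec_has_derivative[OF True d] chart[OF c(1)] c by simp
    have "((\<lambda>x. (f \<circ> chart_inv d) ((snd d \<circ> chart_inv c) x)) has_derivative
        (\<lambda>w. tangent_vec A d p (frechet_derivative (snd d \<circ> chart_inv c) (at (snd c p)) w) f)) (at (snd c p))"
      by (rule has_derivative_compose[OF 1 2])
    then have "((f \<circ> chart_inv c) has_derivative
        (\<lambda>w. tangent_vec A d p (frechet_derivative (snd d \<circ> chart_inv c) (at (snd c p)) w) f)) (at (snd c p))"
      by (rule has_derivative_transform_within_open[OF _ S pS]) (use chart[OF c(1)] chart[OF d(1)] in auto)
    then show ?thesis by (rule tangent_vec_eqI[OF True])
  qed (simp add: tangent_vec_def)
qed

lemma tangent_space_chart:
  assumes "v \<in> tangent_space A p" "c \<in> A" "p \<in> fst c"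
  obtains w where "v = tangent_vec A c p w"
  using assms tangent_vec_change unfolding tangent_space_def by blast

lemma tangent_vec_in_tangent_space: "c \<in> A \<Longrightarrow> p \<in> fst c \<Longrightarrow> tangent_vec A c p w \<in> tangent_space A p"
  by (auto simp: tangent_space_def)

lemma tangent_vec_coordinate:
  assumes "c \<in> A" "p \<in> fst c" "bounded_linear h"
  shows "tangent_vec A c p w (\<lambda>q. h (snd c q)) = h w"
proof (rule tangent_vec_eqI[OF smooth_near_coordinate[OF assms]])
  have S: "open (snd c ` fst c)" using chart[OF assms(1)] by (simp add: is_chart_def)
  show "(((\<lambda>q. h (snd c q)) \<circ> chart_inv c) has_derivative h) (at (snd c p))"
    by (rule has_derivative_transform_within_open[OF bounded_linear_imp_has_derivative[OF assms(3)] S])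
      (use chart[OF assms(1)] assms(2) in auto)
qed

lemma tangent_obtain:
  assumes "v \<in> tangent_space A p"
  obtains c w where "c \<in> A" "p \<in> fst c" "v = tangent_vec A c p w"
  using assms unfolding tangent_space_def by blast

lemma tangent_add:
  assumes "v \<in> tangent_space A p" "smooth_near A p f" "smooth_near A p g"
  shows "v (\<lambda>q. f q + g q) = v f + v g"
proof -
  obtain c w where c: "c \<in> A" "p \<in> fst c" and v: "v = tangent_vec A c p w" using tangent_obtain[OF assms(1)] .
  have "(\<lambda>q. f q + g q) \<circ> chart_inv c = (\<lambda>x. (f \<circ> chart_inv c) x + (g \<circ> chart_inv c) x)" by auto
  then show ?thesis unfolding v
    using tangent_vec_eqI[OF smooth_near_add[OF assms(2,3)]]
      has_derivative_add[OF tangent_vec_has_derivative[OF assms(2) c] tangent_vec_has_derivative[OF assms(3) c]]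
    by simp
qed

lemma tangent_mult:
  assumes "v \<in> tangent_space A p" "smooth_near A p f" "smooth_near A p g"
  shows "v (\<lambda>q. f q * g q) = f p * v g + v f * g p"
proof -
  obtain c w where c: "c \<in> A" "p \<in> fst c" and v: "v = tangent_vec A c p w" using tangent_obtain[OF assms(1)] .
  have "(\<lambda>q. f q * g q) \<circ> chart_inv c = (\<lambda>x. (f \<circ> chart_inv c) x * (g \<circ> chart_inv c) x)" by auto
  then show ?thesis unfolding v
    using tangent_vec_eqI[OF smooth_near_mult[OF assms(2,3)]] chart[OF c(1)] c(2)
      has_derivative_mult[OF tangent_vec_has_derivative[OF assms(2) c] tangent_vec_has_derivative[OF assms(3) c]]
    by simp
qed

lemma tangent_const:
  assumes "v \<in> tangent_space A p"
  shows "v (\<lambda>q. r) = 0"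
proof -
  obtain c w where c: "c \<in> A" "p \<in> fst c" and v: "v = tangent_vec A c p w" using tangent_obtain[OF assms] .
  show ?thesis unfolding v by (simp add: tangent_vec_def comp_def)
qed

lemma tangent_sum:
  assumes "v \<in> tangent_space A p" "p \<in> atlas_carrier A" "\<And>i. i \<in> I \<Longrightarrow> smooth_near A p (f i)"
  shows "v (\<lambda>q. \<Sum>i\<in>I. f i q) = (\<Sum>i\<in>I. v (f i))"
  using assms(3)
  by (induction I rule: infinite_finite_induct)
    (simp_all add: tangent_const[OF assms(1)] tangent_add[OF assms(1)] smooth_near_sum[OF assms(2)])

text \<open>The default value 0 does no harm: failing to be smooth near \<open>p\<close> is itself a
  property of the germ, so \<open>f\<close> and \<open>g\<close> fall under the same case.\<close>

lemma tangent_cong: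
  assumes "v \<in> tangent_space A p" "openin (atlas_topology A) W" "p \<in> W" "\<And>q. q \<in> W \<Longrightarrow> f q = g q"
  shows "v f = v g"
proof (cases "smooth_near A p f")
  case True
  then have g: "smooth_near A p g" using smooth_near_cong[OF assms(2,3)] assms(4) by blast
  obtain c w where c: "c \<in> A" "p \<in> fst c" and v: "v = tangent_vec A c p w" using tangent_obtain[OF assms(1)] .
  have "((g \<circ> chart_inv c) has_derivative (\<lambda>w. tangent_vec A c p w f)) (at (snd c p))"
    by (rule has_derivative_transform_within_open[OF tangent_vec_has_derivative[OF True c]
          open_chart_image[OF assms(2) c(1)]])
      (use c chart[OF c(1)] assms(3,4) in auto)
  then show ?thesis unfolding v using tangent_vec_eqI[OF g] by simp
next
  case False
  then have "\<not> smooth_near A p g" using smooth_near_cong[OF assms(2,3)] assms(4) by metis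
  then show ?thesis using False assms(1) by (auto simp: tangent_space_def tangent_vec_def)
qed

lemma smooth_near_derivative:
  assumes "smooth_near A p f" "c \<in> A" "p \<in> fst c"
  shows "smooth_near A p (\<lambda>q. frechet_derivative (f \<circ> chart_inv c) (at (snd c q)) w)"
proof -
  obtain W where W: "openin (atlas_topology A) W" "p \<in> W" "W \<subseteq> fst c" "open (snd c ` W)"
    "smooth_on (snd c ` W) (f \<circ> chart_inv c)"
    using smooth_near_chartD[OF assms] .
  have "smooth_fun A W (\<lambda>q. frechet_derivative (f \<circ> chart_inv c) (at (snd c q)) w)"
    by (rule smooth_funI_chart[OF assms(2) W(1,3) smooth_on_cong[OF W(4) smooth_on_derivative[OF W(5), of w]]])
      (use W(3) chart[OF assms(2)] in auto)
  then show ?thesis using smooth_nearI W by blast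
qed

lemma tangent_space_linear:
  assumes "p \<in> atlas_carrier A"
  shows "subspace (tangent_space A p)"
proof -
  obtain c where c: "c \<in> A" "p \<in> fst c" using assms by (auto simp: atlas_carrier_def)
  have "tangent_space A p = range (tangent_vec A c p)"
    using tangent_space_chart[OF _ c] tangent_vec_in_tangent_space[OF c] by blast
  then show ?thesis using linear_subspace_image[OF linear_tangent_vec[OF c] subspace_UNIV] by simp
qed

end

section \<open>Compact balls and bump functions on a manifold\<close>

lemma coherent_atlas_manifold:
  "smooth_manifold A \<Longrightarrow> orthonormal_basis B \<Longrightarrow> coherent_atlas A B"
  by unfold_locales (auto simp: smooth_manifold_def)

text \<open>The cube over \<open>insert j B\<close> is the Minkowski sum of a compact segment along
  \<open>j\<close> and the cube over \<open>B\<close>, so compactness passes up by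
  induction.\<close>

lemma compact_coordinate_cube:
  fixes B :: "'e::real_normed_vector set"
  assumes "finite B"
  shows "compact {\<Sum>i\<in>B. u i *\<^sub>R i | u. \<forall>i\<in>B. \<bar>u i\<bar> \<le> (r::real)}"
  using assms
proof (induction B)
  case (insert j B)
  let ?K = "\<lambda>B. {\<Sum>i\<in>B. u i *\<^sub>R i | u. \<forall>i\<in>B. \<bar>u i\<bar> \<le> r}"
  have "?K (insert j B) = {x + y | x y. x \<in> (\<lambda>t. t *\<^sub>R j) ` {-r..r} \<and> y \<in> ?K B}" (is "_ = ?R")
  proof
    show "?K (insert j B) \<subseteq> ?R"
      using insert.hyps by (fastforce simp: abs_le_iff)
    show "?R \<subseteq> ?K (insert j B)"
    proof
      fix z assume "z \<in> ?R"
      then obtain t u where tu: "\<bar>t\<bar> \<le> r" "\<forall>i\<in>B. \<bar>u i\<bar> \<le> r" "z = t *\<^sub>R j + (\<Sum>i\<in>B. u i *\<^sub>R i)"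
        unfolding abs_le_iff atLeastAtMost_iff image_iff by fastforce
      have "(\<Sum>i\<in>B. (u(j := t)) i *\<^sub>R i) = (\<Sum>i\<in>B. u i *\<^sub>R i)"
        by (rule sum.cong) (use insert.hyps in auto)
      then have "z = (\<Sum>i\<in>insert j B. (u(j := t)) i *\<^sub>R i)" using insert.hyps tu by simp
      then show "z \<in> ?K (insert j B)" using tu by fastforce
    qed
  qed
  moreover have "compact ((\<lambda>t. t *\<^sub>R j) ` {-r..r})"
    by (intro compact_continuous_image continuous_intros compact_Icc)
  ultimately show ?case using compact_sums[OF _ insert.IH] by simp
qed simp

text \<open>By Cauchy-Schwarz the coordinates of points of the ball around 0 are bounded by
  \<open>r\<close>, so this ball is a closed subset of a compact cube; translation gives the other
  centres.\<close>

lemma compact_cball_orthonormal: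
  fixes B :: "'e::real_inner set"
  assumes "orthonormal_basis B"
  shows "compact (cball x r :: 'e set)"
proof -
  let ?K = "{\<Sum>i\<in>B. u i *\<^sub>R i | u. \<forall>i\<in>B. \<bar>u i\<bar> \<le> r}"
  have fin: "finite B" and one: "\<And>i. i \<in> B \<Longrightarrow> norm i = 1"
    using assms by (auto simp: orthonormal_basis_def norm_eq_1)
  have "cball 0 r \<subseteq> ?K"
  proof
    fix y :: 'e assume y: "y \<in> cball 0 r"
    have "\<bar>y \<bullet> i\<bar> \<le> r" if "i \<in> B" for i
      using Cauchy_Schwarz_ineq2[of y i] one[OF that] y by simp
    then show "y \<in> ?K" using orthonormal_expansion[OF assms, of y] by blast
  qed
  then have "compact (cball (0::'e) r)"
    using compact_Int_closed[OF compact_coordinate_cube[OF fin] closed_cball, of r 0 r]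
    by (simp add: Int_absorb1)
  then have "compact ((+) x ` cball 0 r)" by (rule compact_translation)
  then show ?thesis by simp
qed

text \<open>The set \<open>K\<close> that corresponds to a closed ball in a chart is compact, hence
  closed by the Hausdorff property; therefore the cutoff extended by 0 is smooth beyond the chart
  domain. The open set \<open>N\<close> on which it vanishes is part of the conclusion because
  sections given only on \<open>W\<close> are later extended by zero there.\<close>

lemma manifold_bump:
  fixes A :: "('p, 'e::real_inner) chart set" and B :: "'e set"
  assumes M: "smooth_manifold A" and onb: "orthonormal_basis B"
    and W: "openin (atlas_topology A) W" "p \<in> W"
  obtains f V N where "smooth_fun A UNIV f" "openin (atlas_topology A) V" "p \<in> V" "V \<subseteq> W"
    "\<And>q. q \<in> V \<Longrightarrow> f q = 1" "openin (atlas_topology A) N" "N \<union> W = UNIV" "\<And>q. q \<in> N \<Longrightarrow> f q = 0"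
proof -
  interpret coherent_atlas A B by (rule coherent_atlas_manifold[OF M onb])
  obtain c where c: "c \<in> A" "p \<in> fst c" using chart_at[OF W] .
  have ch: "is_chart c" by (rule chart[OF c(1)])
  have S: "open (snd c ` (W \<inter> fst c))" by (rule open_chart_image[OF W(1) c(1)])
  then obtain R where R: "R > 0" "cball (snd c p) R \<subseteq> snd c ` (W \<inter> fst c)"
    using W(2) c(2) open_contains_cball by blast
  define r where "r = R / 2"
  have r: "r > 0" "cball (snd c p) (2 * r) \<subseteq> snd c ` (W \<inter> fst c)" using R by (auto simp: r_def)
  obtain g where g: "smooth_on UNIV g" "\<And>y. norm (y - snd c p) \<le> r \<Longrightarrow> g y = 1"
    "\<And>y. norm (y - snd c p) \<ge> 2 * r \<Longrightarrow> g y = (0::real)"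
    using smooth_cutoff[OF r(1)] by blast
  define K where "K = chart_inv c ` cball (snd c p) (2 * r)"
  define V where "V = chart_inv c ` ball (snd c p) r"
  define N where "N = - K"
  define f where "f q = (if q \<in> fst c then g (snd c q) else 0)" for q
  have inv: "chart_inv c y \<in> W \<inter> fst c" "snd c (chart_inv c y) = y" if y: "y \<in> cball (snd c p) (2 * r)" for y
  proof -
    obtain q where "q \<in> W" "q \<in> fst c" "y = snd c q" using y r(2) by blast
    then show "chart_inv c y \<in> W \<inter> fst c" "snd c (chart_inv c y) = y" using ch by auto
  qed
  have KW: "K \<subseteq> W \<inter> fst c" using inv by (auto simp: K_def)
  have ballsub: "ball (snd c p) r \<subseteq> cball (snd c p) (2 * r)" using r(1) by auto
  have sndV: "snd c ` V = ball (snd c p) r" unfolding V_def image_image using inv(2) ballsub by force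
  have VK: "V \<subseteq> K" using ballsub by (auto simp: V_def K_def)
  have V: "openin (atlas_topology A) V" using openin_chart_iff[OF c(1), of V] VK KW sndV by auto
  \<comment> \<open>Continuity of the inverse chart for the atlas topology lets compactness pass
    from the ball to \<open>K\<close>.\<close>
  have "continuous_map (top_of_set (snd c ` fst c)) (atlas_topology A) (chart_inv c)"
    unfolding continuous_map_def
  proof (intro conjI allI impI)
    show "chart_inv c \<in> topspace (top_of_set (snd c ` fst c)) \<rightarrow> topspace (atlas_topology A)"
      using ch openin_subset[OF openin_chart_domain[OF c(1)]] by auto
    fix G assume G: "openin (atlas_topology A) G"
    have "{x \<in> topspace (top_of_set (snd c ` fst c)). chart_inv c x \<in> G} = snd c ` (G \<inter> fst c)"
      using ch by (auto intro: rev_image_eqI)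
    then show "openin (top_of_set (snd c ` fst c)) {x \<in> topspace (top_of_set (snd c ` fst c)). chart_inv c x \<in> G}"
      using open_chart_image[OF G c(1)] by (auto intro!: open_subset)
  qed
  moreover have "compactin (top_of_set (snd c ` fst c)) (cball (snd c p) (2 * r))"
    using compact_cball_orthonormal[OF onb] r(2) by (auto simp: compactin_subtopology)
  ultimately have "compactin (atlas_topology A) K" unfolding K_def by (rule image_compactin[rotated])
  then have "closedin (atlas_topology A) K"
    using M by (auto simp: smooth_manifold_def intro: compactin_imp_closedin)
  moreover have top: "topspace (atlas_topology A) = UNIV"
    using openin_carrier M openin_subset by (fastforce simp: smooth_manifold_def)
  ultimately have N: "openin (atlas_topology A) N" by (simp add: N_def closedin_def Compl_eq_Diff_UNIV)
  have fN: "f q = 0" if "q \<in> N" for q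
  proof (cases "q \<in> fst c")
    case True
    have "snd c q \<notin> cball (snd c p) (2 * r)"
    proof
      assume "snd c q \<in> cball (snd c p) (2 * r)"
      then have "chart_inv c (snd c q) \<in> K" by (simp add: K_def)
      then show False using that True ch by (simp add: N_def)
    qed
    then show ?thesis using g(3) by (simp add: f_def dist_norm norm_minus_commute)
  qed (simp add: f_def)
  have near: "smooth_near A q f" for q
  proof (cases "q \<in> N")
    case True
    show ?thesis
      by (rule smooth_near_cong[OF N True smooth_near_const]) (use fN M in \<open>auto simp: smooth_manifold_def\<close>)
  next
    case False
    then have q: "q \<in> fst c" using KW by (auto simp: N_def)
    have So: "open (snd c ` fst c)" using ch by (simp add: is_chart_def)
    have "smooth_fun A (fst c) f"
      by (rule smooth_funI_chart[OF c(1) openin_chart_domain[OF c(1)] order_refl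
            smooth_on_cong[OF So smooth_on_subset[OF g(1)]]]) (use ch in \<open>auto simp: f_def\<close>)
    then show ?thesis using smooth_nearI[OF openin_chart_domain[OF c(1)] _ q] by blast
  qed
  have f1: "f q = 1" if "q \<in> V" for q
  proof -
    have "snd c q \<in> ball (snd c p) r" "q \<in> fst c" using that sndV VK KW by auto
    then show ?thesis using g(2) by (simp add: f_def dist_norm norm_minus_commute)
  qed
  have "chart_inv c (snd c p) \<in> V" unfolding V_def using r(1) by (intro imageI) simp
  then have pV: "p \<in> V" using ch c(2) by simp
  show thesis
    by (rule that[OF smooth_fun_local[OF near] V pV _ f1 N _ fN]) (use VK KW in \<open>auto simp: N_def\<close>)
qed

section \<open>Frames and sections\<close>

lemma frame_expansion:
  assumes "frame_basis_at D e q" "u \<in> fibre D q"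
  shows "(\<Sum>a\<in>UNIV. frame_coords e q u $ a *\<^sub>R e a q) = u"
proof -
  have inj: "inj (\<lambda>a. e a q)" and ind: "independent (range (\<lambda>a. e a q))"
    and sp: "u \<in> span (range (\<lambda>a. e a q))"
    using assms by (auto simp: frame_basis_at_def)
  have "u = (\<Sum>b\<in>range (\<lambda>a. e a q). representation (range (\<lambda>a. e a q)) u b *\<^sub>R b)"
    using real_vector.sum_representation_eq[OF ind sp] by simp
  also have "\<dots> = (\<Sum>a\<in>UNIV. frame_coords e q u $ a *\<^sub>R e a q)"
    by (simp add: sum.reindex[OF inj] frame_coords_def)
  finally show ?thesis by simp
qed

lemma frame_in_fibre: "frame_basis_at D e q \<Longrightarrow> e a q \<in> fibre D q"
  unfolding frame_basis_at_def by (metis rangeI span_base)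

lemma subspace_fibre: "frame_basis_at D e q \<Longrightarrow> subspace (fibre D q)"
  unfolding frame_basis_at_def by (metis subspace_span)

lemma frame_combination_in_fibre:
  "frame_basis_at D e q \<Longrightarrow> (\<Sum>a\<in>UNIV. r a *\<^sub>R e a q) \<in> fibre D q"
  by (intro subspace_sum subspace_scale subspace_fibre frame_in_fibre)

lemma frame_combination_zero:
  fixes e :: "('m, 'v::real_vector, 'k::finite) frame"
  assumes "frame_basis_at D e q" "(\<Sum>a\<in>UNIV. r a *\<^sub>R e a q) = 0"
  shows "r a = 0"
proof -
  have inj: "inj (\<lambda>a. e a q)" and ind: "independent (range (\<lambda>a. e a q))"
    using assms by (auto simp: frame_basis_at_def)
  have inv: "inv (\<lambda>a. e a q) (e b q) = b" for b using inv_f_f[OF inj, of b] by simp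
  have "(\<Sum>b\<in>range (\<lambda>a. e a q). r (inv (\<lambda>a. e a q) b) *\<^sub>R b) = 0"
    using assms(2) by (simp add: sum.reindex[OF inj] inv)
  from real_vector.independentD[OF ind finite_imageI[OF finite] order_refl this, of "e a q"]
  show ?thesis by (simp add: inv)
qed

lemma frame_coords_combination:
  fixes e :: "('m, 'v::real_vector, 'k::finite) frame"
  assumes "frame_basis_at D e q"
  shows "frame_coords e q (\<Sum>a\<in>UNIV. r a *\<^sub>R e a q) $ a = r a"
proof -
  let ?u = "\<Sum>a\<in>UNIV. r a *\<^sub>R e a q"
  have "(\<Sum>a\<in>UNIV. (frame_coords e q ?u $ a - r a) *\<^sub>R e a q) = 0"
    using frame_expansion[OF assms frame_combination_in_fibre[OF assms, of r]]
    by (simp add: scaleR_left_diff_distrib sum_subtractf)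
  from frame_combination_zero[OF assms this] show ?thesis by simp
qed

text \<open>\<open>representation\<close> takes a default value off the span, so linearity of the
  coordinates is a statement about elements of the fibre.\<close>

lemma frame_coords_add:
  fixes e :: "('m, 'v::real_vector, 'k::finite) frame"
  assumes "frame_basis_at D e q" "u \<in> fibre D q" "w \<in> fibre D q"
  shows "frame_coords e q (u + w) = frame_coords e q u + frame_coords e q w"
proof -
  have "u + w = (\<Sum>a\<in>UNIV. (frame_coords e q u $ a + frame_coords e q w $ a) *\<^sub>R e a q)"
    by (simp add: scaleR_left_distrib sum.distrib frame_expansion[OF assms(1)] assms(2,3))
  then show ?thesis
    using frame_coords_combination[OF assms(1), of "\<lambda>a. frame_coords e q u $ a + frame_coords e q w $ a"]
    by (simp add: vec_eq_iff)
qed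

lemma frame_coords_scaleR:
  fixes e :: "('m, 'v::real_vector, 'k::finite) frame"
  assumes "frame_basis_at D e q" "u \<in> fibre D q"
  shows "frame_coords e q (r *\<^sub>R u) = r *\<^sub>R frame_coords e q u"
proof -
  have "r *\<^sub>R u = (\<Sum>a\<in>UNIV. (r * frame_coords e q u $ a) *\<^sub>R e a q)"
    unfolding scaleR_scaleR[symmetric] scaleR_sum_right[symmetric] by (simp add: frame_expansion[OF assms(1,2)])
  then show ?thesis
    using frame_coords_combination[OF assms(1), of "\<lambda>a. r * frame_coords e q u $ a"] by (simp add: vec_eq_iff)
qed

lemma frame_coords_sum:
  fixes e :: "('m, 'v::real_vector, 'k::finite) frame"
  assumes e: "frame_basis_at D e q" and u: "\<And>i. i \<in> I \<Longrightarrow> u i \<in> fibre D q"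
  shows "frame_coords e q (\<Sum>i\<in>I. r i *\<^sub>R u i) = (\<Sum>i\<in>I. r i *\<^sub>R frame_coords e q (u i))"
proof -
  have zero: "frame_coords e q 0 = 0"
    using frame_coords_scaleR[OF e subspace_0[OF subspace_fibre[OF e]], of 0] by simp
  show ?thesis using u
  proof (induction I rule: infinite_finite_induct)
    case (insert i I)
    have "(\<Sum>i\<in>I. r i *\<^sub>R u i) \<in> fibre D q" "r i *\<^sub>R u i \<in> fibre D q"
      using insert.prems subspace_fibre[OF e] by (auto intro!: subspace_sum subspace_scale)
    then show ?case using insert by (simp add: frame_coords_add[OF e] frame_coords_scaleR[OF e])
  qed (simp_all add: zero)
qed

lemma sum_fun_apply: "(\<Sum>i\<in>I. f i) x = (\<Sum>i\<in>I. f i x)"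
  by (induction I rule: infinite_finite_induct) simp_all

section \<open>Smooth local sections of the algebroid\<close>

locale algebroid =
  fixes D :: "('m, 'e::real_inner, 'v::real_vector, 'k::finite) algebroid"
  assumes lie: "lie_algebroid D"
begin

lemma onb_base: "orthonormal_basis (model_basis D)"
  and manifold: "smooth_manifold (atlas D)"
  and vector_bundle: "smooth_vector_bundle D"
  using lie by (auto simp: lie_algebroid_def)

sublocale base: coherent_atlas "atlas D" "model_basis D"
  by (rule coherent_atlas_manifold[OF manifold onb_base])

lemma base_carrier [simp]: "atlas_carrier (atlas D) = UNIV"
  using manifold by (simp add: smooth_manifold_def)

lemma base_open_UNIV: "base_open D UNIV"
  using base.openin_carrier by (simp add: base_open_def)

lemma base_open_Int: "base_open D U \<Longrightarrow> base_open D V \<Longrightarrow> base_open D (U \<inter> V)"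
  unfolding base_open_def by (rule openin_Int)

abbreviation "adapted c \<equiv> c \<in> adapted_coords D"

text \<open>Common form of two kinds of frames: those in \<open>frames D\<close>, by which
  smoothness of sections is defined, and those of adapted coordinates. \<open>section_near\<close>
  below plays for sections the role that \<open>smooth_near\<close> plays for functions.\<close>

definition local_frame :: "'m set \<Rightarrow> ('m, 'v, 'k) frame \<Rightarrow> bool" where
  "local_frame U e \<longleftrightarrow> base_open D U \<and> (\<forall>a. smooth_section D U (e a)) \<and> (\<forall>q\<in>U. frame_basis_at D e q)"

definition section_near :: "'m \<Rightarrow> ('m \<Rightarrow> 'v) \<Rightarrow> bool" where
  "section_near q s \<longleftrightarrow> (\<exists>U. base_open D U \<and> q \<in> U \<and> smooth_section D U s)"

lemma frame_cover: obtains V e where "(V, e) \<in> frames D" "q \<in> V"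
proof -
  have "(\<Union>(V, e)\<in>frames D. V) = UNIV" using vector_bundle by (simp add: smooth_vector_bundle_def)
  then have "q \<in> (\<Union>(V, e)\<in>frames D. V)" by simp
  then show thesis using that by auto
qed

lemma frame_open: "(V, e) \<in> frames D \<Longrightarrow> base_open D V"
  and frame_basis: "(V, e) \<in> frames D \<Longrightarrow> q \<in> V \<Longrightarrow> frame_basis_at D e q"
  using vector_bundle by (auto simp: smooth_vector_bundle_def)

lemma local_frame_bundle:
  assumes V: "(V, e) \<in> frames D"
  shows "local_frame V e"
  unfolding local_frame_def smooth_section_def
proof (intro conjI allI ballI, goal_cases)
  case (2 a q)
  then show ?case using frame_in_fibre[OF frame_basis[OF V]] by blast
next
  case (3 a Ve)
  have "\<forall>(V, e)\<in>frames D. \<forall>(V', e')\<in>frames D. \<forall>a b.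
      smooth_fun (atlas D) (V \<inter> V') (\<lambda>q. frame_coords e' q (e a q) $ b)"
    using vector_bundle by (simp add: smooth_vector_bundle_def)
  then show ?case using V 3 by blast
qed (use V frame_open frame_basis in auto)

lemma local_frame_section_near: "local_frame U e \<Longrightarrow> q \<in> U \<Longrightarrow> section_near q (e a)"
  by (auto simp: local_frame_def section_near_def)

lemma subspace_fibre': "subspace (fibre D q)"
proof -
  obtain V e where "(V, e) \<in> frames D" "q \<in> V" using frame_cover .
  then show ?thesis using subspace_fibre frame_basis by metis
qed

lemma section_near_bundle_coords:
  assumes "section_near q s" "(V, e) \<in> frames D" "q \<in> V"
  shows "smooth_near (atlas D) q (\<lambda>x. frame_coords e x (s x) $ a)"
proof -
  obtain U where U: "base_open D U" "q \<in> U" "smooth_section D U s" using assms(1) by (auto simp: section_near_def)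
  show ?thesis
  proof (rule base.smooth_nearI[of "U \<inter> V"])
    show "openin (atlas_topology (atlas D)) (U \<inter> V)"
      using base_open_Int[OF U(1) frame_open[OF assms(2)]] by (simp add: base_open_def)
    show "smooth_fun (atlas D) (U \<inter> V) (\<lambda>x. frame_coords e x (s x) $ a)"
      using U(3) assms(2) by (fastforce simp: smooth_section_def)
  qed (use U assms in auto)
qed

text \<open>Smoothness of a section is defined by its coordinates in the frames of the bundle.
  Coordinates in another frame solve a linear system whose matrix and right side are such bundle
  coordinates, and Cramer's rule preserves smoothness.\<close>

lemma section_near_coords:
  assumes "section_near q s" "local_frame U e" "q \<in> U"
  shows "smooth_near (atlas D) q (\<lambda>x. frame_coords e x (s x) $ a)"
proof -
  obtain V e0 where V: "(V, e0) \<in> frames D" "q \<in> V" using frame_cover .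
  obtain T where T: "base_open D T" "q \<in> T" "smooth_section D T s" using assms(1) by (auto simp: section_near_def)
  define W where "W = U \<inter> V \<inter> T"
  have W: "openin (atlas_topology (atlas D)) W" "q \<in> W"
    using base_open_Int[OF base_open_Int[OF _ frame_open[OF V(1)]] T(1)] assms(2,3) V(2) T(2)
    by (auto simp: W_def base_open_def local_frame_def)
  define M where "M x = (\<chi> i a. frame_coords e0 x (e a x) $ i)" for x
  have e: "frame_basis_at D e x" and e0: "frame_basis_at D e0 x" and s: "s x \<in> fibre D x" if "x \<in> W" for x
    using that assms(2) frame_basis[OF V(1)] T(3) by (auto simp: W_def local_frame_def smooth_section_def)
  have Mv: "M x *v y = frame_coords e0 x (\<Sum>a\<in>UNIV. y $ a *\<^sub>R e a x)" if "x \<in> W" for x y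
    using frame_coords_sum[OF e0[OF that], of UNIV "\<lambda>a. e a x" "\<lambda>a. y $ a"] frame_in_fibre[OF e[OF that]]
    by (simp add: vec_eq_iff matrix_vector_mult_def M_def mult.commute)
  show ?thesis
  proof (rule base.smooth_near_linear_solution[OF W])
    show "smooth_near (atlas D) q (\<lambda>x. M x $ i $ j)" for i j
      using section_near_bundle_coords[OF local_frame_section_near[OF assms(2,3)] V] by (simp add: M_def)
    show "smooth_near (atlas D) q (\<lambda>x. frame_coords e0 x (s x) $ i)" for i
      by (rule section_near_bundle_coords[OF assms(1) V])
    show "M x *v frame_coords e x (s x) = frame_coords e0 x (s x)" if "x \<in> W" for x
      by (simp add: Mv[OF that] frame_expansion[OF e[OF that] s[OF that]])
    show "det (M x) \<noteq> 0" if x: "x \<in> W" for x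
    proof -
      \<comment> \<open>A kernel vector gives a vanishing combination of the basis
        \<open>e a x\<close>, so the matrix is injective and hence has nonzero determinant.\<close>
      have "y = 0" if "M x *v y = 0" for y
      proof -
        have "(\<Sum>a\<in>UNIV. y $ a *\<^sub>R e a x) = 0"
          using frame_expansion[OF e0[OF x] frame_combination_in_fibre[OF e[OF x]], of "\<lambda>a. y $ a"]
            Mv[OF x, of y] that by simp
        then show ?thesis using frame_combination_zero[OF e[OF x]] by (metis vec_eq_iff zero_index)
      qed
      then have "\<exists>B. B ** M x = mat 1" unfolding matrix_left_invertible_ker by blast
      then show ?thesis unfolding invertible_det_nz[symmetric] invertible_left_inverse .
    qed
  qed
qed

lemma section_nearD:
  assumes "section_near q s"
  obtains W where "base_open D W" "q \<in> W" "\<And>x. x \<in> W \<Longrightarrow> s x \<in> fibre D x" "\<And>x. x \<in> W \<Longrightarrow> section_near x s"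
  using assms unfolding section_near_def smooth_section_def by blast

lemma section_nearI:
  assumes e: "local_frame U e" "q \<in> U" and W: "base_open D W" "q \<in> W" "\<And>x. x \<in> W \<Longrightarrow> s x \<in> fibre D x"
    and s: "\<And>a. smooth_near (atlas D) q (\<lambda>x. frame_coords e x (s x) $ a)"
  shows "section_near q s"
proof -
  have "\<forall>a. \<exists>T. base_open D T \<and> q \<in> T \<and> (\<forall>x\<in>T. smooth_near (atlas D) x (\<lambda>x. frame_coords e x (s x) $ a))"
    using base.smooth_near_openD[OF s] unfolding base_open_def by metis
  then obtain T where T: "\<And>a. base_open D (T a)" "\<And>a. q \<in> T a"
    "\<And>a x. x \<in> T a \<Longrightarrow> smooth_near (atlas D) x (\<lambda>x. frame_coords e x (s x) $ a)" by metis
  \<comment> \<open>Each coefficient comes with its own neighbourhood; finiteness of the index type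
    keeps the intersection open.\<close>
  define Z where "Z = U \<inter> W \<inter> (\<Inter>a. T a)"
  have "openin (atlas_topology (atlas D)) (\<Inter>a\<in>UNIV. T a)"
    by (rule openin_INT2) (use T(1) in \<open>auto simp: base_open_def\<close>)
  then have Z: "base_open D Z" "q \<in> Z"
    using e W(1,2) T(2) by (auto simp: Z_def base_open_def local_frame_def intro!: openin_Int)
  have sm: "smooth_near (atlas D) x (\<lambda>x. frame_coords e0 x (s x) $ a)"
    if V: "(V, e0) \<in> frames D" "x \<in> V" and x: "x \<in> Z" for V e0 a x
  proof -
    have "smooth_near (atlas D) x (\<lambda>x. \<Sum>b\<in>UNIV. frame_coords e x (s x) $ b * frame_coords e0 x (e b x) $ a)"
      using x T(3) section_near_bundle_coords[OF local_frame_section_near[OF e(1)] V]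
      by (auto intro!: base.smooth_near_sum base.smooth_near_mult simp: Z_def)
    then show ?thesis
    proof (rule base.smooth_near_cong[rotated 2])
      show "openin (atlas_topology (atlas D)) (Z \<inter> V)" "x \<in> Z \<inter> V"
        using base_open_Int[OF Z(1) frame_open[OF V(1)]] V(2) x by (auto simp: base_open_def)
      fix y assume y: "y \<in> Z \<inter> V"
      have ey: "frame_basis_at D e y" and e0y: "frame_basis_at D e0 y" and sy: "s y \<in> fibre D y"
        using y e(1) W(3) frame_basis[OF V(1)] by (auto simp: local_frame_def Z_def)
      show "(\<Sum>b\<in>UNIV. frame_coords e y (s y) $ b * frame_coords e0 y (e b y) $ a) = frame_coords e0 y (s y) $ a"
        using frame_coords_sum[OF e0y, of UNIV "\<lambda>b. e b y" "\<lambda>b. frame_coords e y (s y) $ b"]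
          frame_in_fibre[OF ey] frame_expansion[OF ey sy] by simp
    qed
  qed
  have "smooth_section D Z s"
    unfolding smooth_section_def
    using W(3) by (auto simp: Z_def[symmetric] intro!: base.smooth_fun_local sm) (auto simp: Z_def)
  then show ?thesis using Z by (auto simp: section_near_def)
qed

lemma smooth_section_iff_near:
  assumes "base_open D U"
  shows "smooth_section D U s \<longleftrightarrow> (\<forall>q\<in>U. section_near q s)"
proof
  show "\<forall>q\<in>U. section_near q s" if "smooth_section D U s" using that assms by (auto simp: section_near_def)
next
  assume *: "\<forall>q\<in>U. section_near q s"
  show "smooth_section D U s" unfolding smooth_section_def
  proof (intro conjI ballI allI, goal_cases)
    case (1 q)
    then show ?case using * section_nearD by metis
  next
    case (2 Ve)
    then show ?case using * by (cases Ve) (auto intro!: base.smooth_fun_local section_near_bundle_coords)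
  qed
qed

lemma global_section_iff: "s \<in> global_sections D \<longleftrightarrow> (\<forall>q. section_near q s)"
  using smooth_section_iff_near[OF base_open_UNIV] by simp

lemma section_near_cong:
  assumes "base_open D W" "q \<in> W" "section_near q s" "\<And>x. x \<in> W \<Longrightarrow> s x = t x"
  shows "section_near q t"
proof -
  obtain V e where V: "(V, e) \<in> frames D" "q \<in> V" using frame_cover .
  obtain T where T: "base_open D T" "q \<in> T" "\<And>x. x \<in> T \<Longrightarrow> s x \<in> fibre D x" using section_nearD[OF assms(3)] by metis
  show ?thesis
  proof (rule section_nearI[OF local_frame_bundle[OF V(1)] V(2), of "W \<inter> T"])
    show "smooth_near (atlas D) q (\<lambda>x. frame_coords e x (t x) $ a)" for a
      by (rule base.smooth_near_cong[OF _ assms(2) section_near_bundle_coords[OF assms(3) V]])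
        (use assms in \<open>auto simp: base_open_def\<close>)
  qed (use assms T base_open_Int in \<open>auto dest: assms(4)\<close>, metis assms(4))
qed

lemma section_near_add:
  assumes "section_near q s" "section_near q t"
  shows "section_near q (\<lambda>x. s x + t x)"
proof -
  obtain V e where V: "(V, e) \<in> frames D" "q \<in> V" using frame_cover .
  obtain S where S: "base_open D S" "q \<in> S" "\<And>x. x \<in> S \<Longrightarrow> s x \<in> fibre D x" using section_nearD[OF assms(1)] by metis
  obtain T where T: "base_open D T" "q \<in> T" "\<And>x. x \<in> T \<Longrightarrow> t x \<in> fibre D x" using section_nearD[OF assms(2)] by metis
  have W: "base_open D (S \<inter> T \<inter> V)" by (intro base_open_Int S T frame_open[OF V(1)])
  show ?thesis
  proof (rule section_nearI[OF local_frame_bundle[OF V(1)] V(2) W])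
    show "smooth_near (atlas D) q (\<lambda>x. frame_coords e x (s x + t x) $ a)" for a
    proof (rule base.smooth_near_cong[OF W[unfolded base_open_def]])
      show "smooth_near (atlas D) q (\<lambda>x. frame_coords e x (s x) $ a + frame_coords e x (t x) $ a)"
        by (intro base.smooth_near_add section_near_bundle_coords[OF _ V] assms)
    qed (use S T V frame_basis[OF V(1)] in \<open>auto simp: frame_coords_add[where D = D]\<close>)
  qed (use S T V subspace_fibre' in \<open>auto intro!: subspace_add\<close>)
qed

lemma section_near_scale:
  assumes "smooth_near (atlas D) q f" "section_near q s"
  shows "section_near q (\<lambda>x. f x *\<^sub>R s x)"
proof -
  obtain V e where V: "(V, e) \<in> frames D" "q \<in> V" using frame_cover .
  obtain S where S: "base_open D S" "q \<in> S" "\<And>x. x \<in> S \<Longrightarrow> s x \<in> fibre D x" using section_nearD[OF assms(2)] by metis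
  have W: "base_open D (S \<inter> V)" by (intro base_open_Int S frame_open[OF V(1)])
  show ?thesis
  proof (rule section_nearI[OF local_frame_bundle[OF V(1)] V(2) W])
    show "smooth_near (atlas D) q (\<lambda>x. frame_coords e x (f x *\<^sub>R s x) $ a)" for a
    proof (rule base.smooth_near_cong[OF W[unfolded base_open_def]])
      show "smooth_near (atlas D) q (\<lambda>x. f x * frame_coords e x (s x) $ a)"
        by (intro base.smooth_near_mult section_near_bundle_coords[OF _ V] assms)
    qed (use S V frame_basis[OF V(1)] in \<open>auto simp: frame_coords_scaleR[where D = D]\<close>)
  qed (use S V subspace_fibre' in \<open>auto intro!: subspace_scale\<close>)
qed

lemma section_near_cscale: "section_near q s \<Longrightarrow> section_near q (\<lambda>x. r *\<^sub>R s x)"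
  by (rule section_near_scale[OF base.smooth_near_const]) simp_all

lemma section_near_zero: "section_near q (\<lambda>x. 0)"
proof -
  obtain V e where V: "(V, e) \<in> frames D" "q \<in> V" using frame_cover .
  show ?thesis
    using section_near_cscale[OF local_frame_section_near[OF local_frame_bundle[OF V(1)] V(2)], of 0] by simp
qed

lemma section_near_sum:
  "(\<And>i. i \<in> I \<Longrightarrow> section_near q (s i)) \<Longrightarrow> section_near q (\<lambda>x. \<Sum>i\<in>I. s i x)"
  by (induction I rule: infinite_finite_induct) (simp_all add: section_near_zero section_near_add)

section \<open>Extension of germs to global sections and functions\<close>

lemma base_bump:
  assumes "base_open D W" "q \<in> W"
  obtains f V N where "smooth_fun (atlas D) UNIV f" "base_open D V" "q \<in> V" "V \<subseteq> W"
    "\<And>x. x \<in> V \<Longrightarrow> f x = 1" "base_open D N" "N \<union> W = UNIV" "\<And>x. x \<in> N \<Longrightarrow> f x = 0"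
  using manifold_bump[OF manifold onb_base assms(1)[unfolded base_open_def] assms(2)]
  unfolding base_open_def by metis

lemma smooth_near_of_fun: "smooth_fun (atlas D) UNIV f \<Longrightarrow> smooth_near (atlas D) q f"
  using base.smooth_nearI[of UNIV] base_open_UNIV by (simp add: base_open_def)

text \<open>Multiply by a bump function: off \<open>N\<close> a point lies in \<open>W\<close>,
  where \<open>s\<close> is smooth, and on the open set \<open>N\<close> the product is zero
  whatever values \<open>s\<close> takes there.\<close>

lemma section_extension:
  assumes "section_near q s"
  obtains s' where "s' \<in> global_sections D" "germ_eq D q s s'"
proof -
  obtain W where W: "base_open D W" "q \<in> W" "\<And>x. x \<in> W \<Longrightarrow> section_near x s" using section_nearD[OF assms] by metis
  obtain f V N where f: "smooth_fun (atlas D) UNIV f" "base_open D V" "q \<in> V" "V \<subseteq> W"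
    "\<And>x. x \<in> V \<Longrightarrow> f x = 1" "base_open D N" "N \<union> W = UNIV" "\<And>x. x \<in> N \<Longrightarrow> f x = 0"
    using base_bump[OF W(1,2)] by metis
  have "section_near x (\<lambda>x. f x *\<^sub>R s x)" for x
  proof (cases "x \<in> N")
    case True
    show ?thesis by (rule section_near_cong[OF f(6) True section_near_zero]) (simp add: f(8))
  next
    case False
    then show ?thesis using f(7) W(3) section_near_scale[OF smooth_near_of_fun[OF f(1)]] by blast
  qed
  then have "(\<lambda>x. f x *\<^sub>R s x) \<in> global_sections D" unfolding global_section_iff by blast
  moreover have "germ_eq D q s (\<lambda>x. f x *\<^sub>R s x)" using f(2,3,5) by (auto simp: germ_eq_def)
  ultimately show thesis by (rule that)
qed

lemma function_extension:
  assumes "smooth_near (atlas D) q g"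
  obtains g' V where "smooth_fun (atlas D) UNIV g'" "base_open D V" "q \<in> V" "\<And>x. x \<in> V \<Longrightarrow> g x = g' x"
proof -
  obtain W where W: "base_open D W" "q \<in> W" "\<And>x. x \<in> W \<Longrightarrow> smooth_near (atlas D) x g"
    using base.smooth_near_openD[OF assms] unfolding base_open_def by metis
  obtain f V N where f: "smooth_fun (atlas D) UNIV f" "base_open D V" "q \<in> V" "V \<subseteq> W"
    "\<And>x. x \<in> V \<Longrightarrow> f x = 1" "base_open D N" "N \<union> W = UNIV" "\<And>x. x \<in> N \<Longrightarrow> f x = 0"
    using base_bump[OF W(1,2)] by metis
  have "smooth_near (atlas D) x (\<lambda>x. f x * g x)" for x
  proof (cases "x \<in> N")
    case True
    show ?thesis
      by (rule base.smooth_near_cong[OF f(6)[unfolded base_open_def] True base.smooth_near_const[of x 0]])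
        (simp_all add: f(8))
  next
    case False
    then show ?thesis using f(7) W(3) base.smooth_near_mult[OF smooth_near_of_fun[OF f(1)]] by blast
  qed
  then have "smooth_fun (atlas D) UNIV (\<lambda>x. f x * g x)" by (rule base.smooth_fun_local)
  then show thesis by (rule that[OF _ f(2,3)]) (simp add: f(5))
qed

section \<open>The bracket of local sections\<close>

lemmas lie_axioms = lie[unfolded lie_algebroid_def, THEN conjunct2, THEN conjunct2, THEN conjunct2]

lemmas anchor_tangent = lie_axioms[THEN conjunct1, rule_format]
lemmas anchor_add = lie_axioms[THEN conjunct2, THEN conjunct1, rule_format]
lemmas anchor_scale = lie_axioms[THEN conjunct2, THEN conjunct2, THEN conjunct1, rule_format]
lemmas anchor_smooth =
  lie_axioms[THEN conjunct2, THEN conjunct2, THEN conjunct2, THEN conjunct1, rule_format, OF conjI, OF _ conjI]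
lemmas bracket_axioms = lie_axioms[THEN conjunct2, THEN conjunct2, THEN conjunct2, THEN conjunct2]
lemmas bracket_global = bracket_axioms[THEN conjunct1, rule_format]
lemmas bracket_add_left = bracket_axioms[THEN conjunct2, THEN conjunct1, rule_format]
lemmas bracket_antisym = bracket_axioms[THEN conjunct2, THEN conjunct2, THEN conjunct2, THEN conjunct1, rule_format]
lemmas bracket_leibniz =
  bracket_axioms[THEN conjunct2, THEN conjunct2, THEN conjunct2, THEN conjunct2, THEN conjunct2, rule_format]

lemma anchor_sum:
  assumes "\<And>i. i \<in> I \<Longrightarrow> u i \<in> fibre D q"
  shows "anchor D q (\<Sum>i\<in>I. r i *\<^sub>R u i) f = (\<Sum>i\<in>I. r i * anchor D q (u i) f)"
  using assms
proof (induction I rule: infinite_finite_induct)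
  case (insert i I)
  have "(\<Sum>i\<in>I. r i *\<^sub>R u i) \<in> fibre D q" "r i *\<^sub>R u i \<in> fibre D q"
    using insert.prems subspace_fibre' by (auto intro!: subspace_sum subspace_scale)
  then show ?case using insert by (simp add: anchor_add anchor_scale scaleR_fun_def)
qed (use anchor_scale[OF subspace_0[OF subspace_fibre'], where r = 0] in \<open>simp_all add: scaleR_fun_def\<close>)

lemma global_add: "s \<in> global_sections D \<Longrightarrow> t \<in> global_sections D \<Longrightarrow> s + t \<in> global_sections D"
  unfolding global_section_iff plus_fun_def by (blast intro: section_near_add)

lemma global_minus: "s \<in> global_sections D \<Longrightarrow> - s \<in> global_sections D"
  unfolding global_section_iff using section_near_cscale[of _ s "-1"] by (simp add: fun_Compl_def)

lemma global_scale:
  "smooth_fun (atlas D) UNIV f \<Longrightarrow> s \<in> global_sections D \<Longrightarrow> (\<lambda>x. f x *\<^sub>R s x) \<in> global_sections D"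
  unfolding global_section_iff by (blast intro: section_near_scale smooth_near_of_fun)

lemma bracket_add_right:
  assumes "s \<in> global_sections D" "t \<in> global_sections D" "t' \<in> global_sections D"
  shows "bracket D s (t + t') = bracket D s t + bracket D s t'"
proof -
  have "bracket D s (t + t') = - bracket D (t + t') s"
    by (rule bracket_antisym[OF assms(1) global_add[OF assms(2,3)]])
  also have "\<dots> = - bracket D t s + - bracket D t' s" by (simp add: bracket_add_left[OF assms(2,3,1)])
  also have "\<dots> = bracket D s t + bracket D s t'"
    using bracket_antisym[OF assms(1,2)] bracket_antisym[OF assms(1,3)] by simp
  finally show ?thesis .
qed

text \<open>A section vanishing near \<open>q\<close> equals \<open>f\<close> times itself for some \<open>f\<close> that vanishes near \<open>q\<close>, so
  the Leibniz rule makes its brackets vanish at \<open>q\<close>.\<close>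

lemma bracket_local_right:
  assumes s: "s \<in> global_sections D" and t: "t \<in> global_sections D" "t' \<in> global_sections D"
    and "germ_eq D q t t'"
  shows "bracket D s t q = bracket D s t' q"
proof -
  obtain W where W: "base_open D W" "q \<in> W" "\<And>x. x \<in> W \<Longrightarrow> t x = t' x" using assms(4) by (auto simp: germ_eq_def)
  obtain f V N where f: "smooth_fun (atlas D) UNIV f" "base_open D V" "q \<in> V" "V \<subseteq> W"
    "\<And>x. x \<in> V \<Longrightarrow> f x = 1" "base_open D N" "N \<union> W = UNIV" "\<And>x. x \<in> N \<Longrightarrow> f x = 0"
    using base_bump[OF W(1,2)] by metis
  define u where "u = t + - t'"
  have u: "u \<in> global_sections D" unfolding u_def by (intro global_add global_minus t)
  have uW: "u x = 0" if "x \<in> W" for x using W(3)[OF that] by (simp add: u_def)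
  have g: "smooth_fun (atlas D) UNIV (\<lambda>x. 1 - f x)"
    by (rule base.smooth_fun_local[OF base.smooth_near_diff[OF base.smooth_near_const smooth_near_of_fun[OF f(1)]]])
      simp
  have "(\<lambda>x. (1 - f x) *\<^sub>R u x) = u"
  proof
    show "(1 - f x) *\<^sub>R u x = u x" for x
    proof (cases "x \<in> N")
      case False
      then have "x \<in> W" using f(7) by blast
      then show ?thesis by (simp add: uW)
    qed (simp add: f(8))
  qed
  then have "bracket D s u q = (1 - f q) *\<^sub>R bracket D s u q + anchor D q (s q) (\<lambda>x. 1 - f x) *\<^sub>R u q"
    using bracket_leibniz[OF s u g] by metis
  then have "bracket D s u q = 0" using f(5)[OF f(3)] uW[OF W(2)] by simp
  moreover have "t = t' + u" by (simp add: u_def)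
  ultimately show ?thesis using bracket_add_right[OF s t(2) u] by (simp add: plus_fun_def)
qed

lemma germ_eq_sym: "germ_eq D q s t \<Longrightarrow> germ_eq D q t s"
  by (auto simp: germ_eq_def)

lemma germ_eq_combine:
  assumes "germ_eq D q s s'" "germ_eq D q t t'"
  shows "germ_eq D q (\<lambda>x. h x (s x) (t x)) (\<lambda>x. h x (s' x) (t' x))"
proof -
  obtain W W' where "base_open D W" "q \<in> W" "\<forall>x\<in>W. s x = s' x" "base_open D W'" "q \<in> W'" "\<forall>x\<in>W'. t x = t' x"
    using assms by (auto simp: germ_eq_def)
  then show ?thesis unfolding germ_eq_def using base_open_Int by (intro exI[of _ "W \<inter> W'"]) auto
qed

lemma germ_eq_trans: "germ_eq D q s t \<Longrightarrow> germ_eq D q t u \<Longrightarrow> germ_eq D q s u"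
proof -
  assume "germ_eq D q s t" "germ_eq D q t u"
  then obtain W W' where "base_open D W" "q \<in> W" "\<forall>x\<in>W. s x = t x" "base_open D W'" "q \<in> W'" "\<forall>x\<in>W'. t x = u x"
    by (auto simp: germ_eq_def)
  then show ?thesis unfolding germ_eq_def using base_open_Int by (intro exI[of _ "W \<inter> W'"]) auto
qed

lemma bracket_local:
  assumes "s \<in> global_sections D" "s' \<in> global_sections D" "t \<in> global_sections D" "t' \<in> global_sections D"
    and "germ_eq D q s s'" "germ_eq D q t t'"
  shows "bracket D s t q = bracket D s' t' q"
proof -
  have "bracket D s t q = bracket D s t' q" by (rule bracket_local_right) fact+
  also have "\<dots> = - bracket D t' s q" using bracket_antisym[OF assms(1,4)] by simp
  also have "\<dots> = - bracket D t' s' q" using bracket_local_right[OF assms(4,1,2,5)] by simp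
  also have "\<dots> = bracket D s' t' q" using bracket_antisym[OF assms(2,4)] by simp
  finally show ?thesis .
qed

text \<open>\<open>local_bracket\<close> is a definite description; locality of
  \<open>bracket\<close> in both arguments provides the uniqueness behind it.\<close>

lemma local_bracket_eq:
  assumes "s' \<in> global_sections D" "t' \<in> global_sections D" "germ_eq D q s s'" "germ_eq D q t t'"
  shows "local_bracket D s t q = bracket D s' t' q"
  unfolding local_bracket_def
proof (rule the_equality)
  show "w = bracket D s' t' q" if w: "\<exists>s'\<in>global_sections D. \<exists>t'\<in>global_sections D.
      germ_eq D q s s' \<and> germ_eq D q t t' \<and> w = bracket D s' t' q" for w
  proof -
    obtain s2 t2 where 2: "s2 \<in> global_sections D" "t2 \<in> global_sections D" "germ_eq D q s s2" "germ_eq D q t t2"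
      and w: "w = bracket D s2 t2 q"
      using w by blast
    show ?thesis unfolding w
      by (rule bracket_local[OF 2(1) assms(1) 2(2) assms(2)])
        (use 2 assms germ_eq_sym germ_eq_trans in blast)+
  qed
qed (use assms in blast)

text \<open>The same global representatives compute the local bracket on a whole neighbourhood and
  not just at \<open>q\<close>; this is what makes the local bracket a smooth section near
  \<open>q\<close>.\<close>

lemma local_bracket_obtain:
  assumes "section_near q s" "section_near q t"
  obtains s' t' W where "s' \<in> global_sections D" "t' \<in> global_sections D"
    "germ_eq D q s s'" "germ_eq D q t t'" "base_open D W" "q \<in> W"
    "\<And>x. x \<in> W \<Longrightarrow> s x = s' x" "\<And>x. x \<in> W \<Longrightarrow> t x = t' x"
    "\<And>x. x \<in> W \<Longrightarrow> local_bracket D s t x = bracket D s' t' x"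
proof -
  obtain s' where s': "s' \<in> global_sections D" "germ_eq D q s s'" using section_extension[OF assms(1)] .
  obtain t' where t': "t' \<in> global_sections D" "germ_eq D q t t'" using section_extension[OF assms(2)] .
  obtain S where S: "base_open D S" "q \<in> S" "\<And>x. x \<in> S \<Longrightarrow> s x = s' x" using s'(2) by (auto simp: germ_eq_def)
  obtain T where T: "base_open D T" "q \<in> T" "\<And>x. x \<in> T \<Longrightarrow> t x = t' x" using t'(2) by (auto simp: germ_eq_def)
  have "local_bracket D s t x = bracket D s' t' x" if "x \<in> S \<inter> T" for x
    by (rule local_bracket_eq[OF s'(1) t'(1)]) (use S T that in \<open>auto simp: germ_eq_def\<close>)
  then show thesis using that[OF s'(1) t'(1) s'(2) t'(2) base_open_Int[OF S(1) T(1)]] S T by blast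
qed

lemma local_bracket_section:
  assumes "section_near q s" "section_near q t"
  shows "section_near q (local_bracket D s t)"
proof -
  obtain s' t' W where *: "s' \<in> global_sections D" "t' \<in> global_sections D" "base_open D W" "q \<in> W"
    "\<And>x. x \<in> W \<Longrightarrow> local_bracket D s t x = bracket D s' t' x"
    using local_bracket_obtain[OF assms] by metis
  have "section_near q (bracket D s' t')" using bracket_global[OF *(1,2)] global_section_iff by blast
  then show ?thesis by (rule section_near_cong[OF *(3,4)]) (simp add: *(5))
qed

lemma section_near_fibre: "section_near q s \<Longrightarrow> s q \<in> fibre D q"
  using section_nearD by metis

lemma local_bracket_cong:
  assumes "section_near q s" "section_near q t" "germ_eq D q s s'" "germ_eq D q t t'"
  shows "local_bracket D s t q = local_bracket D s' t' q"
proof -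
  obtain u where u: "u \<in> global_sections D" "germ_eq D q s u" using section_extension[OF assms(1)] .
  obtain w where w: "w \<in> global_sections D" "germ_eq D q t w" using section_extension[OF assms(2)] .
  have "germ_eq D q s' u" "germ_eq D q t' w"
    by (rule germ_eq_trans[OF germ_eq_sym[OF assms(3)] u(2)], rule germ_eq_trans[OF germ_eq_sym[OF assms(4)] w(2)])
  then show ?thesis using local_bracket_eq[OF u(1) w(1)] u(2) w(2) by simp
qed

lemma local_bracket_antisym:
  assumes "section_near q s" "section_near q t"
  shows "local_bracket D s t q = - local_bracket D t s q"
proof -
  obtain u where u: "u \<in> global_sections D" "germ_eq D q s u" using section_extension[OF assms(1)] .
  obtain w where w: "w \<in> global_sections D" "germ_eq D q t w" using section_extension[OF assms(2)] .
  show ?thesis using local_bracket_eq[OF u(1) w(1) u(2) w(2)] local_bracket_eq[OF w(1) u(1) w(2) u(2)]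
      bracket_antisym[OF u(1) w(1)] by simp
qed

lemma local_bracket_add_right:
  assumes "section_near q s" "section_near q t" "section_near q t'"
  shows "local_bracket D s (\<lambda>x. t x + t' x) q = local_bracket D s t q + local_bracket D s t' q"
proof -
  obtain u where u: "u \<in> global_sections D" "germ_eq D q s u" using section_extension[OF assms(1)] .
  obtain w where w: "w \<in> global_sections D" "germ_eq D q t w" using section_extension[OF assms(2)] .
  obtain w' where w': "w' \<in> global_sections D" "germ_eq D q t' w'" using section_extension[OF assms(3)] .
  have "germ_eq D q (\<lambda>x. t x + t' x) (w + w')"
    unfolding plus_fun_def by (rule germ_eq_combine[OF w(2) w'(2), of "\<lambda>_. (+)"])
  then show ?thesis
    using local_bracket_eq[OF u(1) global_add[OF w(1) w'(1)] u(2)] local_bracket_eq[OF u(1) w(1) u(2) w(2)]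
      local_bracket_eq[OF u(1) w'(1) u(2) w'(2)] bracket_add_right[OF u(1) w(1) w'(1)] by simp
qed

lemma local_bracket_leibniz_right:
  assumes "section_near q s" "section_near q t" "smooth_near (atlas D) q f"
  shows "local_bracket D s (\<lambda>x. f x *\<^sub>R t x) q = f q *\<^sub>R local_bracket D s t q + anchor D q (s q) f *\<^sub>R t q"
proof -
  obtain u where u: "u \<in> global_sections D" "germ_eq D q s u" using section_extension[OF assms(1)] .
  obtain w where w: "w \<in> global_sections D" "germ_eq D q t w" using section_extension[OF assms(2)] .
  obtain g V where g: "smooth_fun (atlas D) UNIV g" "base_open D V" "q \<in> V" "\<And>x. x \<in> V \<Longrightarrow> f x = g x"
    using function_extension[OF assms(3)] by metis
  obtain T where T: "base_open D T" "q \<in> T" "\<And>x. x \<in> T \<Longrightarrow> t x = w x" using w(2) by (auto simp: germ_eq_def)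
  have "germ_eq D q (\<lambda>x. f x *\<^sub>R t x) (\<lambda>x. g x *\<^sub>R w x)"
    unfolding germ_eq_def using base_open_Int[OF g(2) T(1)] g T by (intro exI[of _ "V \<inter> T"]) auto
  then have 1: "local_bracket D s (\<lambda>x. f x *\<^sub>R t x) q = g q *\<^sub>R bracket D u w q + anchor D q (u q) g *\<^sub>R w q"
    using local_bracket_eq[OF u(1) global_scale[OF g(1) w(1)] u(2)] bracket_leibniz[OF u(1) w(1) g(1)] by simp
  have "s q = u q" using u(2) by (auto simp: germ_eq_def)
  moreover have "anchor D q (s q) f = anchor D q (s q) g"
    by (rule base.tangent_cong[OF anchor_tangent[OF section_near_fibre[OF assms(1)]], of V])
      (use g in \<open>auto simp: base_open_def\<close>)
  ultimately show ?thesis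
    using 1 local_bracket_eq[OF u(1) w(1) u(2) w(2)] g(3,4) T(2,3) by simp
qed

lemma local_bracket_zero_right:
  assumes "section_near q s"
  shows "local_bracket D s (\<lambda>x. 0) q = 0"
  using local_bracket_add_right[OF assms section_near_zero section_near_zero] by simp

lemma local_bracket_sum_right:
  assumes "section_near q s" "\<And>i. i \<in> I \<Longrightarrow> section_near q (t i)" "\<And>i. i \<in> I \<Longrightarrow> smooth_near (atlas D) q (f i)"
  shows "local_bracket D s (\<lambda>x. \<Sum>i\<in>I. f i x *\<^sub>R t i x) q =
    (\<Sum>i\<in>I. f i q *\<^sub>R local_bracket D s (t i) q + anchor D q (s q) (f i) *\<^sub>R t i q)"
  using assms(2,3)
proof (induction I rule: infinite_finite_induct)
  case (insert i I)
  have "section_near q (\<lambda>x. \<Sum>i\<in>I. f i x *\<^sub>R t i x)" "section_near q (\<lambda>x. f i x *\<^sub>R t i x)"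
    using insert.prems by (auto intro!: section_near_sum section_near_scale)
  from local_bracket_add_right[OF assms(1) this(2,1)]
  show ?case using insert local_bracket_leibniz_right[OF assms(1)] by simp
qed (simp_all add: local_bracket_zero_right[OF assms(1)])

text \<open>Antisymmetry turns the derivative term of the Leibniz rule in the second slot into a
  negative one in the first.\<close>

lemma local_bracket_sum_left:
  assumes "section_near q t" "\<And>i. i \<in> I \<Longrightarrow> section_near q (s i)" "\<And>i. i \<in> I \<Longrightarrow> smooth_near (atlas D) q (f i)"
  shows "local_bracket D (\<lambda>x. \<Sum>i\<in>I. f i x *\<^sub>R s i x) t q =
    (\<Sum>i\<in>I. f i q *\<^sub>R local_bracket D (s i) t q - anchor D q (t q) (f i) *\<^sub>R s i q)"
proof -
  have sec: "section_near q (\<lambda>x. \<Sum>i\<in>I. f i x *\<^sub>R s i x)"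
    using assms by (auto intro!: section_near_sum section_near_scale)
  have "local_bracket D (\<lambda>x. \<Sum>i\<in>I. f i x *\<^sub>R s i x) t q =
    - (\<Sum>i\<in>I. f i q *\<^sub>R local_bracket D t (s i) q + anchor D q (t q) (f i) *\<^sub>R s i q)"
    using local_bracket_antisym[OF sec assms(1)] local_bracket_sum_right[OF assms] by simp
  also have "\<dots> = (\<Sum>i\<in>I. f i q *\<^sub>R local_bracket D (s i) t q - anchor D q (t q) (f i) *\<^sub>R s i q)"
    unfolding sum_negf[symmetric]
    by (rule sum.cong) (simp_all add: local_bracket_antisym[OF assms(1) assms(2)])
  finally show ?thesis .
qed

section \<open>Change of adapted coordinates\<close>

text \<open>The atlas of the base is maximal and a restriction is compatible with all its charts.
  This allows a chart and a bundle frame to be cut down to a common domain.\<close>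

lemma restricted_chart:
  assumes "c \<in> atlas D" "base_open D V"
  shows "(fst c \<inter> V, snd c) \<in> atlas D"
proof -
  let ?c = "(fst c \<inter> V, snd c)"
  have ch: "is_chart c" by (rule base.chart[OF assms(1)])
  have op: "openin (atlas_topology (atlas D)) (fst c \<inter> V)"
    using openin_Int[OF base.openin_chart_domain[OF assms(1)]] assms(2) by (simp add: base_open_def)
  have "open (snd c ` (fst c \<inter> V))"
    using base.openin_chart_iff[OF assms(1), of "fst c \<inter> V"] op by simp
  then have ch': "is_chart ?c" using ch by (auto simp: is_chart_def intro: inj_on_subset)
  have inv: "chart_inv ?c (snd c q) = q" if "q \<in> fst c \<inter> V" for q
    using chart_inv_image[OF ch', of q] that by simp
  have "charts_compatible ?c d" if d: "d \<in> atlas D" for d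
  proof -
    have cd: "charts_compatible c d" by (rule base.compatible[OF assms(1) d])
    have S: "open (snd c ` (fst c \<inter> V \<inter> fst d))"
      using base.open_chart_image[OF openin_Int[OF op base.openin_chart_domain[OF d]] assms(1)]
      by (simp add: Int_ac)
    moreover have "open (snd d ` (fst c \<inter> V \<inter> fst d))" by (rule base.open_chart_image[OF op d])
    moreover have "smooth_on (snd c ` (fst c \<inter> V \<inter> fst d)) (snd d \<circ> chart_inv c)"
      "smooth_on (snd d ` (fst c \<inter> V \<inter> fst d)) (snd c \<circ> chart_inv d)"
      using cd by (auto simp: charts_compatible_def elim!: smooth_on_subset)
    moreover from this(1) have "smooth_on (snd c ` (fst c \<inter> V \<inter> fst d)) (snd d \<circ> chart_inv ?c)"
      by (rule smooth_on_cong[OF S]) (use ch inv in auto)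
    ultimately show ?thesis by (simp add: charts_compatible_def)
  qed
  moreover have "\<forall>c. is_chart c \<and> (\<forall>d\<in>atlas D. charts_compatible c d) \<longrightarrow> c \<in> atlas D"
    using manifold unfolding smooth_manifold_def by blast
  ultimately show ?thesis using ch' by blast
qed

lemma adapted_local_frame: "adapted c \<Longrightarrow> local_frame (coord_dom c) (coord_frame c)"
  unfolding adapted_coords_def local_frame_def base_open_def
  using base.openin_chart_domain by fastforce

lemma adapted_chart: "adapted c \<Longrightarrow> (coord_dom c, coord_map c) \<in> atlas D"
  by (auto simp: adapted_coords_def)

lemma adapted_basis: "adapted c \<Longrightarrow> q \<in> coord_dom c \<Longrightarrow> frame_basis_at D (coord_frame c) q"
  by (auto simp: adapted_coords_def)

lemma adapted_open: "adapted c \<Longrightarrow> base_open D (coord_dom c)"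
  using adapted_local_frame by (auto simp: local_frame_def)

lemma adapted_frame_fibre: "adapted c \<Longrightarrow> q \<in> coord_dom c \<Longrightarrow> coord_frame c a q \<in> fibre D q"
  using adapted_basis frame_in_fibre by metis

lemma adapted_frame_near: "adapted c \<Longrightarrow> q \<in> coord_dom c \<Longrightarrow> section_near q (coord_frame c a)"
  using adapted_local_frame local_frame_section_near by metis

lemma adapted_cover: obtains c where "adapted c" "q \<in> coord_dom c"
proof -
  obtain d where d: "d \<in> atlas D" "q \<in> fst d"
    using base.chart_at[of UNIV q] base_open_UNIV by (auto simp: base_open_def)
  obtain V e where V: "(V, e) \<in> frames D" "q \<in> V" using frame_cover .
  have "smooth_section D (fst d \<inter> V) (e a)" for a
    using local_frame_section_near[OF local_frame_bundle[OF V(1)]]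
      base_open_Int[OF _ frame_open[OF V(1)], of "fst d"] base.openin_chart_domain[OF d(1)]
    by (subst smooth_section_iff_near) (auto simp: base_open_def)
  then have "(fst d \<inter> V, snd d, e) \<in> adapted_coords D"
    using restricted_chart[OF d(1) frame_open[OF V(1)]] frame_basis[OF V(1)] by (auto simp: adapted_coords_def)
  then show thesis by (rule that) (use d V in auto)
qed

text \<open>The matrix A with e_a = A_a^b e'_b, where e is the frame of \<open>c\<close> and e' that
  of \<open>d\<close>. The fibre coordinates then transform by y'^b = A_a^b y^a.\<close>

definition change :: "('m, 'e, 'v, 'k) coords \<Rightarrow> ('m, 'e, 'v, 'k) coords \<Rightarrow> 'k \<Rightarrow> 'k \<Rightarrow> 'm \<Rightarrow> real" where
  "change c d a b q = frame_coords (coord_frame d) q (coord_frame c a q) $ b"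

lemma change_smooth:
  "adapted c \<Longrightarrow> adapted d \<Longrightarrow> q \<in> coord_dom c \<Longrightarrow> q \<in> coord_dom d \<Longrightarrow>
    smooth_near (atlas D) q (change c d a b)"
  unfolding change_def[abs_def] using section_near_coords[OF adapted_frame_near adapted_local_frame] by blast

lemma change_frame:
  assumes "adapted c" "adapted d" "q \<in> coord_dom c" "q \<in> coord_dom d"
  shows "coord_frame c a q = (\<Sum>b\<in>UNIV. change c d a b q *\<^sub>R coord_frame d b q)"
  unfolding change_def
  by (rule frame_expansion[symmetric, OF adapted_basis[OF assms(2,4)] adapted_frame_fibre[OF assms(1,3)]])

lemma change_coords:
  assumes "adapted c" "adapted d" "q \<in> coord_dom c" "q \<in> coord_dom d" "u \<in> fibre D q"
  shows "frame_coords (coord_frame d) q u $ b = (\<Sum>a\<in>UNIV. frame_coords (coord_frame c) q u $ a * change c d a b q)"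
  using frame_coords_sum[OF adapted_basis[OF assms(2,4)], of UNIV "\<lambda>a. coord_frame c a q"
      "\<lambda>a. frame_coords (coord_frame c) q u $ a"] adapted_frame_fibre[OF assms(1,3)]
    frame_expansion[OF adapted_basis[OF assms(1,3)] assms(5)]
  by (simp add: change_def)

lemma struct_C_smooth:
  assumes "adapted c" "q \<in> coord_dom c"
  shows "smooth_near (atlas D) q (struct_C D c a b f)"
  unfolding struct_C_def[abs_def]
  by (rule section_near_coords[OF local_bracket_section[OF adapted_frame_near adapted_frame_near]
        adapted_local_frame]) (rule assms)+

text \<open>Expand both sections in the frame of \<open>d\<close> and apply the Leibniz rule in each
  slot. Besides the tensorial part, each slot contributes the derivative of its frame-change
  coefficients along the other section, and the two contributions carry opposite signs.\<close>

lemma struct_C_change: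
  assumes c: "adapted c" "q \<in> coord_dom c" and d: "adapted d" "q \<in> coord_dom d"
  shows "(\<Sum>g\<in>UNIV. struct_C D c b a g q * change c d g f q) =
    (\<Sum>i\<in>UNIV. \<Sum>j\<in>UNIV. change c d b i q * change c d a j q * struct_C D d i j f q)
    + anchor D q (coord_frame c b q) (change c d a f) - anchor D q (coord_frame c a q) (change c d b f)"
proof -
  let ?A = "\<lambda>a j. change c d a j q" and ?e = "\<lambda>j. coord_frame d j q"
  let ?R = "\<lambda>b a j. anchor D q (coord_frame c b q) (change c d a j)"
  let ?lc = "\<lambda>i j. local_bracket D (coord_frame c i) (coord_frame c j) q"
  let ?ld = "\<lambda>i j. local_bracket D (coord_frame d i) (coord_frame d j) q"
  have sc: "section_near q (coord_frame c i)" and sd: "section_near q (coord_frame d i)" for i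
    by (intro adapted_frame_near c d)+
  have ed: "frame_basis_at D (coord_frame d) q" by (rule adapted_basis[OF d])
  have chs: "smooth_near (atlas D) q (change c d i j)" for i j by (intro change_smooth c d)
  have W: "base_open D (coord_dom c \<inter> coord_dom d)" by (intro base_open_Int adapted_open c d)
  have germ: "germ_eq D q (coord_frame c i) (\<lambda>x. \<Sum>j\<in>UNIV. change c d i j x *\<^sub>R coord_frame d j x)" for i
    unfolding germ_eq_def using W c(2) d(2) change_frame[OF c(1) d(1)]
    by (intro exI[of _ "coord_dom c \<inter> coord_dom d"]) auto
  have refl: "germ_eq D q s s" for s using W c d by (auto simp: germ_eq_def)
  have 1: "local_bracket D (coord_frame d i) (coord_frame c a) q =
      (\<Sum>j\<in>UNIV. ?A a j *\<^sub>R ?ld i j + anchor D q (?e i) (change c d a j) *\<^sub>R ?e j)" for i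
    using local_bracket_cong[OF sd sc refl germ] local_bracket_sum_right[OF sd sd chs] by simp
  have "?lc b a = (\<Sum>i\<in>UNIV. ?A b i *\<^sub>R local_bracket D (coord_frame d i) (coord_frame c a) q
      - ?R a b i *\<^sub>R ?e i)"
    using local_bracket_cong[OF sc sc germ refl] local_bracket_sum_left[OF sc sd chs] by simp
  also have "\<dots> = (\<Sum>i\<in>UNIV. \<Sum>j\<in>UNIV. (?A b i * ?A a j) *\<^sub>R ?ld i j)
      + (\<Sum>i\<in>UNIV. \<Sum>j\<in>UNIV. (?A b i * anchor D q (?e i) (change c d a j)) *\<^sub>R ?e j)
      - (\<Sum>i\<in>UNIV. ?R a b i *\<^sub>R ?e i)"
    by (simp add: 1 sum_subtractf scaleR_sum_right scaleR_add_right sum.distrib)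
  \<comment> \<open>Linearity of the anchor reassembles \<open>coord_frame c b\<close> from its
    expansion in the frame of \<open>d\<close>.\<close>
  also have "(\<Sum>i\<in>UNIV. \<Sum>j\<in>UNIV. (?A b i * anchor D q (?e i) (change c d a j)) *\<^sub>R ?e j)
      = (\<Sum>j\<in>UNIV. ?R b a j *\<^sub>R ?e j)"
    by (subst sum.swap)
      (simp add: change_frame[OF c(1) d(1) c(2) d(2), of b] anchor_sum adapted_frame_fibre d scaleR_sum_left)
  finally have eq: "?lc b a = (\<Sum>i\<in>UNIV. \<Sum>j\<in>UNIV. (?A b i * ?A a j) *\<^sub>R ?ld i j)
      + (\<Sum>j\<in>UNIV. (?R b a j - ?R a b j) *\<^sub>R ?e j)"
    by (simp add: scaleR_left_diff_distrib sum_subtractf)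
  have fib: "?ld i j \<in> fibre D q" "?lc i j \<in> fibre D q" for i j
    by (intro section_near_fibre local_bracket_section sc sd)+
  have "frame_coords (coord_frame d) q (?lc b a) $ f =
    (\<Sum>i\<in>UNIV. \<Sum>j\<in>UNIV. ?A b i * ?A a j * frame_coords (coord_frame d) q (?ld i j) $ f)
    + (?R b a f - ?R a b f)"
  proof -
    have sub: "(\<Sum>j\<in>UNIV. (?A b i * ?A a j) *\<^sub>R ?ld i j) \<in> fibre D q" for i
      by (intro subspace_sum subspace_scale subspace_fibre' fib)
    \<comment> \<open>The factor \<open>1 *\<^sub>R\<close> puts the outer sum into the shape of
      \<open>frame_coords_sum\<close>.\<close>
    have "frame_coords (coord_frame d) q (\<Sum>i\<in>UNIV. 1 *\<^sub>R (\<Sum>j\<in>UNIV. (?A b i * ?A a j) *\<^sub>R ?ld i j)) $ f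
      = (\<Sum>i\<in>UNIV. \<Sum>j\<in>UNIV. ?A b i * ?A a j * frame_coords (coord_frame d) q (?ld i j) $ f)"
      by (subst frame_coords_sum[OF ed sub]) (simp add: frame_coords_sum[OF ed fib(1)])
    moreover have "(\<Sum>i\<in>UNIV. \<Sum>j\<in>UNIV. (?A b i * ?A a j) *\<^sub>R ?ld i j) \<in> fibre D q"
      by (intro subspace_sum subspace_fibre' sub)
    ultimately show ?thesis
      unfolding eq by (simp add: frame_coords_add[OF ed] frame_combination_in_fibre[OF ed] frame_coords_combination[OF ed])
  qed
  then show ?thesis
    using change_coords[OF c(1) d(1) c(2) d(2) fib(2)] by (simp add: struct_C_def)
qed

section \<open>The total space and the prolongation\<close>

abbreviation "TA \<equiv> total_atlas D"
abbreviation "tdom c \<equiv> fst (total_chart D c)"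

definition total_basis :: "('e \<times> (real ^ 'k)) set" where
  "total_basis = (\<lambda>i. (i, 0)) ` model_basis D \<union> range (\<lambda>a. (0, axis a 1))"

lemma finite_model_basis: "finite (model_basis D)"
  using onb_base by (simp add: orthonormal_basis_def)

lemma total_expansion:
  fixes y :: "real ^ 'k"
  shows "(w, y) = (\<Sum>i\<in>model_basis D. (w \<bullet> i) *\<^sub>R (i, 0)) + (\<Sum>a\<in>UNIV. (y $ a) *\<^sub>R (0, axis a 1))"
proof -
  have "(\<Sum>i\<in>model_basis D. (w \<bullet> i) *\<^sub>R (i, 0::real ^ 'k)) = (w, 0)"
    using orthonormal_expansion[OF onb_base, of w] by (simp add: prod_eq_iff fst_sum snd_sum)
  moreover have "(\<Sum>a\<in>UNIV. (y $ a) *\<^sub>R (0::'e, axis a 1)) = (0, y)"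
    using basis_expansion[of y] by (simp add: prod_eq_iff fst_sum snd_sum scalar_mult_eq_scaleR)
  ultimately show ?thesis by (simp only: add_Pair add_0_left add_0_right)
qed

lemma orthonormal_total_basis: "orthonormal_basis total_basis"
  unfolding orthonormal_basis_def
proof (intro conjI)
  show "finite total_basis" using finite_model_basis by (simp add: total_basis_def)
  have on: "i \<bullet> j = (if i = j then 1 else 0)" if "i \<in> model_basis D" "j \<in> model_basis D" for i j
    using onb_base that by (simp add: orthonormal_basis_def)
  have nz: "i \<noteq> 0" if "i \<in> model_basis D" for i using on[OF that that] by auto
  show "\<forall>i\<in>total_basis. \<forall>j\<in>total_basis. i \<bullet> j = (if i = j then 1 else 0)"
    by (auto simp: total_basis_def on inner_axis_axis axis_eq_axis dest: nz split: if_splits)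
  have "z \<in> span total_basis" for z
  proof (cases z)
    case (Pair w y)
    show ?thesis unfolding Pair total_expansion[of w y]
      by (intro span_add span_sum span_scale span_base) (auto simp: total_basis_def)
  qed
  then show "span total_basis = UNIV" by blast
qed

lemma total_dom: "p \<in> tdom c \<longleftrightarrow> fst p \<in> coord_dom c \<and> snd p \<in> fibre D (fst p)"
  by (cases p) (auto simp: total_chart_def)

lemma total_map: "snd (total_chart D c) p = (coord_map c (fst p), frame_coords (coord_frame c) (fst p) (snd p))"
  by (cases p) (simp add: total_chart_def)

text \<open>Over an adapted chart the bundle is a product, so full preimages of base sets become
  cylinders, and openness upstairs reduces to openness in the base.\<close>

lemma total_map_image:
  assumes "adapted c" "W \<subseteq> coord_dom c"
  shows "snd (total_chart D c) ` {p. fst p \<in> W \<and> snd p \<in> fibre D (fst p)} = (coord_map c ` W) \<times> UNIV"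
proof (intro set_eqI iffI)
  fix z assume "z \<in> (coord_map c ` W) \<times> (UNIV :: (real ^ 'k) set)"
  then obtain q y where q: "q \<in> W" "z = (coord_map c q, y)" by auto
  have e: "frame_basis_at D (coord_frame c) q" using adapted_basis assms q by blast
  let ?p = "(q, \<Sum>a\<in>UNIV. y $ a *\<^sub>R coord_frame c a q)"
  have "z = snd (total_chart D c) ?p"
    by (simp add: total_map q(2) vec_eq_iff frame_coords_combination[OF e])
  then show "z \<in> snd (total_chart D c) ` {p. fst p \<in> W \<and> snd p \<in> fibre D (fst p)}"
    using q(1) frame_combination_in_fibre[OF e] by (intro image_eqI) auto
qed (auto simp: total_map)

lemma is_chart_total:
  assumes c: "adapted c"
  shows "is_chart (total_chart D c)"
proof -
  have ch: "is_chart (coord_dom c, coord_map c)" by (rule base.chart[OF adapted_chart[OF c]])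
  have "inj_on (snd (total_chart D c)) (tdom c)"
  proof (rule inj_onI)
    fix p p' assume p: "p \<in> tdom c" "p' \<in> tdom c"
      and eq: "snd (total_chart D c) p = snd (total_chart D c) p'"
    have q: "fst p = fst p'" using ch p eq by (auto simp: is_chart_def total_dom total_map dest: inj_onD)
    have e: "frame_basis_at D (coord_frame c) (fst p)" using adapted_basis c p by (auto simp: total_dom)
    have h: "snd p \<in> fibre D (fst p)" "snd p' \<in> fibre D (fst p)" using p q by (simp_all add: total_dom)
    have k: "frame_coords (coord_frame c) (fst p) (snd p) = frame_coords (coord_frame c) (fst p) (snd p')"
      using eq q by (simp add: total_map)
    have "snd p = snd p'"
      using frame_expansion[OF e h(1)] unfolding k frame_expansion[OF e h(2)] by simp
    then show "p = p'" using q by (simp add: prod_eq_iff)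
  qed
  moreover have "{p. fst p \<in> coord_dom c \<and> snd p \<in> fibre D (fst p)} = tdom c"
    by (auto simp: total_dom)
  then have "snd (total_chart D c) ` tdom c = (coord_map c ` coord_dom c) \<times> UNIV"
    using total_map_image[OF c order_refl] by simp
  then have "open (snd (total_chart D c) ` tdom c)"
    using ch by (simp add: is_chart_def open_Times)
  ultimately show ?thesis by (simp add: is_chart_def)
qed

lemma chart_inv_total:
  assumes "adapted c" "q \<in> coord_dom c"
  shows "chart_inv (total_chart D c) (coord_map c q, y) = (q, \<Sum>a\<in>UNIV. y $ a *\<^sub>R coord_frame c a q)"
proof -
  have e: "frame_basis_at D (coord_frame c) q" using adapted_basis assms by blast
  let ?p = "(q, \<Sum>a\<in>UNIV. y $ a *\<^sub>R coord_frame c a q)"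
  have "?p \<in> tdom c"
    using frame_combination_in_fibre[OF e] assms(2) by (simp add: total_dom)
  moreover have "snd (total_chart D c) ?p = (coord_map c q, y)"
    by (simp add: total_map vec_eq_iff frame_coords_combination[OF e])
  ultimately show ?thesis using chart_inv_image[OF is_chart_total[OF assms(1)], of ?p] by simp
qed

lemma smooth_on_compose_fst:
  fixes g :: "'e \<Rightarrow> 'c::real_normed_vector"
  assumes "open T" "smooth_on T g"
  shows "smooth_on (T \<times> (UNIV :: (real ^ 'k) set)) (\<lambda>z. g (fst z))"
  by (rule smooth_on_compose[OF onb_base _ assms(1) _ smooth_on_bounded_linear[OF _ bounded_linear_fst] assms(2)])
    (auto intro: open_Times assms)

lemma total_overlap:
  "tdom c \<inter> tdom d = {p. fst p \<in> coord_dom c \<inter> coord_dom d \<and> snd p \<in> fibre D (fst p)}"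
  by (auto simp: total_dom)

text \<open>The transition sends (x, y) to (x'(x), y'), where y' depends linearly on y with
  coefficients \<open>change c d\<close> that are smooth in x.\<close>

lemma total_transition_smooth:
  assumes c: "adapted c" and d: "adapted d"
  shows "open (snd (total_chart D c) ` (tdom c \<inter> tdom d))"
    and "smooth_on (snd (total_chart D c) ` (tdom c \<inter> tdom d))
      (snd (total_chart D d) \<circ> chart_inv (total_chart D c))"
proof -
  let ?c = "(coord_dom c, coord_map c)" and ?d = "(coord_dom d, coord_map d)"
  let ?U = "coord_dom c \<inter> coord_dom d"
  define T where "T = coord_map c ` ?U"
  have ch: "is_chart ?c" by (rule base.chart[OF adapted_chart[OF c]])
  have cd: "charts_compatible ?c ?d" by (intro base.compatible adapted_chart c d)
  have T: "open T" using cd by (simp add: charts_compatible_def T_def)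
  have img: "snd (total_chart D c) ` (tdom c \<inter> tdom d) = T \<times> UNIV"
    unfolding total_overlap T_def by (rule total_map_image[OF c]) simp
  have op: "open (T \<times> (UNIV :: (real ^ 'k) set))" using T by (simp add: open_Times)
  show "open (snd (total_chart D c) ` (tdom c \<inter> tdom d))"
    using op by (simp only: img)
  have s1: "smooth_on T (coord_map d \<circ> chart_inv ?c)"
    using cd by (simp add: charts_compatible_def T_def)
  have s2: "smooth_on T (change c d a b \<circ> chart_inv ?c)" for a b
  proof -
    have "smooth_fun (atlas D) ?U (change c d a b)"
      by (rule base.smooth_fun_local) (use change_smooth[OF c d] in blast)
    from base.smooth_funD_chart[OF this adapted_chart[OF c] order_refl]
    show ?thesis by (simp add: T_def)
  qed
  have lin: "bounded_linear (\<lambda>z::'e \<times> (real ^ 'k). snd z $ a)" for a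
    by (rule bounded_linear_compose[OF bounded_linear_vec_nth bounded_linear_snd])
  \<comment> \<open>The fibre part is written as a combination of the vectors
    \<open>axis b 1\<close>, so that closure under sums and products suffices.\<close>
  have sm: "smooth_on (T \<times> UNIV) (\<lambda>z. ((coord_map d \<circ> chart_inv ?c) (fst z),
      \<Sum>b\<in>UNIV. (\<Sum>a\<in>UNIV. snd z $ a * (change c d a b \<circ> chart_inv ?c) (fst z)) *\<^sub>R (axis b 1 :: real ^ 'k)))"
    by (intro smooth_on_Pair[OF op] smooth_on_compose_fst[OF T] smooth_on_sum[OF op] smooth_on_const[OF op]
        smooth_on_bilinear[OF op bounded_bilinear_scaleR] smooth_on_mult[OF op]
        smooth_on_bounded_linear[OF op lin] s1 s2)
  show "smooth_on (snd (total_chart D c) ` (tdom c \<inter> tdom d))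
      (snd (total_chart D d) \<circ> chart_inv (total_chart D c))"
    unfolding img
  proof (rule smooth_on_cong[OF op sm])
    fix z :: "'e \<times> (real ^ 'k)" assume "z \<in> T \<times> UNIV"
    then obtain q y where q: "q \<in> ?U" and z: "z = (coord_map c q, y)" by (auto simp: T_def)
    have e: "frame_basis_at D (coord_frame c) q" using adapted_basis c q by blast
    have inv: "chart_inv ?c (coord_map c q) = q" using chart_inv_image[OF ch, of q] q by simp
    have "frame_coords (coord_frame d) q (\<Sum>a\<in>UNIV. y $ a *\<^sub>R coord_frame c a q) $ b =
        (\<Sum>a\<in>UNIV. y $ a * change c d a b q)" for b
      using change_coords[OF c d _ _ frame_combination_in_fibre[OF e]] q
      by (simp add: frame_coords_combination[OF e])
    moreover have "(\<Sum>b\<in>UNIV. r b *\<^sub>R axis b 1) = (\<chi> b. r b)" for r :: "'k \<Rightarrow> real"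
      using basis_expansion[of "\<chi> b. r b"] by (simp add: scalar_mult_eq_scaleR)
    ultimately show "((coord_map d \<circ> chart_inv ?c) (fst z),
      \<Sum>b\<in>UNIV. (\<Sum>a\<in>UNIV. snd z $ a * (change c d a b \<circ> chart_inv ?c) (fst z)) *\<^sub>R axis b 1) =
      (snd (total_chart D d) \<circ> chart_inv (total_chart D c)) z"
      using q by (simp add: z chart_inv_total[OF c] total_map inv vec_eq_iff)
  qed
qed

sublocale total: coherent_atlas "TA" total_basis
proof
  show "orthonormal_basis total_basis" by (rule orthonormal_total_basis)
  show "is_chart c" if "c \<in> TA" for c using that is_chart_total by (auto simp: total_atlas_def)
  show "charts_compatible c d" if cd: "c \<in> TA" "d \<in> TA" for c d
  proof -
    obtain c' d' where "adapted c'" "c = total_chart D c'" "adapted d'" "d = total_chart D d'"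
      using cd unfolding total_atlas_def by blast
    then show ?thesis
      using total_transition_smooth[of c' d'] total_transition_smooth[of d' c']
      by (simp add: charts_compatible_def Int_commute)
  qed
qed

lemma total_chart_in: "adapted c \<Longrightarrow> total_chart D c \<in> TA"
  by (simp add: total_atlas_def)

lemma total_carrier: "atlas_carrier TA = total_space D"
proof (intro set_eqI iffI)
  fix p assume p: "p \<in> total_space D"
  obtain c where "adapted c" "fst p \<in> coord_dom c" using adapted_cover .
  then show "p \<in> atlas_carrier TA"
    using p by (auto simp: atlas_carrier_def total_atlas_def total_dom total_space_def)
next
  fix p assume "p \<in> atlas_carrier TA"
  then show "p \<in> total_space D"
    by (cases p) (auto simp: atlas_carrier_def total_atlas_def total_dom total_space_def)
qed

lemma total_spaceD: "p \<in> total_space D \<Longrightarrow> snd p \<in> fibre D (fst p)"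
  by (auto simp: total_space_def)

lemma total_dom_space: "p \<in> tdom c \<Longrightarrow> p \<in> total_space D"
  by (cases p) (auto simp: total_dom total_space_def)

lemma total_dom_iff: "p \<in> total_space D \<Longrightarrow> p \<in> tdom c \<longleftrightarrow> fst p \<in> coord_dom c"
  by (auto simp: total_dom dest: total_spaceD)

lemma total_cover:
  assumes "p \<in> total_space D"
  obtains c where "adapted c" "p \<in> tdom c"
  using adapted_cover total_dom_iff[OF assms] by metis

lemma total_openin: "adapted c \<Longrightarrow> openin (atlas_topology TA) (tdom c)"
  by (intro total.openin_chart_domain total_chart_in)

lemma base_chart_near:
  assumes "smooth_near (atlas D) q f" "adapted c" "q \<in> coord_dom c"
  shows "\<exists>W. base_open D W \<and> q \<in> W \<and> W \<subseteq> coord_dom c \<and> open (coord_map c ` W) \<and>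
    smooth_on (coord_map c ` W) (f \<circ> chart_inv (coord_dom c, coord_map c))"
  using base.smooth_near_chartD[OF assms(1) adapted_chart[OF assms(2)]] assms(3)
  unfolding base_open_def by (metis fst_conv snd_conv)

lemma chart_inv_base: "adapted c \<Longrightarrow> q \<in> coord_dom c \<Longrightarrow> chart_inv (coord_dom c, coord_map c) (coord_map c q) = q"
  using chart_inv_image[OF base.chart[OF adapted_chart], of c q] by simp

section \<open>Functions and tangent vectors on the total space compared with the base\<close>

lemma pullback_smooth:
  assumes "smooth_near (atlas D) (fst p) f" "p \<in> total_space D"
  shows "smooth_near TA p (f \<circ> fst)"
proof -
  obtain c where c: "adapted c" "fst p \<in> coord_dom c" using adapted_cover .
  obtain W where W: "base_open D W" "fst p \<in> W" "W \<subseteq> coord_dom c" "open (coord_map c ` W)"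
    "smooth_on (coord_map c ` W) (f \<circ> chart_inv (coord_dom c, coord_map c))"
    using base_chart_near[OF assms(1) c] by blast
  define P where "P = {p. fst p \<in> W \<and> snd p \<in> fibre D (fst p)}"
  have img: "snd (total_chart D c) ` P = (coord_map c ` W) \<times> UNIV"
    unfolding P_def by (rule total_map_image[OF c(1) W(3)])
  have op: "open ((coord_map c ` W) \<times> (UNIV :: (real ^ 'k) set))" using W(4) by (simp add: open_Times)
  have P: "P \<subseteq> tdom c" using W(3) by (auto simp: P_def total_dom)
  have oP: "openin (atlas_topology TA) P"
    using total.openin_chart_iff[OF total_chart_in[OF c(1)] P] op img by simp
  have "smooth_on ((coord_map c ` W) \<times> (UNIV :: (real ^ 'k) set)) ((f \<circ> fst) \<circ> chart_inv (total_chart D c))"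
    by (rule smooth_on_cong[OF op smooth_on_compose_fst[OF W(4,5)]])
      (use W(3) in \<open>auto simp: chart_inv_total[OF c(1)] chart_inv_base[OF c(1)] subset_iff\<close>)
  then have "smooth_fun TA P (f \<circ> fst)"
    by (intro total.smooth_funI_chart[OF total_chart_in[OF c(1)] oP P]) (simp add: img)
  then show ?thesis
    by (rule total.smooth_nearI[OF oP]) (use W(2) total_spaceD[OF assms(2)] in \<open>simp add: P_def\<close>)
qed

lemma fibre_coord_smooth:
  assumes "adapted c" "p \<in> tdom c"
  shows "smooth_near TA p (fibre_coord c a)"
proof -
  have lin: "bounded_linear (\<lambda>z::'e \<times> (real ^ 'k). snd z $ a)"
    by (rule bounded_linear_compose[OF bounded_linear_vec_nth bounded_linear_snd])
  show ?thesis
    using total.smooth_near_coordinate[OF total_chart_in[OF assms(1)] assms(2) lin]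
    by (simp add: total_map fibre_coord_def[abs_def])
qed

lemma tangent_vec_fibre_coord:
  assumes "adapted c" "p \<in> tdom c"
  shows "tangent_vec TA (total_chart D c) p (w, y) (fibre_coord c a) = y $ a"
proof -
  have lin: "bounded_linear (\<lambda>z::'e \<times> (real ^ 'k). snd z $ a)"
    by (rule bounded_linear_compose[OF bounded_linear_vec_nth bounded_linear_snd])
  show ?thesis
    using total.tangent_vec_coordinate[OF total_chart_in[OF assms(1)] assms(2) lin, of "(w, y)"]
    by (simp add: total_map fibre_coord_def[abs_def])
qed

lemma tangent_vec_pullback:
  assumes c: "adapted c" and p: "p \<in> tdom c" and f: "smooth_near (atlas D) (fst p) f"
  shows "tangent_vec TA (total_chart D c) p (w, y) (f \<circ> fst) =
    tangent_vec (atlas D) (coord_dom c, coord_map c) (fst p) w f"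
proof -
  let ?c = "(coord_dom c, coord_map c)"
  have q: "fst p \<in> coord_dom c" using p by (simp add: total_dom)
  have ch: "is_chart ?c" by (rule base.chart[OF adapted_chart[OF c]])
  have op: "open ((coord_map c ` coord_dom c) \<times> (UNIV :: (real ^ 'k) set))"
    using ch by (simp add: open_Times is_chart_def)
  have d: "((f \<circ> chart_inv ?c) has_derivative (\<lambda>w. tangent_vec (atlas D) ?c (fst p) w f))
      (at (fst (snd (total_chart D c) p)))"
    using base.tangent_vec_has_derivative[OF f adapted_chart[OF c]] q by (simp add: total_map)
  have "((\<lambda>z. (f \<circ> chart_inv ?c) (fst z)) has_derivative
      (\<lambda>z. tangent_vec (atlas D) ?c (fst p) (fst z) f)) (at (snd (total_chart D c) p))"
    by (rule has_derivative_compose[OF bounded_linear_imp_has_derivative[OF bounded_linear_fst] d])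
  then have "((f \<circ> fst) \<circ> chart_inv (total_chart D c) has_derivative
      (\<lambda>z. tangent_vec (atlas D) ?c (fst p) (fst z) f)) (at (snd (total_chart D c) p))"
    by (rule has_derivative_transform_within_open[OF _ op])
      (use q in \<open>auto simp: total_map chart_inv_total[OF c] chart_inv_base[OF c]\<close>)
  from total.tangent_vec_eqI[OF pullback_smooth[OF f total_dom_space[OF p]] this, of "(w, y)"]
  show ?thesis by simp
qed

lemma base_coordinate_smooth:
  "adapted c \<Longrightarrow> q \<in> coord_dom c \<Longrightarrow> smooth_near (atlas D) q (\<lambda>q. coord_map c q \<bullet> i)"
  using base.smooth_near_coordinate[OF adapted_chart, of c q "\<lambda>z. z \<bullet> i"] by (simp add: bounded_linear_inner_left)

lemma base_tangent_coordinate: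
  "adapted c \<Longrightarrow> q \<in> coord_dom c \<Longrightarrow>
    tangent_vec (atlas D) (coord_dom c, coord_map c) q w (\<lambda>q. coord_map c q \<bullet> i) = w \<bullet> i"
  using base.tangent_vec_coordinate[OF adapted_chart, of c q "\<lambda>z. z \<bullet> i"] by (simp add: bounded_linear_inner_left)

lemma rho_coords:
  assumes "adapted c" "q \<in> coord_dom c" "u \<in> fibre D q"
  shows "anchor D q u (\<lambda>q. coord_map c q \<bullet> i) = (\<Sum>a\<in>UNIV. frame_coords (coord_frame c) q u $ a * rho D c a i q)"
proof -
  have "u = (\<Sum>a\<in>UNIV. frame_coords (coord_frame c) q u $ a *\<^sub>R coord_frame c a q)"
    using frame_expansion[OF adapted_basis[OF assms(1,2)] assms(3)] by simp
  then have "anchor D q u (\<lambda>q. coord_map c q \<bullet> i) =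
      anchor D q (\<Sum>a\<in>UNIV. frame_coords (coord_frame c) q u $ a *\<^sub>R coord_frame c a q) (\<lambda>q. coord_map c q \<bullet> i)"
    by simp
  also have "\<dots> = (\<Sum>a\<in>UNIV. frame_coords (coord_frame c) q u $ a * rho D c a i q)"
    using anchor_sum[of UNIV "\<lambda>a. coord_frame c a q" q] adapted_frame_fibre[OF assms(1,2)] by (simp add: rho_def)
  finally show ?thesis .
qed

lemma anchor_tangent_vec:
  assumes "adapted c" "q \<in> coord_dom c" "u \<in> fibre D q"
  shows "anchor D q u = tangent_vec (atlas D) (coord_dom c, coord_map c) q
    (\<Sum>i\<in>model_basis D. anchor D q u (\<lambda>q. coord_map c q \<bullet> i) *\<^sub>R i)"
proof -
  obtain w where w: "anchor D q u = tangent_vec (atlas D) (coord_dom c, coord_map c) q w"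
    using base.tangent_space_chart[OF anchor_tangent[OF assms(3)] adapted_chart[OF assms(1)]] assms(2) by auto
  have "w = (\<Sum>i\<in>model_basis D. anchor D q u (\<lambda>q. coord_map c q \<bullet> i) *\<^sub>R i)"
    unfolding w base_tangent_coordinate[OF assms(1,2)] by (rule orthonormal_expansion[OF onb_base])
  then show ?thesis using w by simp
qed

lemma snd_prol_X:
  assumes "adapted c" "p \<in> tdom c"
  shows "snd (prol_X D c a p) = tangent_vec TA (total_chart D c) p
    (\<Sum>i\<in>model_basis D. rho D c a i (fst p) *\<^sub>R i, 0)"
proof -
  have lin: "linear (tangent_vec TA (total_chart D c) p)"
    by (rule total.linear_tangent_vec[OF total_chart_in[OF assms(1)] assms(2)])
  have "(\<Sum>i\<in>model_basis D. rho D c a i (fst p) *\<^sub>R i, 0) = (\<Sum>i\<in>model_basis D. rho D c a i (fst p) *\<^sub>R (i, 0::real ^ 'k))"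
    by (simp add: prod_eq_iff fst_sum snd_sum)
  then show ?thesis by (simp add: prol_X_def linear_sum[OF lin] linear_cmul[OF lin] del: scaleR_Pair)
qed

section \<open>Components of prolongation elements and their transformation\<close>

lemma prolongationD:
  assumes "z \<in> prolongation D p"
  shows "fst z \<in> fibre D (fst p)" "snd z \<in> tangent_space TA p"
    "smooth_near (atlas D) (fst p) f \<Longrightarrow> snd z (f \<circ> fst) = anchor D (fst p) (fst z) f"
  using assms by (auto simp: prolongation_def)

lemma prolongationI:
  assumes "fst z \<in> fibre D (fst p)" "snd z \<in> tangent_space TA p"
    "\<And>f. smooth_near (atlas D) (fst p) f \<Longrightarrow> snd z (f \<circ> fst) = anchor D (fst p) (fst z) f"
  shows "z \<in> prolongation D p"
  using assms by (cases z) (auto simp: prolongation_def)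

lemma subspace_prolongation:
  assumes "p \<in> total_space D"
  shows "subspace (prolongation D p)"
proof -
  have T: "subspace (tangent_space TA p)"
    using total.tangent_space_linear assms total_carrier by simp
  have F: "subspace (fibre D (fst p))" by (rule subspace_fibre')
  show ?thesis unfolding subspace_def
  proof (intro conjI ballI allI)
    have "anchor D (fst p) 0 = 0" using anchor_scale[OF subspace_0[OF F], where r = 0] by simp
    then show "0 \<in> prolongation D p"
      using subspace_0[OF T] subspace_0[OF F] by (intro prolongationI) auto
  next
    fix z z' assume z: "z \<in> prolongation D p" "z' \<in> prolongation D p"
    show "z + z' \<in> prolongation D p"
      using prolongationD[OF z(1)] prolongationD[OF z(2)] subspace_add[OF T] subspace_add[OF F]
      by (intro prolongationI) (auto simp: anchor_add)
  next
    fix r z assume z: "z \<in> prolongation D p"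
    show "r *\<^sub>R z \<in> prolongation D p"
      using prolongationD[OF z] subspace_scale[OF T] subspace_scale[OF F]
      by (intro prolongationI) (auto simp: anchor_scale scaleR_fun_def)
  qed
qed

lemma prol_X_in:
  assumes c: "adapted c" and p: "p \<in> tdom c"
  shows "prol_X D c a p \<in> prolongation D p"
proof (rule prolongationI)
  have q: "fst p \<in> coord_dom c" using p by (simp add: total_dom)
  have f: "coord_frame c a (fst p) \<in> fibre D (fst p)" by (rule adapted_frame_fibre[OF c q])
  then show "fst (prol_X D c a p) \<in> fibre D (fst p)" by (simp add: prol_X_def)
  show "snd (prol_X D c a p) \<in> tangent_space TA p"
    unfolding snd_prol_X[OF c p] by (rule total.tangent_vec_in_tangent_space[OF total_chart_in[OF c] p])
  fix h assume h: "smooth_near (atlas D) (fst p) h"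
  have "anchor D (fst p) (coord_frame c a (fst p)) h = tangent_vec (atlas D) (coord_dom c, coord_map c) (fst p)
      (\<Sum>i\<in>model_basis D. rho D c a i (fst p) *\<^sub>R i) h"
    unfolding rho_def by (rule fun_cong[OF anchor_tangent_vec[OF c q f]])
  then show "snd (prol_X D c a p) (h \<circ> fst) = anchor D (fst p) (fst (prol_X D c a p)) h"
    unfolding snd_prol_X[OF c p] tangent_vec_pullback[OF c p h] by (simp add: prol_X_def)
qed

lemma prol_V_in:
  assumes c: "adapted c" and p: "p \<in> tdom c"
  shows "prol_V D c a p \<in> prolongation D p"
proof (rule prolongationI)
  have q: "fst p \<in> coord_dom c" using p by (simp add: total_dom)
  have F: "0 \<in> fibre D (fst p)" by (rule subspace_0[OF subspace_fibre'])
  then show "fst (prol_V D c a p) \<in> fibre D (fst p)" by (simp add: prol_V_def)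
  show "snd (prol_V D c a p) \<in> tangent_space TA p"
    using total.tangent_vec_in_tangent_space[OF total_chart_in[OF c] p] by (simp add: prol_V_def)
  have lin: "linear (tangent_vec (atlas D) (coord_dom c, coord_map c) (fst p))"
    by (rule base.linear_tangent_vec[OF adapted_chart[OF c]]) (simp add: q)
  show "snd (prol_V D c a p) (f \<circ> fst) = anchor D (fst p) (fst (prol_V D c a p)) f"
    if "smooth_near (atlas D) (fst p) f" for f
    using tangent_vec_pullback[OF c p that] anchor_scale[OF F, where r = 0] linear_0[OF lin]
    by (simp add: prol_V_def)
qed

lemma fst_prol [simp]: "fst (prol_X D c a p) = coord_frame c a (fst p)" "fst (prol_V D c a p) = 0"
  by (simp_all add: prol_X_def prol_V_def)

lemma prol_X_fibre_coord:
  "adapted c \<Longrightarrow> p \<in> tdom c \<Longrightarrow> snd (prol_X D c a p) (fibre_coord c b) = 0"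
  by (simp add: snd_prol_X tangent_vec_fibre_coord)

lemma prol_V_fibre_coord:
  "adapted c \<Longrightarrow> p \<in> tdom c \<Longrightarrow>
    snd (prol_V D c a p) (fibre_coord c b) = (if a = b then 1 else 0)"
  by (simp add: prol_V_def tangent_vec_fibre_coord axis_def eq_commute)

definition combine :: "('m, 'e, 'v, 'k) coords \<Rightarrow> 'm \<times> 'v \<Rightarrow> ('k \<Rightarrow> real) \<Rightarrow> ('k \<Rightarrow> real) \<Rightarrow> ('m, 'v) prolongation_elem" where
  "combine c p \<xi> \<eta> = (\<Sum>a\<in>UNIV. \<xi> a *\<^sub>R prol_X D c a p) + (\<Sum>a\<in>UNIV. \<eta> a *\<^sub>R prol_V D c a p)"

text \<open>Testing the compatibility of anchor and projection on the base coordinates forces the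
  base part of \<open>snd z\<close> to be the anchor of \<open>fst z\<close>. What remains free are
  the fibre components of the velocity, and the fibre coordinates read them off.\<close>

lemma prolongation_combine:
  assumes c: "adapted c" and p: "p \<in> tdom c" and z: "z \<in> prolongation D p"
  shows "z = combine c p (\<lambda>a. frame_coords (coord_frame c) (fst p) (fst z) $ a) (\<lambda>a. snd z (fibre_coord c a))"
    (is "z = ?r")
proof (rule prod_eqI)
  have q: "fst p \<in> coord_dom c" using p by (simp add: total_dom)
  let ?k = "\<lambda>a. frame_coords (coord_frame c) (fst p) (fst z) $ a"
  let ?t = "tangent_vec TA (total_chart D c) p"
  have lin: "linear ?t" by (rule total.linear_tangent_vec[OF total_chart_in[OF c] p])
  show "fst z = fst ?r"
    using frame_expansion[OF adapted_basis[OF c q] prolongationD(1)[OF z]] by (simp add: combine_def fst_sum)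
  obtain w y where wy: "snd z = ?t (w, y)"
    using total.tangent_space_chart[OF prolongationD(2)[OF z] total_chart_in[OF c] p] by (metis surj_pair)
  have y: "y $ a = snd z (fibre_coord c a)" for a
    by (simp add: wy tangent_vec_fibre_coord[OF c p])
  have w: "w \<bullet> i = (\<Sum>a\<in>UNIV. ?k a * rho D c a i (fst p))" for i
  proof -
    have "w \<bullet> i = snd z ((\<lambda>q. coord_map c q \<bullet> i) \<circ> fst)"
      using tangent_vec_pullback[OF c p base_coordinate_smooth[OF c q]] by (simp add: wy base_tangent_coordinate[OF c q])
    also have "\<dots> = anchor D (fst p) (fst z) (\<lambda>q. coord_map c q \<bullet> i)"
      by (rule prolongationD(3)[OF z base_coordinate_smooth[OF c q]])
    also have "\<dots> = (\<Sum>a\<in>UNIV. ?k a * rho D c a i (fst p))" by (rule rho_coords[OF c q prolongationD(1)[OF z]])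
    finally show ?thesis .
  qed
  have "snd z = (\<Sum>i\<in>model_basis D. (w \<bullet> i) *\<^sub>R ?t (i, 0)) + (\<Sum>a\<in>UNIV. y $ a *\<^sub>R ?t (0, axis a 1))"
    unfolding wy by (subst total_expansion) (simp add: linear_add[OF lin] linear_sum[OF lin] linear_cmul[OF lin] del: scaleR_Pair)
  moreover have "(\<Sum>i\<in>model_basis D. (w \<bullet> i) *\<^sub>R ?t (i, 0)) = (\<Sum>a\<in>UNIV. ?k a *\<^sub>R snd (prol_X D c a p))"
  proof -
    have "(\<Sum>i\<in>model_basis D. (w \<bullet> i) *\<^sub>R ?t (i, 0)) =
        (\<Sum>i\<in>model_basis D. \<Sum>a\<in>UNIV. (?k a * rho D c a i (fst p)) *\<^sub>R ?t (i, 0))"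
      by (simp only: w scaleR_sum_left)
    also have "\<dots> = (\<Sum>a\<in>UNIV. \<Sum>i\<in>model_basis D. (?k a * rho D c a i (fst p)) *\<^sub>R ?t (i, 0))"
      by (rule sum.swap)
    also have "\<dots> = (\<Sum>a\<in>UNIV. ?k a *\<^sub>R snd (prol_X D c a p))"
      by (simp only: prol_X_def snd_conv scaleR_sum_right scaleR_scaleR)
    finally show ?thesis .
  qed
  ultimately show "snd z = snd ?r" by (simp add: combine_def snd_sum y prol_V_def)
qed

text \<open>The transformation laws below rest on this test: it replaces a comparison of functionals
  by one of their values on the fibre coordinates of a single chart.\<close>

lemma prolongation_eqI:
  assumes "adapted c" "p \<in> tdom c" "z \<in> prolongation D p" "z' \<in> prolongation D p"
    and "fst z = fst z'" "\<And>a. snd z (fibre_coord c a) = snd z' (fibre_coord c a)"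
  shows "z = z'"
  using prolongation_combine[OF assms(1-3)]
  unfolding assms(5,6) prolongation_combine[OF assms(1,2,4), symmetric] .

lemma combine_in:
  assumes "adapted c" "p \<in> tdom c"
  shows "combine c p \<xi> \<eta> \<in> prolongation D p"
  unfolding combine_def using subspace_prolongation[OF total_dom_space[OF assms(2)]] prol_X_in[OF assms] prol_V_in[OF assms]
  by (intro subspace_add subspace_sum subspace_scale) auto

lemma combine_snd:
  "snd (combine c p \<xi> \<eta>) F = (\<Sum>a\<in>UNIV. \<xi> a * snd (prol_X D c a p) F) + (\<Sum>a\<in>UNIV. \<eta> a * snd (prol_V D c a p) F)"
  by (simp add: combine_def snd_sum sum_fun_apply scaleR_fun_def)

lemma combine_fst: "fst (combine c p \<xi> \<eta>) = (\<Sum>a\<in>UNIV. \<xi> a *\<^sub>R coord_frame c a (fst p))"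
  by (simp add: combine_def fst_sum)

lemma combine_fibre_coord:
  "adapted c \<Longrightarrow> p \<in> tdom c \<Longrightarrow> snd (combine c p \<xi> \<eta>) (fibre_coord c a) = \<eta> a"
  by (simp add: combine_snd prol_X_fibre_coord prol_V_fibre_coord if_distrib cong: if_cong)

lemma combine_frame_coords:
  "adapted c \<Longrightarrow> p \<in> tdom c \<Longrightarrow>
    frame_coords (coord_frame c) (fst p) (fst (combine c p \<xi> \<eta>)) $ a = \<xi> a"
  unfolding combine_fst by (rule frame_coords_combination[OF adapted_basis]) (auto simp: total_dom)

lemma combine_inject:
  assumes "adapted c" "p \<in> tdom c" "combine c p \<xi> \<eta> = combine c p \<xi>' \<eta>'"
  shows "\<xi> a = \<xi>' a" "\<eta> a = \<eta>' a"
  using combine_frame_coords[OF assms(1,2)] combine_fibre_coord[OF assms(1,2)] assms(3) by metis+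

lemma fibre_coord_change:
  assumes c: "adapted c" "p \<in> tdom c" and d: "adapted d" "p \<in> tdom d"
  shows "fibre_coord d b p = (\<Sum>a\<in>UNIV. (change c d a b \<circ> fst) p * fibre_coord c a p)"
  using change_coords[OF c(1) d(1), of "fst p" "snd p" b] c(2) d(2)
  by (simp add: fibre_coord_def total_dom mult.commute)

text \<open>The Leibniz rule for y'^b = A_a^b y^a, where A_a^b comes from the base and is therefore
  differentiated by the anchor of \<open>fst z\<close>. The inhomogeneous terms in the laws for
  prolongation elements originate here.\<close>

lemma fibre_coord_change_derivative:
  assumes c: "adapted c" "p \<in> tdom c" and d: "adapted d" "p \<in> tdom d"
    and z: "z \<in> prolongation D p"
  shows "snd z (fibre_coord d b) = (\<Sum>a\<in>UNIV. change c d a b (fst p) * snd z (fibre_coord c a)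
    + anchor D (fst p) (fst z) (change c d a b) * fibre_coord c a p)"
proof -
  have op: "openin (atlas_topology TA) (tdom c \<inter> tdom d)"
    by (intro openin_Int total_openin c d)
  have ps: "p \<in> total_space D" by (rule total_dom_space[OF c(2)])
  have A: "smooth_near (atlas D) (fst p) (change c d a b)" for a
    by (rule change_smooth) (use c d in \<open>auto simp: total_dom\<close>)
  have sA: "smooth_near TA p (change c d a b \<circ> fst)" for a by (rule pullback_smooth[OF A ps])
  have sy: "smooth_near TA p (fibre_coord c a)" for a by (rule fibre_coord_smooth[OF c])
  have "snd z (fibre_coord d b) = snd z (\<lambda>p. \<Sum>a\<in>UNIV. (change c d a b \<circ> fst) p * fibre_coord c a p)"
    by (rule total.tangent_cong[OF prolongationD(2)[OF z] op]) (use c d fibre_coord_change in auto)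
  also have "\<dots> = (\<Sum>a\<in>UNIV. snd z (\<lambda>p. (change c d a b \<circ> fst) p * fibre_coord c a p))"
    by (intro total.tangent_sum[OF prolongationD(2)[OF z]] total.smooth_near_mult sA sy) (use ps total_carrier in simp)
  also have "\<dots> = (\<Sum>a\<in>UNIV. change c d a b (fst p) * snd z (fibre_coord c a)
    + anchor D (fst p) (fst z) (change c d a b) * fibre_coord c a p)"
    using total.tangent_mult[OF prolongationD(2)[OF z] sA sy] prolongationD(3)[OF z A] by simp
  finally show ?thesis .
qed

lemma prol_V_change:
  assumes c: "adapted c" "p \<in> tdom c" and d: "adapted d" "p \<in> tdom d"
  shows "prol_V D c a p = combine d p (\<lambda>_. 0) (\<lambda>b. change c d a b (fst p))"
proof (rule prolongation_eqI[OF d prol_V_in[OF c] combine_in[OF d]])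
  show "fst (prol_V D c a p) = fst (combine d p (\<lambda>_. 0) (\<lambda>b. change c d a b (fst p)))" by (simp add: combine_fst)
  have "anchor D (fst p) 0 f = 0" for f
    using anchor_scale[OF subspace_0[OF subspace_fibre'], where r = 0] by simp
  then show "snd (prol_V D c a p) (fibre_coord d b) = snd (combine d p (\<lambda>_. 0) (\<lambda>b. change c d a b (fst p))) (fibre_coord d b)" for b
    by (simp add: fibre_coord_change_derivative[OF c d prol_V_in[OF c]] combine_fibre_coord[OF d]
        prol_V_fibre_coord[OF c] if_distrib[of "\<lambda>x. _ * x"] cong: if_cong)
qed

text \<open>For \<open>prol_V\<close> the first component is 0 and the anchor term drops out; for
  \<open>prol_X\<close> it survives as a vertical part that is linear in the fibre
  coordinates.\<close>

lemma prol_X_change: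
  assumes c: "adapted c" "p \<in> tdom c" and d: "adapted d" "p \<in> tdom d"
  shows "prol_X D c a p = combine d p (\<lambda>b. change c d a b (fst p))
    (\<lambda>b. \<Sum>g\<in>UNIV. anchor D (fst p) (coord_frame c a (fst p)) (change c d g b) * fibre_coord c g p)"
    (is "_ = ?r")
proof (rule prolongation_eqI[OF d prol_X_in[OF c] combine_in[OF d]])
  show "fst (prol_X D c a p) = fst ?r"
    using change_frame[OF c(1) d(1)] c(2) d(2) by (simp add: combine_fst total_dom)
  show "snd (prol_X D c a p) (fibre_coord d b) = snd ?r (fibre_coord d b)" for b
    by (simp add: fibre_coord_change_derivative[OF c d prol_X_in[OF c]] combine_fibre_coord[OF d]
        prol_X_fibre_coord[OF c])
qed

text \<open>Bridge from the coordinate expressions in the definitions to derivations. Smoothness of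
  \<open>F\<close> enters because \<open>tangent_vec\<close> is set to 0 on all other functions,
  whereas \<open>d_y\<close> takes a Frechet derivative regardless.\<close>

lemma d_y_eq: "smooth_near TA p F \<Longrightarrow> d_y D c a F p = snd (prol_V D c a p) F"
  by (simp add: d_y_def prol_V_def tangent_vec_def)

lemma d_x_sum_eq:
  "smooth_near TA p F \<Longrightarrow>
    (\<Sum>i\<in>model_basis D. rho D c a i (fst p) * d_x D c i F p) = snd (prol_X D c a p) F"
  by (simp add: d_x_def prol_X_def tangent_vec_def sum_fun_apply scaleR_fun_def)

lemma d_y_smooth:
  "adapted c \<Longrightarrow> p \<in> tdom c \<Longrightarrow> smooth_near TA p F \<Longrightarrow>
    smooth_near TA p (d_y D c a F)"
  unfolding d_y_def[abs_def] by (rule total.smooth_near_derivative[OF _ total_chart_in])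

lemma d_x_smooth:
  "adapted c \<Longrightarrow> p \<in> tdom c \<Longrightarrow> smooth_near TA p F \<Longrightarrow>
    smooth_near TA p (d_x D c i F)"
  unfolding d_x_def[abs_def] by (rule total.smooth_near_derivative[OF _ total_chart_in])

lemma d_y_symmetric:
  assumes c: "adapted c" "p \<in> tdom c" and F: "smooth_near TA p F"
  shows "d_y D c a (d_y D c b F) p = d_y D c b (d_y D c a F) p"
proof -
  obtain W where W: "openin (atlas_topology TA) W" "p \<in> W" "W \<subseteq> tdom c"
    "open (snd (total_chart D c) ` W)" "smooth_on (snd (total_chart D c) ` W) (F \<circ> chart_inv (total_chart D c))"
    using total.smooth_near_chartD[OF F total_chart_in[OF c(1)] c(2)] .
  have ch: "is_chart (total_chart D c)" by (rule is_chart_total[OF c(1)])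
  let ?f = "F \<circ> chart_inv (total_chart D c)"
  let ?g = "\<lambda>u x. frechet_derivative ?f (at x) u"
  have eq: "d_y D c a (d_y D c b F) p =
      frechet_derivative (?g (0, axis b 1)) (at (snd (total_chart D c) p)) (0, axis a 1)" for a b
  proof -
    have 1: "(?g (0, axis b 1) has_derivative frechet_derivative (?g (0, axis b 1)) (at (snd (total_chart D c) p)))
        (at (snd (total_chart D c) p))"
      by (rule smooth_on_has_derivative[OF smooth_on_derivative[OF W(5)]]) (use W(2) in blast)
    have "(d_y D c b F \<circ> chart_inv (total_chart D c) has_derivative
        frechet_derivative (?g (0, axis b 1)) (at (snd (total_chart D c) p))) (at (snd (total_chart D c) p))"
      by (rule has_derivative_transform_within_open[OF 1 W(4)]) (use W(2,3) ch in \<open>auto simp: d_y_def subset_iff\<close>)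
    from frechet_derivative_at[OF this] show ?thesis by (simp add: d_y_def[of D c a])
  qed
  show ?thesis unfolding eq by (rule second_derivative_symmetric[OF W(4,5)]) (use W(2) in blast)
qed

lemma rho_smooth:
  assumes "adapted c" "q \<in> coord_dom c"
  shows "smooth_near (atlas D) q (rho D c a i)"
proof -
  have "smooth_fun (atlas D) (coord_dom c) (\<lambda>q. anchor D q (coord_frame c a q) (\<lambda>q. coord_map c q \<bullet> i))"
    by (rule anchor_smooth[OF adapted_open[OF assms(1)]])
      (use assms(1) base_coordinate_smooth[OF assms(1)] in \<open>auto simp: adapted_coords_def intro: base.smooth_fun_local\<close>)
  then show ?thesis
    unfolding rho_def[abs_def]
    using base.smooth_nearI adapted_open[OF assms(1)] assms(2) by (auto simp: base_open_def)
qed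

lemma anchor_change_smooth:
  assumes c: "adapted c" "q \<in> coord_dom c" and d: "adapted d" "q \<in> coord_dom d"
  shows "smooth_near (atlas D) q (\<lambda>q. anchor D q (coord_frame c a q) (change c d i j))"
proof -
  have U: "base_open D (coord_dom c \<inter> coord_dom d)" by (intro base_open_Int adapted_open c d)
  have "smooth_fun (atlas D) (coord_dom c \<inter> coord_dom d) (\<lambda>q. anchor D q (coord_frame c a q) (change c d i j))"
  proof (rule anchor_smooth[OF U])
    show "smooth_section D (coord_dom c \<inter> coord_dom d) (coord_frame c a)"
      unfolding smooth_section_iff_near[OF U] using adapted_frame_near[OF c(1)] by blast
    show "smooth_fun (atlas D) (coord_dom c \<inter> coord_dom d) (change c d i j)"
      by (rule base.smooth_fun_local[OF change_smooth[OF c(1) d(1)]]) auto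
  qed
  then show ?thesis using base.smooth_nearI U c d by (auto simp: base_open_def)
qed

text \<open>\<open>vertical\<close> is spanned by the vectors of all charts around the point; under
  a change of chart \<open>prol_V\<close> stays purely vertical, so one chart already yields the
  whole span.\<close>

lemma vertical_eq:
  assumes c: "adapted c" "p \<in> tdom c"
  shows "vertical D p = span (range (\<lambda>a. prol_V D c a p))"
proof -
  have dom: "fst p \<in> coord_dom d \<longleftrightarrow> p \<in> tdom d" for d
    using total_dom_iff[OF total_dom_space[OF c(2)]] by simp
  show ?thesis unfolding vertical_def
  proof (rule subset_antisym; rule span_minimal[OF _ subspace_span])
    show "{prol_V D d a p | d a. adapted d \<and> fst p \<in> coord_dom d} \<subseteq> span (range (\<lambda>a. prol_V D c a p))"
    proof
      fix v assume "v \<in> {prol_V D d a p | d a. adapted d \<and> fst p \<in> coord_dom d}"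
      then obtain d a where v: "v = prol_V D d a p" and "adapted d" "fst p \<in> coord_dom d" by blast
      then have "prol_V D d a p = combine c p (\<lambda>_. 0) (\<lambda>b. change d c a b (fst p))"
        using prol_V_change[OF _ _ c] dom by blast
      then show "v \<in> span (range (\<lambda>a. prol_V D c a p))"
        by (simp add: v combine_def span_sum span_scale span_base)
    qed
    show "range (\<lambda>a. prol_V D c a p) \<subseteq> span {prol_V D d a p | d a. adapted d \<and> fst p \<in> coord_dom d}"
    proof (rule image_subsetI)
      fix a
      have "prol_V D c a p \<in> {prol_V D d a p | d a. adapted d \<and> fst p \<in> coord_dom d}"
        using c dom by blast
      then show "prol_V D c a p \<in> span {prol_V D d a p | d a. adapted d \<and> fst p \<in> coord_dom d}"
        by (rule span_base)
    qed
  qed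
qed

lemma smooth_prolongation_sectionI:
  assumes "W \<subseteq> total_space D" "\<And>p. p \<in> W \<Longrightarrow> Z p \<in> prolongation D p"
    and "\<And>c a p. adapted c \<Longrightarrow> p \<in> W \<inter> tdom c \<Longrightarrow> smooth_near TA p (\<xi> c a)"
    and "\<And>c a p. adapted c \<Longrightarrow> p \<in> W \<inter> tdom c \<Longrightarrow> smooth_near TA p (\<eta> c a)"
    and "\<And>c p. adapted c \<Longrightarrow> p \<in> W \<inter> tdom c \<Longrightarrow> Z p = combine c p (\<lambda>a. \<xi> c a p) (\<lambda>a. \<eta> c a p)"
  shows "smooth_prolongation_section D W Z"
  unfolding smooth_prolongation_section_def
proof (intro conjI ballI)
  show "Z p \<in> prolongation D p" if "p \<in> W" for p by (rule assms(2)[OF that])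
qed (use assms(3-) in \<open>unfold combine_def, intro exI[of _ "\<xi> _"] exI[of _ "\<eta> _"],
  auto intro!: total.smooth_fun_local\<close>)

end

section \<open>Euler-Lagrange equations\<close>

lemma matrix_inv_right:
  assumes "invertible A"
  shows "A ** matrix_inv A = mat 1"
  using someI_ex[of "\<lambda>B. A ** B = mat 1 \<and> B ** A = mat 1"] assms
  unfolding invertible_def matrix_inv_def by blast

text \<open>Indexing the coefficients by \<open>'k\<close> instead of by vectors presents the
  combinations as the range of a linear map on \<open>real ^ 'k\<close>, which is a subspace
  containing every \<open>f b\<close>.\<close>

lemma span_range_obtain:
  fixes f :: "'k::finite \<Rightarrow> 'x::real_vector"
  assumes "x \<in> span (range f)"
  obtains r where "x = (\<Sum>a\<in>UNIV. r a *\<^sub>R f a)"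
proof -
  define h where "h = (\<lambda>r::real ^ 'k. \<Sum>a\<in>UNIV. r $ a *\<^sub>R f a)"
  have lin: "linear h"
    by (rule linearI) (simp_all add: h_def scaleR_left_distrib sum.distrib scaleR_sum_right)
  have "h (axis b 1) = f b" for b
  proof -
    have "h (axis b 1) = (\<Sum>a\<in>UNIV. if a = b then f a else 0)"
      unfolding h_def by (rule sum.cong) (auto simp: axis_def)
    then show ?thesis by simp
  qed
  then have "range f \<subseteq> range h" by (metis image_subsetI rangeI)
  then have "span (range f) \<subseteq> range h"
    by (rule span_minimal) (rule linear_subspace_image[OF lin subspace_UNIV])
  then show thesis using assms that by (auto simp: h_def)
qed

lemma sum_rotate4:
  "(\<Sum>a\<in>A. \<Sum>g\<in>G. \<Sum>i\<in>I. \<Sum>k\<in>K. t a g i k) = (\<Sum>i\<in>I. \<Sum>k\<in>K. \<Sum>g\<in>G. \<Sum>a\<in>A. t a g i k)"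
proof -
  have "(\<Sum>a\<in>A. \<Sum>g\<in>G. \<Sum>i\<in>I. \<Sum>k\<in>K. t a g i k) = (\<Sum>a\<in>A. \<Sum>i\<in>I. \<Sum>g\<in>G. \<Sum>k\<in>K. t a g i k)"
    by (rule sum.cong[OF refl sum.swap])
  also have "\<dots> = (\<Sum>i\<in>I. \<Sum>a\<in>A. \<Sum>g\<in>G. \<Sum>k\<in>K. t a g i k)" by (rule sum.swap)
  also have "\<dots> = (\<Sum>i\<in>I. \<Sum>a\<in>A. \<Sum>k\<in>K. \<Sum>g\<in>G. t a g i k)"
    by (rule sum.cong[OF refl sum.cong[OF refl sum.swap]])
  also have "\<dots> = (\<Sum>i\<in>I. \<Sum>k\<in>K. \<Sum>a\<in>A. \<Sum>g\<in>G. t a g i k)" by (rule sum.cong[OF refl sum.swap])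
  also have "\<dots> = (\<Sum>i\<in>I. \<Sum>k\<in>K. \<Sum>g\<in>G. \<Sum>a\<in>A. t a g i k)"
    by (rule sum.cong[OF refl sum.cong[OF refl sum.swap]])
  finally show ?thesis .
qed

locale lagrangian = algebroid D
  for D :: "('m, 'e::real_inner, 'v::real_vector, 'k::finite) algebroid" +
  fixes L :: "'m \<times> 'v \<Rightarrow> real"
  assumes regular: "regular_lagrangian D L"
begin

lemma L_smooth: "p \<in> total_space D \<Longrightarrow> smooth_near TA p L"
  using total.smooth_nearI[OF total.openin_carrier] regular total_carrier by (simp add: regular_lagrangian_def)

lemma hessian_invertible: "adapted c \<Longrightarrow> p \<in> tdom c \<Longrightarrow> invertible (hessian D L c p)"
  using regular by (simp add: regular_lagrangian_def invertible_det_nz)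

lemma dL_smooth: "adapted c \<Longrightarrow> p \<in> tdom c \<Longrightarrow> smooth_near TA p (d_y D c b L)"
  by (intro d_y_smooth L_smooth total_dom_space)

lemma hessian_symmetric:
  "adapted c \<Longrightarrow> p \<in> tdom c \<Longrightarrow> hessian D L c p $ a $ b = hessian D L c p $ b $ a"
  by (simp add: hessian_def d_y_symmetric L_smooth total_dom_space)

text \<open>The value that the second Euler-Lagrange equation prescribes for the time derivative of
  the momentum \<open>d_y D c b L\<close>.\<close>

definition el_force :: "('m, 'e, 'v, 'k) coords \<Rightarrow> 'k \<Rightarrow> 'm \<times> 'v \<Rightarrow> real" where
  "el_force c b p = snd (prol_X D c b p) L
    - (\<Sum>a\<in>UNIV. \<Sum>f\<in>UNIV. struct_C D c b a f (fst p) * d_y D c f L p * fibre_coord c a p)"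

text \<open>The Euler-Lagrange equations in the chart \<open>c\<close>, as a condition on the velocity \<open>z\<close> at \<open>p\<close>.\<close>

definition el_equations :: "('m, 'e, 'v, 'k) coords \<Rightarrow> ('m, 'v) prolongation_elem \<Rightarrow> 'm \<times> 'v \<Rightarrow> bool" where
  "el_equations c z p \<longleftrightarrow> (\<forall>b. snd z (d_y D c b L) = el_force c b p)"

definition semispray_in_chart :: "('m, 'e, 'v, 'k) coords \<Rightarrow> 'm \<times> 'v \<Rightarrow> ('m, 'v) prolongation_elem" where
  "semispray_in_chart c p = combine c p (\<lambda>a. fibre_coord c a p) (\<lambda>a. semispray_coeff D L c a p)"

text \<open>Right side of the linear system, with the Hessian as matrix, that the semispray
  coefficients solve. It is the force less the rate of change of the momentum already produced by
  the part y^a X_a of the velocity.\<close>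

definition source :: "('m, 'e, 'v, 'k) coords \<Rightarrow> 'k \<Rightarrow> 'm \<times> 'v \<Rightarrow> real" where
  "source c b p = (\<Sum>i\<in>model_basis D. rho D c b i (fst p) * d_x D c i L p)
         - (\<Sum>i\<in>model_basis D. \<Sum>a\<in>UNIV.
              rho D c a i (fst p) * d_x D c i (d_y D c b L) p * fibre_coord c a p)
         - (\<Sum>a\<in>UNIV. \<Sum>f\<in>UNIV.
              struct_C D c b a f (fst p) * d_y D c f L p * fibre_coord c a p)"

lemma el_force_iff:
  assumes "adapted c" "p \<in> tdom c"
  shows "P + (\<Sum>b\<in>UNIV. \<Sum>f\<in>UNIV. fibre_coord c b p * struct_C D c a b f (fst p) * d_y D c f L p)
    - (\<Sum>i\<in>model_basis D. rho D c a i (fst p) * d_x D c i L p) = 0 \<longleftrightarrow> P = el_force c a p"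
  unfolding d_x_sum_eq[OF L_smooth[OF total_dom_space[OF assms(2)]]] by (auto simp: el_force_def mult_ac)

lemma hessian_semispray:
  assumes "adapted c" "p \<in> tdom c"
  shows "hessian D L c p *v (\<chi> a. semispray_coeff D L c a p) = (\<chi> b. source c b p)"
proof -
  have "(\<chi> a. semispray_coeff D L c a p) = matrix_inv (hessian D L c p) *v (\<chi> b. source c b p)"
    by (simp add: vec_eq_iff matrix_vector_mult_def semispray_coeff_def source_def)
  then show ?thesis
    by (simp add: matrix_vector_mul_assoc matrix_inv_right[OF hessian_invertible[OF assms]])
qed

lemma source_eq:
  assumes "adapted c" "p \<in> tdom c"
  shows "source c b p = el_force c b p - (\<Sum>a\<in>UNIV. fibre_coord c a p * snd (prol_X D c a p) (d_y D c b L))"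
proof -
  have "(\<Sum>i\<in>model_basis D. \<Sum>a\<in>UNIV. rho D c a i (fst p) * d_x D c i (d_y D c b L) p * fibre_coord c a p)
    = (\<Sum>a\<in>UNIV. fibre_coord c a p * (\<Sum>i\<in>model_basis D. rho D c a i (fst p) * d_x D c i (d_y D c b L) p))"
    by (subst sum.swap) (simp add: sum_distrib_left mult_ac)
  then show ?thesis
    by (simp add: source_def el_force_def d_x_sum_eq dL_smooth[OF assms] L_smooth[OF total_dom_space[OF assms(2)]])
qed

lemma el_equations_iff:
  assumes c: "adapted c" "p \<in> tdom c" and z: "z \<in> prolongation D p" "fst z = snd p"
  shows "el_equations c z p \<longleftrightarrow> z = semispray_in_chart c p"
proof -
  \<comment> \<open>\<open>y\<close> holds the vertical components of \<open>z\<close>; the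
    components along \<open>prol_X\<close> are fixed by \<open>fst z = snd p\<close> to be the fibre
    coordinates of \<open>p\<close>.\<close>
  define y where "y = (\<chi> a. snd z (fibre_coord c a))"
  have zc: "z = combine c p (\<lambda>a. fibre_coord c a p) (\<lambda>a. y $ a)"
    using prolongation_combine[OF c z(1)] by (simp add: z(2) y_def fibre_coord_def)
  have eq: "snd z (d_y D c b L) = (\<Sum>a\<in>UNIV. fibre_coord c a p * snd (prol_X D c a p) (d_y D c b L))
      + (hessian D L c p *v y) $ b" for b
  proof -
    \<comment> \<open>\<open>prol_V D c a\<close> applied to the momentum with index
      \<open>b\<close> is the Hessian entry \<open>a\<close>, \<open>b\<close>, whereas the matrix
      product uses the entry \<open>b\<close>, \<open>a\<close>; symmetry of second derivatives
      identifies them.\<close>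
    have "(hessian D L c p *v y) $ b = (\<Sum>a\<in>UNIV. y $ a * snd (prol_V D c a p) (d_y D c b L))"
      unfolding matrix_vector_mult_def vec_lambda_beta hessian_symmetric[OF c, of b]
      by (simp add: hessian_def d_y_eq[OF dL_smooth[OF c]] mult.commute)
    then show ?thesis by (subst zc) (simp add: combine_snd)
  qed
  have "el_equations c z p \<longleftrightarrow> hessian D L c p *v y = (\<chi> b. source c b p)"
    by (simp add: el_equations_def eq vec_eq_iff source_eq[OF c] eq_diff_eq add.commute)
  also have "\<dots> \<longleftrightarrow> y = (\<chi> a. semispray_coeff D L c a p)"
    using hessian_semispray[OF c] inj_matrix_vector_mult[OF hessian_invertible[OF c]] by (metis injD)
  also have "\<dots> \<longleftrightarrow> z = semispray_in_chart c p"
  proof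
    show "y = (\<chi> a. semispray_coeff D L c a p)" if "z = semispray_in_chart c p"
      using combine_fibre_coord[OF c] that by (simp add: vec_eq_iff y_def semispray_in_chart_def)
  qed (simp add: zc semispray_in_chart_def)
  finally show ?thesis .
qed

lemma anchor_expansion:
  assumes c: "adapted c" "p \<in> tdom c"
  shows "anchor D (fst p) (snd p) f = (\<Sum>a\<in>UNIV. fibre_coord c a p * anchor D (fst p) (coord_frame c a (fst p)) f)"
proof -
  have q: "fst p \<in> coord_dom c" "snd p \<in> fibre D (fst p)" using c by (auto simp: total_dom)
  have "snd p = (\<Sum>a\<in>UNIV. fibre_coord c a p *\<^sub>R coord_frame c a (fst p))"
    unfolding fibre_coord_def by (rule frame_expansion[OF adapted_basis[OF c(1) q(1)] q(2), symmetric])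
  then have "anchor D (fst p) (snd p) f = anchor D (fst p) (\<Sum>a\<in>UNIV. fibre_coord c a p *\<^sub>R coord_frame c a (fst p)) f"
    by simp
  also have "\<dots> = (\<Sum>a\<in>UNIV. fibre_coord c a p * anchor D (fst p) (coord_frame c a (fst p)) f)"
    by (rule anchor_sum) (rule adapted_frame_fibre[OF c(1) q(1)])
  finally show ?thesis .
qed

lemma d_y_change:
  assumes c: "adapted c" "p \<in> tdom c" and d: "adapted d" "p \<in> tdom d"
  shows "d_y D c b L p = (\<Sum>j\<in>UNIV. (change c d b j \<circ> fst) p * d_y D d j L p)"
  using L_smooth[OF total_dom_space[OF c(2)]] by (simp add: d_y_eq prol_V_change[OF c d] combine_snd)

lemma el_equations_change:
  assumes c: "adapted c" "p \<in> tdom c" and d: "adapted d" "p \<in> tdom d"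
    and z: "z \<in> prolongation D p" "fst z = snd p" and el: "el_equations d z p"
  shows "el_equations c z p"
  unfolding el_equations_def
proof
  fix b
  let ?q = "fst p"
  define A where "A a j = change c d a j ?q" for a j
  define R where "R a i j = anchor D ?q (coord_frame c a ?q) (change c d i j)" for a i j
  define y where "y a = fibre_coord c a p" for a
  define X where "X j = snd (prol_X D d j p) L" for j
  define V where "V j = d_y D d j L p" for j
  define C where "C i k g = struct_C D d i k g ?q" for i k g
  have op: "openin (atlas_topology TA) (tdom c \<inter> tdom d)" by (intro openin_Int total_openin c d)
  have ps: "p \<in> total_space D" by (rule total_dom_space[OF c(2)])
  have q: "?q \<in> coord_dom c" "?q \<in> coord_dom d" using c d by (auto simp: total_dom)
  have As: "smooth_near (atlas D) ?q (change c d a j)" for a j by (rule change_smooth[OF c(1) d(1) q])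
  have sA: "smooth_near TA p (change c d a j \<circ> fst)" for a j by (rule pullback_smooth[OF As ps])
  have sV: "smooth_near TA p (d_y D d j L)" for j by (rule dL_smooth[OF d])
  note zT = prolongationD(2)[OF z(1)]
  have el': "snd z (d_y D d j L) = X j - (\<Sum>k\<in>UNIV. \<Sum>g\<in>UNIV. C j k g * V g * fibre_coord d k p)" for j
    using el by (simp add: el_equations_def el_force_def X_def V_def C_def)
  have "snd z (d_y D c b L) = snd z (\<lambda>p. \<Sum>j\<in>UNIV. (change c d b j \<circ> fst) p * d_y D d j L p)"
    by (rule total.tangent_cong[OF zT op _ d_y_change[OF c(1) _ d(1)]]) (use c(2) d(2) in auto)
  also have "\<dots> = (\<Sum>j\<in>UNIV. snd z (\<lambda>p. (change c d b j \<circ> fst) p * d_y D d j L p))"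
    by (intro total.tangent_sum[OF zT] total.smooth_near_mult sA sV) (use ps total_carrier in simp)
  also have "\<dots> = (\<Sum>j\<in>UNIV. A b j * snd z (d_y D d j L) + anchor D ?q (snd p) (change c d b j) * V j)"
    using total.tangent_mult[OF zT sA sV] prolongationD(3)[OF z(1) As] z(2) by (simp add: A_def V_def)
  \<comment> \<open>Three contributions: the transformed \<open>prol_X\<close> derivatives of
    \<open>L\<close>, the structure functions of \<open>d\<close>, and the derivative of the
    frame-change matrix along the anchor of \<open>snd p\<close>.\<close>
  also have "\<dots> = (\<Sum>j\<in>UNIV. A b j * X j) - (\<Sum>j\<in>UNIV. A b j * (\<Sum>k\<in>UNIV. \<Sum>g\<in>UNIV. C j k g * V g * fibre_coord d k p))
      + (\<Sum>j\<in>UNIV. (\<Sum>a\<in>UNIV. y a * R a b j) * V j)"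
    unfolding el' anchor_expansion[OF c]
    by (simp add: right_diff_distrib sum.distrib sum_subtractf R_def y_def)
  also have "(\<Sum>j\<in>UNIV. A b j * (\<Sum>k\<in>UNIV. \<Sum>g\<in>UNIV. C j k g * V g * fibre_coord d k p))
      = (\<Sum>a\<in>UNIV. \<Sum>g\<in>UNIV. y a * V g * (\<Sum>j\<in>UNIV. \<Sum>k\<in>UNIV. A b j * A a k * C j k g))"
  proof -
    have "(\<Sum>j\<in>UNIV. A b j * (\<Sum>k\<in>UNIV. \<Sum>g\<in>UNIV. C j k g * V g * fibre_coord d k p))
        = (\<Sum>j\<in>UNIV. \<Sum>k\<in>UNIV. \<Sum>g\<in>UNIV. \<Sum>a\<in>UNIV. y a * V g * (A b j * A a k * C j k g))"
      unfolding fibre_coord_change[OF c d]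
      by (simp add: sum_distrib_left sum_distrib_right A_def y_def mult_ac)
    also have "\<dots> = (\<Sum>a\<in>UNIV. \<Sum>g\<in>UNIV. \<Sum>j\<in>UNIV. \<Sum>k\<in>UNIV. y a * V g * (A b j * A a k * C j k g))"
      by (rule sum_rotate4[symmetric])
    finally show ?thesis by (simp add: sum_distrib_left)
  qed
  \<comment> \<open>\<open>struct_C_change\<close> trades the structure functions of
    \<open>d\<close> for those of \<open>c\<close>. Its term \<open>R a b g\<close> cancels against
    the derivative of the frame-change matrix, and \<open>R b a g\<close> supplies the vertical part
    that completes \<open>prol_X D c b\<close>.\<close>
  also have "\<dots> = (\<Sum>a\<in>UNIV. \<Sum>g\<in>UNIV. y a * V g * ((\<Sum>f\<in>UNIV. struct_C D c b a f ?q * A f g) - R b a g + R a b g))"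
    using struct_C_change[OF c(1) q(1) d(1) q(2), of b] by (simp add: A_def R_def C_def)
  also have "\<dots> = (\<Sum>a\<in>UNIV. \<Sum>g\<in>UNIV. y a * V g * (\<Sum>f\<in>UNIV. struct_C D c b a f ?q * A f g))
      - (\<Sum>a\<in>UNIV. \<Sum>g\<in>UNIV. y a * V g * R b a g) + (\<Sum>a\<in>UNIV. \<Sum>g\<in>UNIV. y a * V g * R a b g)"
    by (simp add: algebra_simps sum.distrib sum_subtractf)
  also have "(\<Sum>a\<in>UNIV. \<Sum>g\<in>UNIV. y a * V g * (\<Sum>f\<in>UNIV. struct_C D c b a f ?q * A f g))
      = (\<Sum>a\<in>UNIV. \<Sum>f\<in>UNIV. struct_C D c b a f ?q * d_y D c f L p * y a)"
  proof (rule sum.cong[OF refl])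
    fix a
    have "(\<Sum>g\<in>UNIV. y a * V g * (\<Sum>f\<in>UNIV. struct_C D c b a f ?q * A f g))
      = (\<Sum>g\<in>UNIV. \<Sum>f\<in>UNIV. struct_C D c b a f ?q * (A f g * V g) * y a)"
      by (simp add: sum_distrib_left mult_ac)
    also have "\<dots> = (\<Sum>f\<in>UNIV. \<Sum>g\<in>UNIV. struct_C D c b a f ?q * (A f g * V g) * y a)"
      by (rule sum.swap)
    also have "\<dots> = (\<Sum>f\<in>UNIV. struct_C D c b a f ?q * d_y D c f L p * y a)"
      unfolding d_y_change[OF c d] by (simp add: sum_distrib_left sum_distrib_right A_def V_def)
    finally show "(\<Sum>g\<in>UNIV. y a * V g * (\<Sum>f\<in>UNIV. struct_C D c b a f ?q * A f g))
      = (\<Sum>f\<in>UNIV. struct_C D c b a f ?q * d_y D c f L p * y a)" .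
  qed
  also have "(\<Sum>a\<in>UNIV. \<Sum>g\<in>UNIV. y a * V g * R a b g) = (\<Sum>j\<in>UNIV. (\<Sum>a\<in>UNIV. y a * R a b j) * V j)"
    by (subst sum.swap) (simp add: sum_distrib_left sum_distrib_right mult_ac)
  also have "(\<Sum>a\<in>UNIV. \<Sum>g\<in>UNIV. y a * V g * R b a g) = (\<Sum>j\<in>UNIV. (\<Sum>a\<in>UNIV. R b a j * y a) * V j)"
    by (subst sum.swap) (simp add: sum_distrib_left sum_distrib_right mult_ac)
  finally have "snd z (d_y D c b L) = (\<Sum>j\<in>UNIV. A b j * X j) + (\<Sum>j\<in>UNIV. (\<Sum>a\<in>UNIV. R b a j * y a) * V j)
      - (\<Sum>a\<in>UNIV. \<Sum>f\<in>UNIV. struct_C D c b a f ?q * d_y D c f L p * y a)"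
    by simp
  also have "(\<Sum>j\<in>UNIV. A b j * X j) + (\<Sum>j\<in>UNIV. (\<Sum>a\<in>UNIV. R b a j * y a) * V j) = snd (prol_X D c b p) L"
    unfolding prol_X_change[OF c d] combine_snd
    by (simp add: A_def X_def R_def y_def V_def d_y_eq[OF L_smooth[OF ps]])
  finally show "snd z (d_y D c b L) = el_force c b p" by (simp add: el_force_def y_def)
qed

section \<open>The global semispray and its integral curves\<close>

lemma semispray_in_chart_in: "adapted c \<Longrightarrow> p \<in> tdom c \<Longrightarrow> semispray_in_chart c p \<in> prolongation D p"
  unfolding semispray_in_chart_def by (rule combine_in)

lemma fst_semispray_in_chart:
  assumes "adapted c" "p \<in> tdom c"
  shows "fst (semispray_in_chart c p) = snd p"
  using assms frame_expansion[OF adapted_basis[OF assms(1)], of "fst p" "snd p"]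
  by (simp add: semispray_in_chart_def combine_fst fibre_coord_def total_dom)

text \<open>The vector built in \<open>d\<close> solves the equations of \<open>d\<close>, hence
  those of \<open>c\<close>, where the solution is unique.\<close>

lemma semispray_in_chart_change:
  assumes c: "adapted c" "p \<in> tdom c" and d: "adapted d" "p \<in> tdom d"
  shows "semispray_in_chart c p = semispray_in_chart d p"
  using el_equations_change[OF c d semispray_in_chart_in[OF d] fst_semispray_in_chart[OF d]] el_equations_iff[OF c semispray_in_chart_in[OF d] fst_semispray_in_chart[OF d]]
    el_equations_iff[OF d semispray_in_chart_in[OF d] fst_semispray_in_chart[OF d]] by simp

definition canonical_semispray :: "'m \<times> 'v \<Rightarrow> ('m, 'v) prolongation_elem" where
  "canonical_semispray p = semispray_in_chart (SOME c. adapted c \<and> p \<in> tdom c) p"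

lemma canonical_semispray_eq:
  assumes c: "adapted c" "p \<in> tdom c"
  shows "canonical_semispray p = semispray_in_chart c p"
proof -
  have "adapted (SOME c. adapted c \<and> p \<in> tdom c) \<and> p \<in> tdom (SOME c. adapted c \<and> p \<in> tdom c)"
    by (rule someI[of "\<lambda>c. adapted c \<and> p \<in> tdom c" c]) (use c in simp)
  then show ?thesis unfolding canonical_semispray_def using semispray_in_chart_change[OF _ _ c] by blast
qed

lemma pullback_near:
  "(\<And>q. q \<in> coord_dom c \<Longrightarrow> smooth_near (atlas D) q f) \<Longrightarrow> p \<in> tdom c \<Longrightarrow> smooth_near TA p (\<lambda>p. f (fst p))"
  using pullback_smooth[of p f] total_dom_space[of p c] by (simp add: total_dom comp_def)

text \<open>The coefficients are defined through \<open>matrix_inv\<close>; their smoothness is read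
  off from the linear system that they solve, by Cramer's rule.\<close>

lemma semispray_coeff_smooth:
  assumes c: "adapted c" "p \<in> tdom c"
  shows "smooth_near TA p (semispray_coeff D L c a)"
proof -
  have carrier: "p \<in> atlas_carrier TA" using total_dom_space[OF c(2)] total_carrier by simp
  have sL: "smooth_near TA p L" by (rule L_smooth[OF total_dom_space[OF c(2)]])
  have sr: "smooth_near TA p (\<lambda>p. rho D c a i (fst p))" for a i
    by (rule pullback_near[OF rho_smooth[OF c(1)] c(2)])
  have sC: "smooth_near TA p (\<lambda>p. struct_C D c a b f (fst p))" for a b f
    by (rule pullback_near[OF struct_C_smooth[OF c(1)] c(2)])
  have sS: "smooth_near TA p (source c b)" for b
    unfolding source_def[abs_def]
    by (intro total.smooth_near_diff total.smooth_near_sum total.smooth_near_mult carrier sr sC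
        d_x_smooth[OF c] d_y_smooth[OF c] fibre_coord_smooth[OF c] sL)
  have "smooth_near TA p (\<lambda>p. (\<chi> a. semispray_coeff D L c a p) $ a)"
  proof (rule total.smooth_near_linear_solution[OF total_openin[OF c(1)] c(2)])
    show "smooth_near TA p (\<lambda>p. hessian D L c p $ i $ j)" for i j
      using d_y_smooth[OF c d_y_smooth[OF c sL]] by (simp add: hessian_def)
    show "smooth_near TA p (\<lambda>p. (\<chi> b. source c b p) $ i)" for i using sS by simp
    show "det (hessian D L c p) \<noteq> 0" if "p \<in> tdom c" for p
      using hessian_invertible[OF c(1) that] by (simp add: invertible_det_nz)
    show "hessian D L c p *v (\<chi> a. semispray_coeff D L c a p) = (\<chi> b. source c b p)" if "p \<in> tdom c" for p
      by (rule hessian_semispray[OF c(1) that])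
  qed
  then show ?thesis by simp
qed

lemma semispray_canonical_semispray: "semispray D canonical_semispray"
  unfolding semispray_def
proof (intro conjI ballI)
  show "smooth_prolongation_section D (total_space D) canonical_semispray"
  proof (rule smooth_prolongation_sectionI[of _ _ fibre_coord "semispray_coeff D L"])
    show "canonical_semispray p \<in> prolongation D p" if "p \<in> total_space D" for p
      using total_cover[OF that] canonical_semispray_eq semispray_in_chart_in by metis
  qed (auto simp: canonical_semispray_eq semispray_in_chart_def fibre_coord_smooth semispray_coeff_smooth)
  show "fst (canonical_semispray p) = snd p" if "p \<in> total_space D" for p
    using total_cover[OF that] canonical_semispray_eq fst_semispray_in_chart by metis
qed

text \<open>For a curve with velocity \<open>v\<close> at the point \<open>p\<close>, the equations
  for the base coordinates say that \<open>(snd p, v)\<close> lies in the prolongation, and those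
  for the momenta that it satisfies \<open>el_equations\<close>; uniqueness identifies it with the
  semispray. Conversely, both sets of equations are values of the semispray, on base coordinates and
  on momenta.\<close>

lemma integral_curve_iff:
  "integral_curve D (\<lambda>p. prolongation_anchor (canonical_semispray p)) J \<gamma> \<longleftrightarrow> euler_lagrange_solution D L J \<gamma>"
proof
  assume I: "integral_curve D (\<lambda>p. prolongation_anchor (canonical_semispray p)) J \<gamma>"
  show "euler_lagrange_solution D L J \<gamma>"
    unfolding euler_lagrange_solution_def
  proof (intro conjI ballI impI allI)
    show dc: "differentiable_curve D J \<gamma>" using I by (simp add: integral_curve_def)
    fix c t assume c: "adapted c" and t: "t \<in> J" and q: "fst (\<gamma> t) \<in> coord_dom c"
    let ?p = "\<gamma> t"
    have ps: "?p \<in> total_space D" using dc t by (auto simp: differentiable_curve_def)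
    have p: "?p \<in> tdom c" using total_dom_iff[OF ps] q by simp
    have "has_velocity TA \<gamma> (snd (semispray_in_chart c ?p)) t"
      using I t by (simp add: integral_curve_def prolongation_anchor_def canonical_semispray_eq[OF c p, symmetric])
    then have der: "((\<lambda>s. f (\<gamma> s)) has_real_derivative snd (semispray_in_chart c ?p) f) (at t)" if "smooth_near TA ?p f" for f
      using that by (simp add: has_velocity_def)
    note gin = semispray_in_chart_in[OF c p]
    show "((\<lambda>s. coord_map c (fst (\<gamma> s)) \<bullet> i) has_real_derivative
        (\<Sum>a\<in>UNIV. rho D c a i (fst ?p) * fibre_coord c a ?p)) (at t)" for i
    proof -
      have "snd (semispray_in_chart c ?p) ((\<lambda>q. coord_map c q \<bullet> i) \<circ> fst) = anchor D (fst ?p) (snd ?p) (\<lambda>q. coord_map c q \<bullet> i)"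
        using prolongationD(3)[OF gin base_coordinate_smooth[OF c q]] fst_semispray_in_chart[OF c p] by simp
      also have "\<dots> = (\<Sum>a\<in>UNIV. rho D c a i (fst ?p) * fibre_coord c a ?p)"
        using rho_coords[OF c q total_spaceD[OF ps]] by (simp add: fibre_coord_def mult.commute)
      finally show ?thesis
        using der[OF pullback_smooth[OF base_coordinate_smooth[OF c q] ps], of i] by simp
    qed
    fix a
    have el: "el_equations c (semispray_in_chart c ?p) ?p" using el_equations_iff[OF c p gin fst_semispray_in_chart[OF c p]] by simp
    then have "((\<lambda>s. d_y D c a L (\<gamma> s)) has_real_derivative el_force c a ?p) (at t)"
      using der[OF dL_smooth[OF c p], of a] by (simp add: el_equations_def)
    then show "\<exists>P. ((\<lambda>s. d_y D c a L (\<gamma> s)) has_real_derivative P) (at t) \<and>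
           P + (\<Sum>b\<in>UNIV. \<Sum>f\<in>UNIV.
                  fibre_coord c b ?p * struct_C D c a b f (fst ?p) * d_y D c f L ?p)
             - (\<Sum>i\<in>model_basis D. rho D c a i (fst ?p) * d_x D c i L ?p) = 0"
      unfolding el_force_iff[OF c p] by blast
  qed
next
  assume E: "euler_lagrange_solution D L J \<gamma>"
  have dc: "differentiable_curve D J \<gamma>" using E by (simp add: euler_lagrange_solution_def)
  have "has_velocity TA \<gamma> (snd (canonical_semispray (\<gamma> t))) t" if t: "t \<in> J" for t
  proof -
    let ?p = "\<gamma> t"
    have ps: "?p \<in> total_space D" using dc t by (auto simp: differentiable_curve_def)
    obtain c where c: "adapted c" "?p \<in> tdom c" using total_cover[OF ps] .
    have q: "fst ?p \<in> coord_dom c" using c by (simp add: total_dom)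
    \<comment> \<open>A velocity exists by \<open>differentiable_curve\<close>; the Euler-Lagrange
      equations by themselves speak only of base coordinates and momenta along the curve.\<close>
    obtain v where v: "has_velocity TA \<gamma> v t" using dc t by (auto simp: differentiable_curve_def)
    have vT: "v \<in> tangent_space TA ?p" using v by (simp add: has_velocity_def)
    have der: "((\<lambda>s. f (\<gamma> s)) has_real_derivative v f) (at t)" if "smooth_near TA ?p f" for f
      using v that by (simp add: has_velocity_def)
    have E1: "((\<lambda>s. coord_map c (fst (\<gamma> s)) \<bullet> i) has_real_derivative
        (\<Sum>a\<in>UNIV. rho D c a i (fst ?p) * fibre_coord c a ?p)) (at t)" if "i \<in> model_basis D" for i
      using E c(1) t q that by (simp add: euler_lagrange_solution_def)
    have E2: "((\<lambda>s. d_y D c a L (\<gamma> s)) has_real_derivative el_force c a ?p) (at t)" for a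
      using E[unfolded euler_lagrange_solution_def, THEN conjunct2, rule_format, OF c(1) t q,
          THEN conjunct2, rule_format, of a, unfolded el_force_iff[OF c]] by blast
    obtain w y where wy: "v = tangent_vec TA (total_chart D c) ?p (w, y)"
      using total.tangent_space_chart[OF vT total_chart_in[OF c(1)] c(2)] by (metis surj_pair)
    have wi: "w \<bullet> i = anchor D (fst ?p) (snd ?p) (\<lambda>q. coord_map c q \<bullet> i)" if i: "i \<in> model_basis D" for i
    proof -
      have "w \<bullet> i = v ((\<lambda>q. coord_map c q \<bullet> i) \<circ> fst)"
        using tangent_vec_pullback[OF c base_coordinate_smooth[OF c(1) q]] by (simp add: wy base_tangent_coordinate[OF c(1) q])
      also have "\<dots> = (\<Sum>a\<in>UNIV. rho D c a i (fst ?p) * fibre_coord c a ?p)"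
        using DERIV_unique[OF _ E1[OF i]] der[OF pullback_smooth[OF base_coordinate_smooth[OF c(1) q] ps]] by simp
      also have "\<dots> = anchor D (fst ?p) (snd ?p) (\<lambda>q. coord_map c q \<bullet> i)"
        using rho_coords[OF c(1) q total_spaceD[OF ps]] by (simp add: fibre_coord_def mult.commute)
      finally show ?thesis .
    qed
    \<comment> \<open>The inner products with the basis determine \<open>w\<close>, so the projected
      velocity and the anchor of \<open>snd p\<close> are one tangent vector.\<close>
    have "w = (\<Sum>i\<in>model_basis D. anchor D (fst ?p) (snd ?p) (\<lambda>q. coord_map c q \<bullet> i) *\<^sub>R i)"
      using orthonormal_expansion[OF onb_base, of w] wi by simp
    then have anch: "anchor D (fst ?p) (snd ?p) = tangent_vec (atlas D) (coord_dom c, coord_map c) (fst ?p) w"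
      using anchor_tangent_vec[OF c(1) q total_spaceD[OF ps]] by simp
    have zin: "(snd ?p, v) \<in> prolongation D ?p"
    proof (rule prolongationI)
      show "snd (snd ?p, v) (f \<circ> fst) = anchor D (fst ?p) (fst (snd ?p, v)) f"
        if "smooth_near (atlas D) (fst ?p) f" for f
        using tangent_vec_pullback[OF c that] by (simp add: wy anch)
    qed (use vT total_spaceD[OF ps] in auto)
    have "el_equations c (snd ?p, v) ?p"
      unfolding el_equations_def
      using DERIV_unique[OF der[OF dL_smooth[OF c]] E2] by simp
    then have "(snd ?p, v) = semispray_in_chart c ?p" using el_equations_iff[OF c zin] by simp
    then have "v = snd (canonical_semispray ?p)" using canonical_semispray_eq[OF c] by (metis snd_conv)
    then show ?thesis using v by simp
  qed
  then show "integral_curve D (\<lambda>p. prolongation_anchor (canonical_semispray p)) J \<gamma>"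
    using dc by (simp add: integral_curve_def prolongation_anchor_def)
qed

section \<open>The canonical connection\<close>

lemma prol_V_pullback:
  assumes "adapted c" "p \<in> tdom c" "smooth_near (atlas D) (fst p) f"
  shows "snd (prol_V D c a p) (f \<circ> fst) = 0"
  using prolongationD(3)[OF prol_V_in[OF assms(1,2)] assms(3)]
    anchor_scale[OF subspace_0[OF subspace_fibre'], where r = 0] by simp

text \<open>Evaluate the chart-independent semispray on the fibre coordinates of \<open>d\<close>.
  The anchor of \<open>snd p\<close> is linear in the fibre coordinates, so the inhomogeneous term
  is quadratic in them.\<close>

lemma semispray_coeff_change:
  assumes c: "adapted c" "p \<in> tdom c" and d: "adapted d" "p \<in> tdom d"
  shows "semispray_coeff D L d j p = (\<Sum>g\<in>UNIV. (change c d g j \<circ> fst) p * semispray_coeff D L c g p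
    + (\<Sum>b\<in>UNIV. fibre_coord c b p * ((\<lambda>q. anchor D q (coord_frame c b q) (change c d g j)) \<circ> fst) p) * fibre_coord c g p)"
proof -
  have "semispray_coeff D L d j p = snd (semispray_in_chart c p) (fibre_coord d j)"
    unfolding semispray_in_chart_change[OF c d] by (simp add: semispray_in_chart_def combine_fibre_coord[OF d])
  then show ?thesis
    using fibre_coord_change_derivative[OF c d semispray_in_chart_in[OF c]]
    by (simp add: fst_semispray_in_chart[OF c] anchor_expansion[OF c]) (simp add: semispray_in_chart_def combine_fibre_coord[OF c])
qed

text \<open>Differentiating the quadratic term along one fibre direction hits either of its two
  linear factors, which produces \<open>R\<close> with that index in either position.\<close>

lemma semispray_coeff_change_derivative:
  fixes a j
  assumes c: "adapted c" "p \<in> tdom c" and d: "adapted d" "p \<in> tdom d"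
  defines "R \<equiv> \<lambda>b g. anchor D (fst p) (coord_frame c b (fst p)) (change c d g j)"
  shows "snd (prol_V D c a p) (semispray_coeff D L d j) =
    (\<Sum>g\<in>UNIV. change c d g j (fst p) * snd (prol_V D c a p) (semispray_coeff D L c g))
    + (\<Sum>g\<in>UNIV. R a g * fibre_coord c g p) + (\<Sum>b\<in>UNIV. fibre_coord c b p * R b a)"
proof -
  let ?v = "snd (prol_V D c a p)"
  let ?R = "\<lambda>b g. (\<lambda>q. anchor D q (coord_frame c b q) (change c d g j)) \<circ> fst"
  let ?S = "\<lambda>g p. \<Sum>b\<in>UNIV. fibre_coord c b p * ?R b g p"
  let ?F = "\<lambda>g p. (change c d g j \<circ> fst) p * semispray_coeff D L c g p + ?S g p * fibre_coord c g p"
  let ?s = "\<lambda>g. R a g * fibre_coord c g p + (if a = g then \<Sum>b\<in>UNIV. fibre_coord c b p * R b g else 0)"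
  have ps: "p \<in> total_space D" by (rule total_dom_space[OF c(2)])
  have carrier: "p \<in> atlas_carrier TA" using ps total_carrier by simp
  have op: "openin (atlas_topology TA) (tdom c \<inter> tdom d)" by (intro openin_Int total_openin c d)
  have q: "fst p \<in> coord_dom c" "fst p \<in> coord_dom d" using c d by (auto simp: total_dom)
  note vT = prolongationD(2)[OF prol_V_in[OF c], of a]
  have A: "smooth_near (atlas D) (fst p) (change c d g j)" for g by (rule change_smooth[OF c(1) d(1) q])
  have Rs: "smooth_near (atlas D) (fst p) (\<lambda>q. anchor D q (coord_frame c b q) (change c d g j))" for b g
    by (rule anchor_change_smooth[OF c(1) q(1) d(1) q(2)])
  note sA = pullback_smooth[OF A ps] and sR = pullback_smooth[OF Rs ps]
    and sy = fibre_coord_smooth[OF c] and sp = semispray_coeff_smooth[OF c]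
  have sS: "smooth_near TA p (?S g)" for g
    by (intro total.smooth_near_sum total.smooth_near_mult carrier sR sy)
  have dS: "?v (?S g) = R a g" for g
  proof -
    have "?v (?S g) = (\<Sum>b\<in>UNIV. ?v (\<lambda>p. fibre_coord c b p * ?R b g p))"
      by (intro total.tangent_sum[OF vT carrier] total.smooth_near_mult sR sy)
    also have "\<dots> = (\<Sum>b\<in>UNIV. if a = b then R b g else 0)"
      unfolding total.tangent_mult[OF vT sy sR] prol_V_pullback[OF c Rs] prol_V_fibre_coord[OF c]
      by (rule sum.cong[OF refl]) (simp add: R_def)
    finally show ?thesis by simp
  qed
  have "?v (semispray_coeff D L d j) = ?v (\<lambda>p. \<Sum>g\<in>UNIV. ?F g p)"
    by (rule total.tangent_cong[OF vT op _ semispray_coeff_change[OF c(1) _ d(1)]]) (use c(2) d(2) in auto)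
  also have "\<dots> = (\<Sum>g\<in>UNIV. ?v (?F g))"
    by (intro total.tangent_sum[OF vT carrier] total.smooth_near_add total.smooth_near_mult sA sp sS sy)
  also have "\<dots> = (\<Sum>g\<in>UNIV. change c d g j (fst p) * ?v (semispray_coeff D L c g)
      + ?s g)"
  proof (rule sum.cong[OF refl])
    fix g
    have "?v (?F g)
      = ?v (\<lambda>p. (change c d g j \<circ> fst) p * semispray_coeff D L c g p)
      + ?v (\<lambda>p. ?S g p * fibre_coord c g p)"
      by (intro total.tangent_add[OF vT] total.smooth_near_mult sA sp sS sy)
    also have "?v (\<lambda>p. (change c d g j \<circ> fst) p * semispray_coeff D L c g p)
      = change c d g j (fst p) * ?v (semispray_coeff D L c g)"
      unfolding total.tangent_mult[OF vT sA sp] prol_V_pullback[OF c A] by simp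
    also have "?v (\<lambda>p. ?S g p * fibre_coord c g p)
      = ?s g"
      unfolding total.tangent_mult[OF vT sS sy] dS by (simp add: prol_V_fibre_coord[OF c] R_def)
    finally show "?v (?F g)
      = change c d g j (fst p) * ?v (semispray_coeff D L c g)
      + ?s g" .
  qed
  finally show ?thesis by (simp add: sum.distrib)
qed

definition delta :: "('m, 'e, 'v, 'k) coords \<Rightarrow> 'k \<Rightarrow> 'm \<times> 'v \<Rightarrow> ('m, 'v) prolongation_elem" where
  "delta c a p = prol_X D c a p - (\<Sum>f\<in>UNIV. canonical_N D L c a f p *\<^sub>R prol_V D c f p)"

lemma delta_sum: "(\<Sum>a\<in>UNIV. r a *\<^sub>R delta c a p) = combine c p r (\<lambda>f. - (\<Sum>a\<in>UNIV. r a * canonical_N D L c a f p))"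
proof -
  have "(\<Sum>a\<in>UNIV. r a *\<^sub>R (\<Sum>f\<in>UNIV. canonical_N D L c a f p *\<^sub>R prol_V D c f p))
    = (\<Sum>f\<in>UNIV. (\<Sum>a\<in>UNIV. r a * canonical_N D L c a f p) *\<^sub>R prol_V D c f p)"
    unfolding scaleR_sum_right scaleR_sum_left scaleR_scaleR by (rule sum.swap)
  then show ?thesis
    by (simp add: delta_def combine_def scaleR_right_diff_distrib sum_subtractf sum_negf)
qed

lemma delta_eq: "delta c a p = combine c p (\<lambda>b. if b = a then 1 else 0) (\<lambda>f. - canonical_N D L c a f p)"
proof -
  have "(\<Sum>b\<in>UNIV. (if b = a then 1 else 0) *\<^sub>R prol_X D c b p) = (\<Sum>b\<in>UNIV. if b = a then prol_X D c b p else 0)"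
    by (rule sum.cong) auto
  then show ?thesis by (simp add: delta_def combine_def sum_negf)
qed

lemma delta_in: "adapted c \<Longrightarrow> p \<in> tdom c \<Longrightarrow> delta c a p \<in> prolongation D p"
  unfolding delta_eq by (rule combine_in)

lemma canonical_N_eq:
  assumes c: "adapted c" "p \<in> tdom c"
  shows "canonical_N D L c a f p = - (1 / 2) * (snd (prol_V D c a p) (semispray_coeff D L c f)
     + (\<Sum>b\<in>UNIV. fibre_coord c b p * struct_C D c b a f (fst p)))"
  by (simp add: canonical_N_def d_y_eq[OF semispray_coeff_smooth[OF c]])

lemma canonical_N_smooth:
  assumes c: "adapted c" "p \<in> tdom c"
  shows "smooth_near TA p (canonical_N D L c a f)"
  unfolding canonical_N_def[abs_def]
  by (intro total.smooth_near_cmult total.smooth_near_add total.smooth_near_sum total.smooth_near_mult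
      d_y_smooth[OF c] semispray_coeff_smooth[OF c] fibre_coord_smooth[OF c]
      pullback_near[OF struct_C_smooth[OF c(1)] c(2)])
    (use total_dom_space[OF c(2)] total_carrier in simp)

text \<open>The inhomogeneous terms in the transformation of the derivatives of the semispray coefficients
  are symmetrised; the structure functions supply the antisymmetric part.\<close>

lemma delta_change:
  assumes c: "adapted c" "p \<in> tdom c" and d: "adapted d" "p \<in> tdom d"
  shows "delta c a p = (\<Sum>h\<in>UNIV. change c d a h (fst p) *\<^sub>R delta d h p)"
  unfolding delta_sum
proof (rule prolongation_eqI[OF d delta_in[OF c] combine_in[OF d]])
  let ?q = "fst p"
  let ?r = "combine d p (\<lambda>h. change c d a h ?q) (\<lambda>f. - (\<Sum>h\<in>UNIV. change c d a h ?q * canonical_N D L d h f p))"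
  have q: "?q \<in> coord_dom c" "?q \<in> coord_dom d" using c d by (auto simp: total_dom)
  have fd: "fst (delta c a p) = coord_frame c a ?q" by (simp add: delta_def fst_sum)
  then show "fst (delta c a p) = fst ?r"
    using change_frame[OF c(1) d(1) q] by (simp add: combine_fst)
  fix j
  define A where "A a j = change c d a j ?q" for a j
  define R where "R b g = anchor D ?q (coord_frame c b ?q) (change c d g j)" for b g
  define y where "y a = fibre_coord c a p" for a
  define N where "N g = canonical_N D L c a g p" for g
  define P where "P g = snd (prol_V D c a p) (semispray_coeff D L c g)" for g
  define C where "C b g = struct_C D c b a g ?q" for b g
  have N: "N g = - (1 / 2) * (P g + (\<Sum>b\<in>UNIV. y b * C b g))" for g
    unfolding N_def P_def y_def C_def by (rule canonical_N_eq[OF c])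
  \<comment> \<open>After reordering the sums, \<open>struct_C_change\<close> passes to the
    structure functions of \<open>c\<close> at the cost of the difference
    \<open>R a e - R e a\<close>.\<close>
  have S: "(\<Sum>h\<in>UNIV. A a h * (\<Sum>b\<in>UNIV. fibre_coord d b p * struct_C D d b h j ?q))
      = (\<Sum>e\<in>UNIV. y e * ((\<Sum>g\<in>UNIV. C e g * A g j) - R e a + R a e))"
  proof -
    have "(\<Sum>h\<in>UNIV. A a h * (\<Sum>b\<in>UNIV. fibre_coord d b p * struct_C D d b h j ?q))
      = (\<Sum>h\<in>UNIV. \<Sum>b\<in>UNIV. \<Sum>e\<in>UNIV. y e * (A e b * A a h * struct_C D d b h j ?q))"
      unfolding fibre_coord_change[OF c d]
      by (simp add: sum_distrib_left sum_distrib_right A_def y_def mult_ac)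
    also have "\<dots> = (\<Sum>b\<in>UNIV. \<Sum>h\<in>UNIV. \<Sum>e\<in>UNIV. y e * (A e b * A a h * struct_C D d b h j ?q))"
      by (rule sum.swap)
    also have "\<dots> = (\<Sum>b\<in>UNIV. \<Sum>e\<in>UNIV. \<Sum>h\<in>UNIV. y e * (A e b * A a h * struct_C D d b h j ?q))"
      by (rule sum.cong[OF refl sum.swap])
    also have "\<dots> = (\<Sum>e\<in>UNIV. \<Sum>b\<in>UNIV. \<Sum>h\<in>UNIV. y e * (A e b * A a h * struct_C D d b h j ?q))"
      by (rule sum.swap)
    also have "\<dots> = (\<Sum>e\<in>UNIV. y e * (\<Sum>b\<in>UNIV. \<Sum>h\<in>UNIV. A e b * A a h * struct_C D d b h j ?q))"
      by (simp add: sum_distrib_left)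
    also have "\<dots> = (\<Sum>e\<in>UNIV. y e * ((\<Sum>g\<in>UNIV. C e g * A g j) - R e a + R a e))"
      using struct_C_change[OF c(1) q(1) d(1) q(2)] by (simp add: A_def C_def R_def)
    finally show ?thesis .
  qed
  have V: "(\<Sum>h\<in>UNIV. A a h * snd (prol_V D d h p) (semispray_coeff D L d j))
      = (\<Sum>g\<in>UNIV. A g j * P g) + (\<Sum>g\<in>UNIV. R a g * y g) + (\<Sum>b\<in>UNIV. y b * R b a)"
  proof -
    have "(\<Sum>h\<in>UNIV. A a h * snd (prol_V D d h p) (semispray_coeff D L d j))
        = snd (prol_V D c a p) (semispray_coeff D L d j)"
      by (simp add: prol_V_change[OF c d] combine_snd A_def)
    then show ?thesis
      using semispray_coeff_change_derivative[OF c d, of a j] by (simp add: A_def P_def R_def y_def)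
  qed
  have "- (\<Sum>h\<in>UNIV. A a h * canonical_N D L d h j p)
      = (1 / 2) * ((\<Sum>h\<in>UNIV. A a h * snd (prol_V D d h p) (semispray_coeff D L d j))
      + (\<Sum>h\<in>UNIV. A a h * (\<Sum>b\<in>UNIV. fibre_coord d b p * struct_C D d b h j ?q)))"
  proof -
    have "(\<Sum>h\<in>UNIV. A a h * canonical_N D L d h j p)
        = (\<Sum>h\<in>UNIV. - (1 / 2) * (A a h * snd (prol_V D d h p) (semispray_coeff D L d j)
          + A a h * (\<Sum>b\<in>UNIV. fibre_coord d b p * struct_C D d b h j ?q)))"
      unfolding canonical_N_eq[OF d] by (rule sum.cong[OF refl]) (simp add: algebra_simps)
    then show ?thesis by (simp add: sum_distrib_left[symmetric] sum_negf sum.distrib sum_divide_distrib[symmetric])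
  qed
  \<comment> \<open>In the sum of \<open>S\<close> and \<open>V\<close> the terms with
    \<open>R b a\<close> cancel and those with \<open>R a g\<close> double; the factor 1/2 leaves
    one copy.\<close>
  also have "\<dots> = (1 / 2) * ((\<Sum>g\<in>UNIV. A g j * P g) + (\<Sum>e\<in>UNIV. y e * (\<Sum>g\<in>UNIV. C e g * A g j)))
      + (\<Sum>g\<in>UNIV. R a g * y g)"
    unfolding S V by (simp add: algebra_simps sum.distrib sum_subtractf)
  also have "(\<Sum>e\<in>UNIV. y e * (\<Sum>g\<in>UNIV. C e g * A g j)) = (\<Sum>g\<in>UNIV. A g j * (\<Sum>e\<in>UNIV. y e * C e g))"
    unfolding sum_distrib_left by (subst sum.swap) (simp add: mult_ac)
  also have "(1 / 2) * ((\<Sum>g\<in>UNIV. A g j * P g) + (\<Sum>g\<in>UNIV. A g j * (\<Sum>e\<in>UNIV. y e * C e g)))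
      = (\<Sum>g\<in>UNIV. A g j * (- N g))"
    unfolding N sum.distrib[symmetric] sum_distrib_left[where r = "1/2"]
    by (rule sum.cong[OF refl]) (simp add: algebra_simps)
  finally have "(\<Sum>g\<in>UNIV. A g j * (- N g)) + (\<Sum>g\<in>UNIV. R a g * y g) = - (\<Sum>h\<in>UNIV. A a h * canonical_N D L d h j p)"
    by simp
  \<comment> \<open>The same copy of \<open>R a g\<close> arises on the other side, from the anchor
    term of \<open>delta c a\<close>, whose first component is that of
    \<open>prol_X D c a\<close>.\<close>
  moreover have "snd (delta c a p) (fibre_coord d j) = (\<Sum>g\<in>UNIV. A g j * (- N g)) + (\<Sum>g\<in>UNIV. R a g * y g)"
    unfolding fibre_coord_change_derivative[OF c d delta_in[OF c]] fd
    by (simp add: delta_eq combine_fibre_coord[OF c] A_def N_def R_def y_def sum_subtractf sum_negf)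
  ultimately show "snd (delta c a p) (fibre_coord d j) = snd ?r (fibre_coord d j)"
    by (simp add: combine_fibre_coord[OF d] A_def)
qed

section \<open>The horizontal subbundle as a complement of the vertical one\<close>

definition horizontal :: "'m \<times> 'v \<Rightarrow> ('m, 'v) prolongation_elem set" where
  "horizontal p = span (range (\<lambda>a. delta (SOME c. adapted c \<and> p \<in> tdom c) a p))"

lemma span_delta_subset:
  assumes c: "adapted c" "p \<in> tdom c" and d: "adapted d" "p \<in> tdom d"
  shows "span (range (\<lambda>a. delta c a p)) \<subseteq> span (range (\<lambda>a. delta d a p))"
proof (rule span_minimal[OF _ subspace_span], rule image_subsetI)
  show "delta c a p \<in> span (range (\<lambda>a. delta d a p))" for a
    unfolding delta_change[OF c d] by (intro span_sum span_scale span_base rangeI)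
qed

lemma horizontal_eq:
  assumes c: "adapted c" "p \<in> tdom c"
  shows "horizontal p = span (range (\<lambda>a. delta c a p))"
proof -
  have "adapted (SOME c. adapted c \<and> p \<in> tdom c) \<and> p \<in> tdom (SOME c. adapted c \<and> p \<in> tdom c)"
    by (rule someI[of "\<lambda>c. adapted c \<and> p \<in> tdom c" c]) (use c in simp)
  then show ?thesis unfolding horizontal_def using span_delta_subset c by (intro subset_antisym) blast+
qed

lemma combine_zero: "combine c p (\<lambda>_. 0) (\<lambda>_. 0) = 0"
  by (simp add: combine_def)

text \<open>\<open>delta c a\<close> has component 1 along \<open>prol_X D c a\<close> and 0 along
  the other \<open>prol_X\<close>; this tells the vectors apart and, applied to combinations, also
  gives their independence.\<close>

lemma delta_injective:
  assumes "adapted c" "p \<in> tdom c"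
  shows "inj (\<lambda>a. delta c a p)"
proof (rule injI)
  fix a b assume "delta c a p = delta c b p"
  from combine_inject(1)[OF assms this[unfolded delta_eq], of a] show "a = b" by (simp split: if_splits)
qed

lemma independent_delta:
  assumes c: "adapted c" "p \<in> tdom c"
  shows "independent (range (\<lambda>a. delta c a p))"
proof (rule real_vector.independent_if_scalars_zero)
  fix r x assume s: "(\<Sum>x\<in>range (\<lambda>a. delta c a p). r x *\<^sub>R x) = 0" and "x \<in> range (\<lambda>a. delta c a p)"
  then obtain a where x: "x = delta c a p" by blast
  have "(\<Sum>a\<in>UNIV. r (delta c a p) *\<^sub>R delta c a p) = 0"
    using s by (simp add: sum.reindex[OF delta_injective[OF c]])
  then have "combine c p (\<lambda>a. r (delta c a p)) (\<lambda>f. - (\<Sum>a\<in>UNIV. r (delta c a p) * canonical_N D L c a f p))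
      = combine c p (\<lambda>_. 0) (\<lambda>_. 0)"
    by (simp add: delta_sum combine_zero)
  from combine_inject(1)[OF c this, of a] show "r x = 0" by (simp add: x)
qed simp

text \<open>Smoothness of a prolongation section asks for smooth components in every adapted chart,
  also in those other than \<open>c\<close>; \<open>delta_change\<close> supplies them.\<close>

lemma delta_section:
  assumes c: "adapted c"
  shows "smooth_prolongation_section D (tdom c) (delta c a)"
proof (rule smooth_prolongation_sectionI)
  show "tdom c \<subseteq> total_space D" using total_dom_space by blast
  show "delta c a p \<in> prolongation D p" if "p \<in> tdom c" for p by (rule delta_in[OF c that])
  fix d p assume d: "adapted d" and p: "p \<in> tdom c \<inter> tdom d"
  have ps: "p \<in> total_space D" using p total_dom_space by blast
  show "delta c a p = combine d p (\<lambda>b. (change c d a b \<circ> fst) p)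
      (\<lambda>f. - (\<Sum>h\<in>UNIV. (change c d a h \<circ> fst) p * canonical_N D L d h f p))"
    using delta_change[OF c _ d, of p a] p by (simp add: delta_sum)
  show A: "smooth_near TA p (change c d a b \<circ> fst)" for b
    using pullback_smooth[OF change_smooth[OF c d] ps] p by (simp add: total_dom)
  show "smooth_near TA p (\<lambda>p. - (\<Sum>h\<in>UNIV. (change c d a h \<circ> fst) p * canonical_N D L d h f p))" for f
    by (intro total.smooth_near_minus total.smooth_near_sum total.smooth_near_mult A canonical_N_smooth[OF d])
      (use p ps total_carrier in auto)
qed

lemma N_connection_horizontal: "N_connection D horizontal"
  unfolding N_connection_def smooth_subbundle_def
proof (intro conjI ballI)
  fix p assume p: "p \<in> total_space D"
  obtain c where c: "adapted c" "p \<in> tdom c" using total_cover[OF p] .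
  show "\<exists>W \<Z>. openin (atlas_topology TA) W \<and> p \<in> W \<and> finite \<Z> \<and>
        (\<forall>Z\<in>\<Z>. smooth_prolongation_section D W Z) \<and>
        (\<forall>p'\<in>W. inj_on (\<lambda>Z. Z p') \<Z> \<and> independent ((\<lambda>Z. Z p') ` \<Z>) \<and>
           horizontal p' = span ((\<lambda>Z. Z p') ` \<Z>))"
  proof (intro exI conjI ballI)
    show "openin (atlas_topology TA) (tdom c)" by (rule total_openin[OF c(1)])
    show "p \<in> tdom c" by (rule c(2))
    show "finite (range (delta c))" by simp
    show "smooth_prolongation_section D (tdom c) Z" if "Z \<in> range (delta c)" for Z
      using that delta_section[OF c(1)] by blast
    fix p' assume p': "p' \<in> tdom c"
    have img: "(\<lambda>Z. Z p') ` range (delta c) = range (\<lambda>a. delta c a p')" by (simp add: image_image)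
    show "inj_on (\<lambda>Z. Z p') (range (delta c))"
      using delta_injective[OF c(1) p'] by (auto simp: inj_on_def)
    show "independent ((\<lambda>Z. Z p') ` range (delta c))"
      unfolding img by (rule independent_delta[OF c(1) p'])
    show "horizontal p' = span ((\<lambda>Z. Z p') ` range (delta c))"
      unfolding img by (rule horizontal_eq[OF c(1) p'])
  qed
  have H: "horizontal p = span (range (\<lambda>a. delta c a p))" by (rule horizontal_eq[OF c])
  have V: "vertical D p = span (range (\<lambda>a. prol_V D c a p))" by (rule vertical_eq[OF c])
  note sub = subspace_prolongation[OF p]
  show "prolongation D p = {h + v | h v. h \<in> horizontal p \<and> v \<in> vertical D p}"
  proof (intro subset_antisym subsetI)
    fix z assume z: "z \<in> prolongation D p"
    define \<xi> where "\<xi> = (\<lambda>a. frame_coords (coord_frame c) (fst p) (fst z) $ a)"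
    define \<eta> where "\<eta> = (\<lambda>a. snd z (fibre_coord c a))"
    let ?h = "\<Sum>a\<in>UNIV. \<xi> a *\<^sub>R delta c a p"
    \<comment> \<open>The vertical remainder is \<open>\<eta>\<close> corrected by the vertical part
      that \<open>?h\<close> carries through \<open>canonical_N\<close>.\<close>
    let ?v = "\<Sum>f\<in>UNIV. (\<eta> f + (\<Sum>a\<in>UNIV. \<xi> a * canonical_N D L c a f p)) *\<^sub>R prol_V D c f p"
    have "z = combine c p \<xi> \<eta>" unfolding \<xi>_def \<eta>_def by (rule prolongation_combine[OF c z])
    also have "\<dots> = ?h + ?v"
      unfolding delta_sum by (simp add: combine_def scaleR_left_distrib sum.distrib sum_negf)
    finally have "z = ?h + ?v" .
    moreover have "?h \<in> horizontal p" unfolding H by (intro span_sum span_scale span_base rangeI)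
    moreover have "?v \<in> vertical D p" unfolding V by (intro span_sum span_scale span_base rangeI)
    ultimately show "z \<in> {h + v | h v. h \<in> horizontal p \<and> v \<in> vertical D p}" by blast
  next
    fix z assume "z \<in> {h + v | h v. h \<in> horizontal p \<and> v \<in> vertical D p}"
    then obtain h v where z: "z = h + v" "h \<in> horizontal p" "v \<in> vertical D p" by blast
    have "horizontal p \<subseteq> prolongation D p" "vertical D p \<subseteq> prolongation D p"
      unfolding H V using delta_in[OF c] prol_V_in[OF c] by (intro span_minimal[OF _ sub]; blast)+
    then show "z \<in> prolongation D p" using z subspace_add[OF sub] by blast
  qed
  show "horizontal p \<inter> vertical D p = {0}"
  proof (intro subset_antisym subsetI)
    fix z assume z: "z \<in> horizontal p \<inter> vertical D p"
    obtain r where r: "z = (\<Sum>a\<in>UNIV. r a *\<^sub>R delta c a p)"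
      using span_range_obtain[of z "\<lambda>a. delta c a p"] z H by blast
    obtain s where s: "z = (\<Sum>a\<in>UNIV. s a *\<^sub>R prol_V D c a p)"
      using span_range_obtain[of z "\<lambda>a. prol_V D c a p"] z V by blast
    \<comment> \<open>A vertical vector has no components along \<open>prol_X\<close>, while for a
      combination of the \<open>delta c a\<close> these components are its coefficients
      \<open>r\<close>.\<close>
    have "combine c p r (\<lambda>f. - (\<Sum>a\<in>UNIV. r a * canonical_N D L c a f p)) = combine c p (\<lambda>_. 0) s"
      using r s by (simp add: delta_sum) (simp add: combine_def)
    from combine_inject(1)[OF c this] show "z \<in> {0}" by (simp add: r)
  qed (simp add: H V span_zero)
qed

lemma N_coefficients_horizontal:
  "adapted c \<Longrightarrow> N_coefficients D horizontal c (canonical_N D L c)"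
  unfolding N_coefficients_def using horizontal_eq by (simp add: delta_def)

end

theorem theorem2p4:
  fixes D :: "('m, 'e::real_inner, 'v::real_vector, 'k::finite) algebroid"
    and L :: "'m \<times> 'v \<Rightarrow> real"
  assumes "lie_algebroid D"
    and "regular_lagrangian D L"
  shows "\<exists>\<Gamma> H.
    semispray D \<Gamma> \<and>
    (\<forall>c\<in>adapted_coords D. \<forall>p\<in>fst (total_chart D c).
       \<Gamma> p = (\<Sum>a\<in>UNIV. fibre_coord c a p *\<^sub>R prol_X D c a p)
             + (\<Sum>a\<in>UNIV. semispray_coeff D L c a p *\<^sub>R prol_V D c a p)) \<and>
    (\<forall>J \<gamma>. integral_curve D (\<lambda>p. prolongation_anchor (\<Gamma> p)) J \<gamma> \<longleftrightarrow>
            euler_lagrange_solution D L J \<gamma>) \<and>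
    N_connection D H \<and>
    (\<forall>c\<in>adapted_coords D. N_coefficients D H c (canonical_N D L c))"
proof -
  interpret lagrangian D L by unfold_locales (rule assms)+
  show ?thesis
    using semispray_canonical_semispray integral_curve_iff N_connection_horizontal N_coefficients_horizontal
      canonical_semispray_eq[unfolded semispray_in_chart_def combine_def]
    by (intro exI[of _ canonical_semispray] exI[of _ horizontal]) blast
qed

end
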